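(* The map $G\mapsto p_G(x)=\sum_{k\ge0}b_k(G)x^k$, assigning to an element of the strong ring its Poincaré polynomial, is a ring homomorphism from the strong ring to $\mathbb{Z}[x]$.
   Context: A finite abstract simplicial complex is a finite set of finite non-empty sets which is closed under taking non-empty subsets; $\dim(x)=|x|-1$. A product complex is a finite Cartesian product $G_1\times\cdots\times G_n$ ($n\ge 1$) of finite abstract simplicial complexes; its cells are the sets $x=x_1\times\cdots\times x_n$ with $x_i\in G_i$, and $\dim(x)=\sum_i\dim(x_i)$. Two product complexes are isomorphic if there is a bijection between their cells preserving inclusion in both directions. A signed complex is a finite formal disjoint union of product complexes, each summand carrying a sign in $\{1,-1\}$. Addition is disjoint union, $-G$ reverses all signs, and products are taken term by term with signs multiplied. The strong ring is the commutative ring of signed complexes modulo isomorphism of summands, splitting of summands into connected components (with the same sign), and cancellation of $G\oplus(-G)$; its zero is the empty complex and its one is the one-point complex $K_1$. Fix an orientation of each simplex of a simplicial complex, with boundary operation $\delta$. The exterior derivative of a simplicial complex acts on real functions on its simplices by $df(x)=f(\delta x)$; for a product of two complexes it is $df(x,y)=f(\delta_1x,y)+(-1)^{\dim(x)}f(x,\delta_2y)$, and iteratively for more factors. With $d_k$ the restriction of $d$ to functions on $k$-dimensional cells, the Betti number of a product complex is $b_k(G)=\dim(\ker d_k/\mathrm{im}\,d_{k-1})$, equal to the dimension of the kernel of the block $H_k$ of $H=(d+d^* )^2$ acting on functions on $k$-dimensional cells. For a signed complex with summands $G_i$ and signs $\varepsilon_i$, $b_k(G)=\sum_i\varepsilon_ib_k(G_i)$.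 *)

theory Defs
  imports
    "HOL-Algebra.Algebraic_Closure_Type"
    "HOL-Combinatorics.Permutations"
    "HOL-Library.Multiset"
begin

definition simplicial_complex :: "'a set set \<Rightarrow> bool" where
  "simplicial_complex K \<longleftrightarrow>
     finite K \<and> (\<forall>x\<in>K. finite x \<and> x \<noteq> {}) \<and>
     (\<forall>x\<in>K. \<forall>y. y \<subseteq> x \<and> y \<noteq> {} \<longrightarrow> y \<in> K)"

text \<open>A product complex is given by the list of its factors.\<close>

definition product_complex :: "'a set set list \<Rightarrow> bool" where
  "product_complex Gs \<longleftrightarrow> Gs \<noteq> [] \<and> (\<forall>K\<in>set Gs. simplicial_complex K)"

text \<open>
  The tuples of simplices \<open>[x\<^sub>1, \<dots>, x\<^sub>n]\<close> with \<open>x\<^sub>i \<in> G\<^sub>i\<close> are the elements of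
  \<open>listset Gs\<close>. The cell described by such a tuple is the Cartesian product
  \<open>listset [x\<^sub>1, \<dots>, x\<^sub>n]\<close>, a set of lists of vertices. As all \<open>x\<^sub>i\<close> are non-empty,
  the tuple can be recovered from the cell. Inclusion and connectedness are formulated for
  cells as sets, cochains for tuples.
\<close>

definition cells :: "'a set set list \<Rightarrow> 'a list set set" where
  "cells Gs = listset ` listset Gs"

definition cell_dim :: "'a set list \<Rightarrow> nat" where
  "cell_dim xs = (\<Sum>x\<leftarrow>xs. card x - 1)"

definition isomorphic_complexes :: "'a set set list \<Rightarrow> 'a set set list \<Rightarrow> bool" where
  "isomorphic_complexes Gs Hs \<longleftrightarrow>
     (\<exists>f. bij_betw f (cells Gs) (cells Hs) \<and>
          (\<forall>x\<in>cells Gs. \<forall>y\<in>cells Gs. x \<subseteq> y \<longleftrightarrow> f x \<subseteq> f y))"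

text \<open>
  Two cells are in the same connected component if they are joined by a chain of cells in which
  of any two consecutive cells one contains the other. Each component is the set of cells of
  exactly one product complex.
\<close>

definition comparable_cells :: "'a set set list \<Rightarrow> ('a list set \<times> 'a list set) set" where
  "comparable_cells Gs = {(x, y). x \<in> cells Gs \<and> y \<in> cells Gs \<and> (x \<subseteq> y \<or> y \<subseteq> x)}"

definition connected_components :: "'a set set list \<Rightarrow> 'a set set list set" where
  "connected_components Gs =
     {Cs. product_complex Cs \<and> cells Cs \<in> cells Gs // (comparable_cells Gs)\<^sup>*}"


section \<open>Cohomology\<close>

text \<open>
  An orientation of a simplex is represented by an enumeration of its vertices. It may depend
  on the complex in which the simplex lies.
\<close>

definition is_orientation :: "('a set set \<Rightarrow> 'a set \<Rightarrow> 'a list) \<Rightarrow> bool" where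
  "is_orientation ori \<longleftrightarrow>
     (\<forall>K. simplicial_complex K \<longrightarrow> (\<forall>x\<in>K. distinct (ori K x) \<and> set (ori K x) = x))"

text \<open>The sign of the permutation relating two enumerations of the same set.\<close>

definition enum_sign :: "'a list \<Rightarrow> 'a list \<Rightarrow> int" where
  "enum_sign us vs = sign (THE p. p permutes set us \<and> map p us = vs)"

text \<open>
  The value \<open>f (\<delta> x)\<close> of the linear extension of \<open>f\<close> on the boundary
  \<open>\<Sum>\<^sub>i (-1)\<^sup>i [v\<^sub>0, \<dots>, v\<^sub>i\<^sub>-\<^sub>1, v\<^sub>i\<^sub>+\<^sub>1, \<dots>, v\<^sub>k]\<close> of the oriented simplex
  \<open>x = [v\<^sub>0, \<dots>, v\<^sub>k]\<close>, each face being compared with its own orientation.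
  The condition on \<open>i\<close> only excludes the empty face of a vertex.
\<close>

definition eval_boundary ::
  "('a set set \<Rightarrow> 'a set \<Rightarrow> 'a list) \<Rightarrow> 'a set set \<Rightarrow> ('a set \<Rightarrow> real) \<Rightarrow> 'a set \<Rightarrow> real" where
  "eval_boundary ori K f x =
     (let vs = ori K x in
      \<Sum>i | i < length vs \<and> x - {vs ! i} \<in> K.
        (-1) ^ i * of_int (enum_sign (remove1 (vs ! i) vs) (ori K (x - {vs ! i})))
          * f (x - {vs ! i}))"

fun ext_deriv ::
  "('a set set \<Rightarrow> 'a set \<Rightarrow> 'a list) \<Rightarrow> 'a set set list \<Rightarrow> ('a set list \<Rightarrow> real)
    \<Rightarrow> 'a set list \<Rightarrow> real" where
  "ext_deriv ori (K # Gs) f (x # xs) =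
     eval_boundary ori K (\<lambda>y. f (y # xs)) x
       + (-1) ^ (card x - 1) * ext_deriv ori Gs (\<lambda>ys. f (x # ys)) xs"
| "ext_deriv ori _ f _ = 0"

text \<open>Real functions on a set of cells are functions on all lists that vanish elsewhere.\<close>

definition functions_on :: "'c set \<Rightarrow> ('c \<Rightarrow> real) set" where
  "functions_on S = {f. \<forall>x. x \<notin> S \<longrightarrow> f x = 0}"

definition coboundary ::
  "('a set set \<Rightarrow> 'a set \<Rightarrow> 'a list) \<Rightarrow> 'a set set list \<Rightarrow> ('a set list \<Rightarrow> real)
    \<Rightarrow> 'a set list \<Rightarrow> real" where
  "coboundary ori Gs f = (\<lambda>xs. if xs \<in> listset Gs then ext_deriv ori Gs f xs else 0)"

definition cocycles ::
  "('a set set \<Rightarrow> 'a set \<Rightarrow> 'a list) \<Rightarrow> nat \<Rightarrow> 'a set set list \<Rightarrow> ('a set list \<Rightarrow> real) set" where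
  "cocycles ori k Gs =
     {f \<in> functions_on {xs \<in> listset Gs. cell_dim xs = k}. coboundary ori Gs f = (\<lambda>_. 0)}"

text \<open>For \<open>k = 0\<close> the space of functions on cells of dimension \<open>k - 1\<close> is the zero space.\<close>

definition coboundaries ::
  "('a set set \<Rightarrow> 'a set \<Rightarrow> 'a list) \<Rightarrow> nat \<Rightarrow> 'a set set list \<Rightarrow> ('a set list \<Rightarrow> real) set" where
  "coboundaries ori k Gs =
     coboundary ori Gs ` functions_on {xs \<in> listset Gs. Suc (cell_dim xs) = k}"

text \<open>
  \<open>B\<close> is a set of representatives of a finite basis of the quotient space \<open>V / W\<close>,
  for subspaces \<open>W \<subseteq> V\<close> of a space of real functions.
\<close>

definition quotient_basis ::
  "('c \<Rightarrow> real) set \<Rightarrow> ('c \<Rightarrow> real) set \<Rightarrow> ('c \<Rightarrow> real) set \<Rightarrow> bool" where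
  "quotient_basis V W B \<longleftrightarrow>
     finite B \<and> B \<subseteq> V \<and>
     (\<forall>c. (\<lambda>x. \<Sum>b\<in>B. c b * b x) \<in> W \<longrightarrow> (\<forall>b\<in>B. c b = 0)) \<and>
     (\<forall>f\<in>V. \<exists>c. (\<lambda>x. f x - (\<Sum>b\<in>B. c b * b x)) \<in> W)"

definition quotient_dim :: "('c \<Rightarrow> real) set \<Rightarrow> ('c \<Rightarrow> real) set \<Rightarrow> nat" where
  "quotient_dim V W = (THE n. \<exists>B. quotient_basis V W B \<and> card B = n)"

definition betti :: "('a set set \<Rightarrow> 'a set \<Rightarrow> 'a list) \<Rightarrow> nat \<Rightarrow> 'a set set list \<Rightarrow> nat" where
  "betti ori k Gs = quotient_dim (cocycles ori k Gs) (coboundaries ori k Gs)"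


section \<open>The strong ring\<close>

type_synonym 'a signed_complex = "(int \<times> 'a set set list) multiset"

definition is_signed_complex :: "'a signed_complex \<Rightarrow> bool" where
  "is_signed_complex A \<longleftrightarrow> (\<forall>(s, Gs) \<in># A. s \<in> {1, -1} \<and> product_complex Gs)"

definition signed_minus :: "'a signed_complex \<Rightarrow> 'a signed_complex" where
  "signed_minus A = image_mset (\<lambda>(s, Gs). (- s, Gs)) A"

definition signed_times :: "'a signed_complex \<Rightarrow> 'a signed_complex \<Rightarrow> 'a signed_complex" where
  "signed_times A B = (\<Sum>(s, Gs) \<in># A. image_mset (\<lambda>(t, Hs). (s * t, Gs @ Hs)) B)"

text \<open>The one-point complex; the choice of the vertex is irrelevant up to isomorphism.\<close>

definition one_point :: "'a set set" where
  "one_point = {{undefined}}"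

text \<open>
  The elementary identifications. A summand without cells has no connected
  components, so splitting identifies it with the empty sum.
\<close>

inductive strong_step :: "'a signed_complex \<Rightarrow> 'a signed_complex \<Rightarrow> bool" where
  isomorphism:
    "\<lbrakk>is_signed_complex A; s \<in> {1, -1}; product_complex Gs; product_complex Hs;
      isomorphic_complexes Gs Hs\<rbrakk>
     \<Longrightarrow> strong_step (A + {#(s, Gs)#}) (A + {#(s, Hs)#})"
| splitting:
    "\<lbrakk>is_signed_complex A; s \<in> {1, -1}; product_complex Gs\<rbrakk>
     \<Longrightarrow> strong_step (A + {#(s, Gs)#})
           (A + image_mset (\<lambda>Cs. (s, Cs)) (mset_set (connected_components Gs)))"
| cancellation:
    "\<lbrakk>is_signed_complex A; is_signed_complex B\<rbrakk>
     \<Longrightarrow> strong_step (A + (B + signed_minus B)) A"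

definition strong_class :: "'a signed_complex \<Rightarrow> 'a signed_complex set" where
  "strong_class A = {B. equivclp strong_step A B}"

text \<open>
  The operations on classes are those induced by the operations on representatives: the unions
  below are unions of equal classes.
\<close>

definition strong_ring :: "'a signed_complex set ring" where
  "strong_ring =
     \<lparr>carrier = strong_class ` {A. is_signed_complex A},
      monoid.mult = (\<lambda>P Q. \<Union>A\<in>P. \<Union>B\<in>Q. strong_class (signed_times A B)),
      one = strong_class {#(1, [one_point])#},
      ring.zero = strong_class {#},
      add = (\<lambda>P Q. \<Union>A\<in>P. \<Union>B\<in>Q. strong_class (A + B))\<rparr>"


section \<open>The Poincare polynomial\<close>

definition signed_betti ::
  "('a set set \<Rightarrow> 'a set \<Rightarrow> 'a list) \<Rightarrow> nat \<Rightarrow> 'a signed_complex \<Rightarrow> int" where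
  "signed_betti ori k A = (\<Sum>(s, Gs) \<in># A. s * int (betti ori k Gs))"

definition poincare_poly ::
  "('a set set \<Rightarrow> 'a set \<Rightarrow> 'a list) \<Rightarrow> 'a signed_complex \<Rightarrow> int poly" where
  "poincare_poly ori A =
     (\<Sum>k | signed_betti ori k A \<noteq> 0. Polynomial.monom (signed_betti ori k A) k)"

definition poincare_map ::
  "('a set set \<Rightarrow> 'a set \<Rightarrow> 'a list) \<Rightarrow> 'a signed_complex set \<Rightarrow> int poly" where
  "poincare_map ori P = the_elem (poincare_poly ori ` P)"

end

theory Submission
  imports Defs
begin

text \<open>
  Three facts about the Betti numbers of product complexes carry the theorem. As polynomials they
  multiply under products (\<open>betti_poly_append\<close>), they add over connected components
  (\<open>betti_poly_components\<close>), and they depend only on the poset of cells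
  (\<open>betti_poly_isomorphic\<close>). Together they say that the signed Poincare polynomial respects sums,
  products and the three identifications of the strong ring.

  All three are read off from one matrix. Let \<open>M\<close> be the incidence matrix of the exterior derivative
  and \<open>D\<close> the sum of \<open>M\<close> and its transpose, so that \<open>H\<close> is the square of \<open>D\<close>. By Hodge theory the
  \<open>k\<close>-th Betti number is the trace, over the cells of dimension \<open>k\<close>, of the orthogonal projection
  \<open>P\<close> onto the kernel of \<open>D\<close> (\<open>quotient_dim_eq_trace\<close>). The entries of \<open>P\<close> are
  characterised by a reproducing property (\<open>harmonic_kernel\<close>), which makes \<open>P\<close> computable. On a
  product, \<open>D f\<close> is a sum of two orthogonal parts, one for each factor, so a function is harmonic iff
  it is harmonic in each variable, and \<open>P\<close> is the tensor product of the two projections. On a disjoint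
  union \<open>P\<close> is block diagonal. Relabelling the cells and changing the signs of some of them conjugates
  \<open>P\<close> and keeps its diagonal.

  It remains to see that the incidence matrix is determined by the poset of cells up to such sign
  changes. Two incidence matrices with the same support differ by signs \<open>r x y\<close>, one for each
  facet \<open>y\<close> of a cell \<open>x\<close>, whose product around every diamond of four cells is \<open>1\<close>. As two facets
  of a cell of dimension at least two are joined by a chain of facets, consecutive ones of which have
  a facet in common, the equation \<open>r x y = \<epsilon> x * \<epsilon> y\<close> can be solved by recursion on the dimension (\<open>gauge_equivalence\<close>). The
  properties of cell posets used here are collected in the locale \<open>oriented_cells\<close>; they hold for
  simplicial complexes and pass to products and disjoint unions. The same uniqueness takes care of the
  orientations, which the components of a complex need not inherit from it.

  For the ring structure, the one point that is not formal is that multiplication respects the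
  splitting into components. This holds because the components of a product are the products of the
  components of its factors (\<open>components_append\<close>).
\<close>

section \<open>Linear algebra of real functions\<close>

text \<open>
  Induction on the number of equations: an equation in which the unknown \<open>p\<close> occurs is solved for \<open>p\<close>,
  and the result is substituted into the others.
\<close>

lemma underdetermined_system:
  fixes a :: "'i \<Rightarrow> 'j \<Rightarrow> real"
  assumes "finite J" "finite I" "card J < card I"
  shows "\<exists>c. (\<exists>i\<in>I. c i \<noteq> 0) \<and> (\<forall>j\<in>J. (\<Sum>i\<in>I. c i * a i j) = 0)"
  using assms
proof (induction J arbitrary: I a rule: finite_induct)
  case empty
  then have "I \<noteq> {}" by auto
  then show ?case by (intro exI[of _ "\<lambda>_. 1"]) auto
next
  case (insert j J)
  show ?case
  proof (cases "\<forall>i\<in>I. a i j = 0")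
    case True
    have "card J < card I" using insert.hyps insert.prems by simp
    with insert.IH insert.prems
    obtain c where "\<exists>i\<in>I. c i \<noteq> 0" "\<forall>j\<in>J. (\<Sum>i\<in>I. c i * a i j) = 0"
      by blast
    with True show ?thesis by (intro exI[of _ c]) auto
  next
    case False
    (* The unknown p is eliminated with the help of equation j. *)
    then obtain p where p: "p \<in> I" "a p j \<noteq> 0" by blast
    define a' where "a' i k = a i k - a i j / a p j * a p k" for i k
    have "card J < card (I - {p})"
      using insert p by simp
    then obtain c where c: "\<exists>i\<in>I-{p}. c i \<noteq> 0" "\<forall>k\<in>J. (\<Sum>i\<in>I-{p}. c i * a' i k) = 0"
      using insert.IH[of "I - {p}" a'] insert.prems by blast
    define e where "e i = (if i = p then - (\<Sum>i\<in>I-{p}. c i * a i j) / a p j else c i)" for i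
    have split: "(\<Sum>i\<in>I. e i * a i k) = e p * a p k + (\<Sum>i\<in>I-{p}. c i * a i k)" for k
    proof -
      have "(\<Sum>i\<in>I-{p}. e i * a i k) = (\<Sum>i\<in>I-{p}. c i * a i k)"
        by (intro sum.cong) (auto simp: e_def)
      then show ?thesis using insert.prems(1) p by (simp add: sum.remove)
    qed
    have "(\<Sum>i\<in>I. e i * a i j) = 0"
      unfolding split using p by (simp add: e_def)
    moreover have "(\<Sum>i\<in>I. e i * a i k) = 0" if "k \<in> J" for k
    proof -
      have "0 = (\<Sum>i\<in>I-{p}. c i * a' i k)" using c that by simp
      also have "\<dots> = (\<Sum>i\<in>I-{p}. c i * a i k) - (\<Sum>i\<in>I-{p}. c i * a i j) / a p j * a p k"
        by (simp add: a'_def algebra_simps sum_subtractf sum_divide_distrib sum_distrib_left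
            sum_distrib_right)
      finally show ?thesis unfolding split by (simp add: e_def)
    qed
    moreover have "\<exists>i\<in>I. e i \<noteq> 0" using c by (auto simp: e_def)
    ultimately show ?thesis by (intro exI[of _ e]) auto
  qed
qed

definition linear_subspace :: "('c \<Rightarrow> real) set \<Rightarrow> bool" where
  "linear_subspace U \<longleftrightarrow> (\<lambda>_. 0) \<in> U \<and> (\<forall>f\<in>U. \<forall>g\<in>U. \<forall>c. (\<lambda>x. f x + c * g x) \<in> U)"

lemma linear_subspaceD:
  assumes "linear_subspace U"
  shows "(\<lambda>_. 0) \<in> U" "f \<in> U \<Longrightarrow> g \<in> U \<Longrightarrow> (\<lambda>x. f x + c * g x) \<in> U"
    "f \<in> U \<Longrightarrow> (\<lambda>x. c * f x) \<in> U"
    "f \<in> U \<Longrightarrow> g \<in> U \<Longrightarrow> (\<lambda>x. f x - g x) \<in> U"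
proof -
  show 1: "(\<lambda>_. 0) \<in> U" and 2: "f \<in> U \<Longrightarrow> g \<in> U \<Longrightarrow> (\<lambda>x. f x + c * g x) \<in> U" for f g c
    using assms unfolding linear_subspace_def by blast+
  from 2[OF 1, of f c] show "f \<in> U \<Longrightarrow> (\<lambda>x. c * f x) \<in> U" by simp
  from 2[of f g "-1"] show "f \<in> U \<Longrightarrow> g \<in> U \<Longrightarrow> (\<lambda>x. f x - g x) \<in> U" by simp
qed

lemma linear_subspace_sum:
  assumes "linear_subspace U" "finite B" "\<And>b. b \<in> B \<Longrightarrow> f b \<in> U"
  shows "(\<lambda>x. \<Sum>b\<in>B. c b * f b x) \<in> U"
  using assms(2,3)
proof (induction B rule: finite_induct)
  case empty
  then show ?case using linear_subspaceD(1)[OF assms(1)] by simp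
next
  case (insert b B)
  then have "(\<lambda>x. (\<Sum>b\<in>B. c b * f b x) + c b * f b x) \<in> U"
    by (intro linear_subspaceD(2)[OF assms(1)]) auto
  then show ?case using insert by (simp add: add.commute)
qed

text \<open>
  If \<open>A\<close> were larger than \<open>B\<close>, expressing its elements through \<open>B\<close> modulo \<open>W\<close> would give an
  underdetermined system, and a nontrivial solution of it is a relation within \<open>A\<close> modulo \<open>W\<close>.
\<close>

lemma quotient_basis_card_le:
  assumes W: "linear_subspace W" and A: "quotient_basis V W A" and B: "quotient_basis V W B"
  shows "card A \<le> card B"
proof (rule ccontr)
  assume "\<not> card A \<le> card B"
  have fin: "finite A" "finite B" using A B by (auto simp: quotient_basis_def)
  have "\<forall>a\<in>A. \<exists>c. (\<lambda>x. a x - (\<Sum>b\<in>B. c b * b x)) \<in> W"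
    using A B unfolding quotient_basis_def by blast
  then have "\<exists>m. \<forall>a\<in>A. (\<lambda>x. a x - (\<Sum>b\<in>B. m a b * b x)) \<in> W"
    by (rule bchoice)
  then obtain m where m: "\<And>a. a \<in> A \<Longrightarrow> (\<lambda>x. a x - (\<Sum>b\<in>B. m a b * b x)) \<in> W"
    by blast
  obtain c where c: "\<exists>a\<in>A. c a \<noteq> 0" "\<forall>b\<in>B. (\<Sum>a\<in>A. c a * m a b) = 0"
    using underdetermined_system[OF fin(2,1), of m] \<open>\<not> card A \<le> card B\<close> by auto
  have "(\<lambda>x. \<Sum>a\<in>A. c a * (a x - (\<Sum>b\<in>B. m a b * b x))) \<in> W"
    using linear_subspace_sum[OF W fin(1), of "\<lambda>a x. a x - (\<Sum>b\<in>B. m a b * b x)" c] m by simp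
  moreover have "(\<Sum>a\<in>A. c a * (a x - (\<Sum>b\<in>B. m a b * b x))) = (\<Sum>a\<in>A. c a * a x)" for x
  proof -
    have "(\<Sum>a\<in>A. c a * (\<Sum>b\<in>B. m a b * b x)) = (\<Sum>b\<in>B. (\<Sum>a\<in>A. c a * m a b) * b x)"
      by (simp add: sum_distrib_left sum_distrib_right mult.assoc) (rule sum.swap)
    also have "\<dots> = 0" using c by simp
    finally show ?thesis by (simp add: right_diff_distrib sum_subtractf)
  qed
  ultimately have "(\<lambda>x. \<Sum>a\<in>A. c a * a x) \<in> W" by simp
  with A c show False unfolding quotient_basis_def by blast
qed

lemma quotient_dim_eq_card:
  assumes "linear_subspace W" "quotient_basis V W B"
  shows "quotient_dim V W = card B"
  unfolding quotient_dim_def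
  by (rule the_equality) (use assms quotient_basis_card_le in \<open>blast intro: le_antisym\<close>)+

text \<open>
  Orthonormality is with respect to the standard inner product of functions on \<open>S\<close>. It makes the
  coefficients of an expansion explicit, so that projections can be written down.
\<close>

definition orthonormal_basis :: "'c set \<Rightarrow> ('c \<Rightarrow> real) set \<Rightarrow> ('c \<Rightarrow> real) set \<Rightarrow> bool" where
  "orthonormal_basis S U B \<longleftrightarrow>
     finite B \<and> B \<subseteq> U \<and>
     (\<forall>a\<in>B. \<forall>b\<in>B. (\<Sum>x\<in>S. a x * b x) = of_bool (a = b)) \<and>
     (\<forall>f\<in>U. \<forall>x. f x = (\<Sum>b\<in>B. (\<Sum>y\<in>S. f y * b y) * b x))"

lemma inner_sum_left:
  fixes c :: "'b \<Rightarrow> real"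
  shows "(\<Sum>x\<in>S. (\<Sum>b\<in>B. c b * f b x) * a x) = (\<Sum>b\<in>B. c b * (\<Sum>x\<in>S. f b x * a x))"
  by (simp add: sum_distrib_left sum_distrib_right mult.assoc) (rule sum.swap)

lemma inner_orthonormal_sum:
  assumes "finite B" "\<forall>a\<in>B. \<forall>b\<in>B. (\<Sum>x\<in>S. a x * b x) = of_bool (a = b)" "a \<in> B"
  shows "(\<Sum>x\<in>S. (\<Sum>b\<in>B. c b * b x) * a x) = (c a :: real)"
proof -
  have "(\<Sum>x\<in>S. (\<Sum>b\<in>B. c b * b x) * a x) = (\<Sum>b\<in>B. c b * (\<Sum>x\<in>S. b x * a x))"
    by (rule inner_sum_left)
  also have "\<dots> = (\<Sum>b\<in>B. if b = a then c b else 0)"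
    using assms by (intro sum.cong) auto
  finally show ?thesis using assms by simp
qed

text \<open>
  Gram-Schmidt, one point of \<open>S\<close> at a time: the functions in \<open>U\<close> that vanish at the new point \<open>s\<close>
  form a subspace \<open>U'\<close> of codimension at most one.
\<close>

lemma orthonormal_basis_exists:
  assumes "finite S" "linear_subspace U" "U \<subseteq> functions_on S"
  shows "\<exists>B. orthonormal_basis S U B"
  using assms
proof (induction S arbitrary: U rule: finite_induct)
  case empty
  then have "U = {\<lambda>_. 0}"
    using linear_subspaceD(1) by (fastforce simp: functions_on_def)
  then show ?case by (intro exI[of _ "{}"]) (simp add: orthonormal_basis_def)
next
  case (insert s S)
  note U = linear_subspaceD[OF insert.prems(1)]
  define U' where "U' = {f \<in> U. f s = 0}"
  have "linear_subspace U'"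
    using insert.prems(1) by (auto simp: linear_subspace_def U'_def)
  moreover have "U' \<subseteq> functions_on S"
    using insert.prems(2) by (fastforce simp: functions_on_def U'_def)
  ultimately obtain B where B: "orthonormal_basis S U' B" using insert.IH by blast
  have Bs: "b s = 0" "b \<in> U" if "b \<in> B" for b
    using B that by (auto simp: orthonormal_basis_def U'_def)
  have inner: "(\<Sum>x\<in>insert s S. f x * b x) = (\<Sum>x\<in>S. f x * b x)" if "b \<in> B" for f b
    using insert.hyps Bs[OF that] by simp
  have finB: "finite B" and onB: "\<forall>a\<in>B. \<forall>b\<in>B. (\<Sum>x\<in>S. a x * b x) = of_bool (a = b)"
    and expB: "\<And>f x. f \<in> U' \<Longrightarrow> f x = (\<Sum>b\<in>B. (\<Sum>y\<in>S. f y * b y) * b x)"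
    using B by (auto simp: orthonormal_basis_def)
  show ?case
  proof (cases "U = U'")
    case True
    then show ?thesis using B inner by (intro exI[of _ B]) (simp add: orthonormal_basis_def)
  next
    case False
    then obtain f where f: "f \<in> U" "f s \<noteq> 0" by (auto simp: U'_def)
    define g where "g = (\<lambda>x. f x - (\<Sum>b\<in>B. (\<Sum>y\<in>S. f y * b y) * b x))"
    have "g \<in> U" unfolding g_def
      using Bs by (intro U(4) f linear_subspace_sum[OF insert.prems(1) finB]) auto
    have "(\<Sum>b\<in>B. (\<Sum>y\<in>S. f y * b y) * b s) = 0"
      using Bs by (intro sum.neutral) auto
    then have gs: "g s \<noteq> 0" using f by (simp add: g_def)
    have gb: "(\<Sum>x\<in>insert s S. g x * b x) = 0" if "b \<in> B" for b
    proof -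
      have "(\<Sum>x\<in>S. g x * b x) = (\<Sum>x\<in>S. f x * b x) - (\<Sum>y\<in>S. f y * b y)"
        using inner_orthonormal_sum[OF finB onB that, of "\<lambda>b. \<Sum>y\<in>S. f y * b y"]
        by (simp add: g_def left_diff_distrib sum_subtractf)
      then show ?thesis using inner[OF that, of g] by simp
    qed
    (* The new basis element is the normalised part of f orthogonal to B. *)
    define N where "N = (\<Sum>x\<in>insert s S. g x * g x)"
    have "N > 0" unfolding N_def using insert.hyps gs
      by (intro sum_pos2[of _ s]) (auto simp: zero_less_mult_iff linorder_neq_iff)
    define e where "e = (\<lambda>x. g x / sqrt N)"
    have eU: "e \<in> U" using U(3)[OF \<open>g \<in> U\<close>, of "1 / sqrt N"] by (simp add: e_def)
    have es: "e s \<noteq> 0" using gs \<open>N > 0\<close> by (simp add: e_def)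
    have ee: "(\<Sum>x\<in>insert s S. e x * e x) = 1"
    proof -
      have "(\<Sum>x\<in>insert s S. e x * e x) = (\<Sum>x\<in>insert s S. g x * g x) / (sqrt N * sqrt N)"
        unfolding e_def sum_divide_distrib by (intro sum.cong) auto
      then show ?thesis using \<open>N > 0\<close> by (simp add: N_def[symmetric])
    qed
    have eb: "(\<Sum>x\<in>insert s S. e x * b x) = 0" if "b \<in> B" for b
    proof -
      have "(\<Sum>x\<in>insert s S. e x * b x) = (\<Sum>x\<in>insert s S. g x * b x) / sqrt N"
        unfolding e_def sum_divide_distrib by (intro sum.cong) auto
      then show ?thesis using gb[OF that] by simp
    qed
    have "e \<notin> B" using es Bs by blast
    have "orthonormal_basis (insert s S) U (insert e B)"
      unfolding orthonormal_basis_def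
    proof (intro conjI ballI allI)
      show "finite (insert e B)" using finB by simp
      show "insert e B \<subseteq> U" using eU Bs by auto
    next
      fix a b assume "a \<in> insert e B" "b \<in> insert e B"
      then consider "a = e" "b = e" | "a = e" "b \<in> B" | "a \<in> B" "b = e" | "a \<in> B" "b \<in> B" by blast
      then show "(\<Sum>x\<in>insert s S. a x * b x) = of_bool (a = b)"
      proof cases
        case 1 then show ?thesis using ee by simp
      next
        case 2 then show ?thesis using eb \<open>e \<notin> B\<close> by auto
      next
        case 3 then show ?thesis using eb[of a] \<open>e \<notin> B\<close> by (auto simp: mult.commute)
      next
        case 4 then show ?thesis using inner onB by auto
      qed
    next
      fix h x assume h: "h \<in> U"
      (* Subtracting r times e makes h vanish at s, so the expansion in B applies to the rest. *)
      define r where "r = h s / e s"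
      define h' where "h' = (\<lambda>x. h x - r * e x)"
      have "h' \<in> U'"
        using U(2)[OF h eU, of "- r"] es by (simp add: U'_def h'_def r_def)
      have he: "(\<Sum>y\<in>insert s S. h' y * b y) = (\<Sum>y\<in>insert s S. h y * b y)" if "b \<in> B" for b
      proof -
        have "(\<Sum>y\<in>insert s S. h' y * b y)
            = (\<Sum>y\<in>insert s S. h y * b y) - r * (\<Sum>y\<in>insert s S. e y * b y)"
          unfolding h'_def left_diff_distrib sum_subtractf sum_distrib_left by (simp add: mult.assoc)
        then show ?thesis using eb[OF that] by simp
      qed
      have exp: "h' x = (\<Sum>b\<in>B. (\<Sum>y\<in>insert s S. h y * b y) * b x)" for x
        unfolding expB[OF \<open>h' \<in> U'\<close>, of x]
        using inner he by (intro sum.cong refl) simp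
      have "(\<Sum>y\<in>insert s S. h' y * e y)
          = (\<Sum>b\<in>B. (\<Sum>y\<in>insert s S. h y * b y) * (\<Sum>y\<in>insert s S. b y * e y))"
        unfolding exp by (rule inner_sum_left)
      also have "\<dots> = 0"
        using eb by (intro sum.neutral) (simp add: mult.commute)
      finally have "(\<Sum>y\<in>insert s S. h' y * e y) = 0" .
      moreover have "(\<Sum>y\<in>insert s S. h' y * e y)
          = (\<Sum>y\<in>insert s S. h y * e y) - r * (\<Sum>y\<in>insert s S. e y * e y)"
        unfolding h'_def left_diff_distrib sum_subtractf sum_distrib_left by (simp add: mult.assoc)
      ultimately have "(\<Sum>y\<in>insert s S. h y * e y) = r" using ee by simp
      moreover have "h x = r * e x + h' x" by (simp add: h'_def)
      ultimately show "h x = (\<Sum>b\<in>insert e B. (\<Sum>y\<in>insert s S. h y * b y) * b x)"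
        using exp \<open>e \<notin> B\<close> finB by simp
    qed
    then show ?thesis by blast
  qed
qed

section \<open>Harmonic functions and Hodge theory\<close>

text \<open>
  The operator \<open>d + d\<^sup>*\<close>, for the exterior derivative \<open>d\<close> with incidence matrix \<open>M\<close>.
\<close>

definition dirac :: "'c set \<Rightarrow> ('c \<Rightarrow> 'c \<Rightarrow> real) \<Rightarrow> ('c \<Rightarrow> real) \<Rightarrow> 'c \<Rightarrow> real" where
  "dirac C M f = (\<lambda>x. \<Sum>y\<in>C. (M x y + M y x) * f y)"

definition harmonic :: "'c set \<Rightarrow> ('c \<Rightarrow> 'c \<Rightarrow> real) \<Rightarrow> ('c \<Rightarrow> real) \<Rightarrow> bool" where
  "harmonic C M f \<longleftrightarrow> f \<in> functions_on C \<and> (\<forall>x\<in>C. dirac C M f x = 0)"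

text \<open>
  The matrix of the orthogonal projection onto the harmonic functions. It is described by its
  reproducing property, and not through a basis, because this can be checked directly for matrices
  built from other ones.
\<close>

definition harmonic_kernel ::
  "'c set \<Rightarrow> ('c \<Rightarrow> 'c \<Rightarrow> real) \<Rightarrow> ('c \<Rightarrow> 'c \<Rightarrow> real) \<Rightarrow> bool" where
  "harmonic_kernel C M P \<longleftrightarrow>
     (\<forall>y\<in>C. harmonic C M (\<lambda>x. P x y)) \<and>
     (\<forall>f y. harmonic C M f \<longrightarrow> y \<in> C \<longrightarrow> (\<Sum>x\<in>C. P x y * f x) = f y)"

lemma harmonic_kernelD:
  assumes "harmonic_kernel C M P"
  shows "y \<in> C \<Longrightarrow> harmonic C M (\<lambda>x. P x y)"
    and "harmonic C M f \<Longrightarrow> y \<in> C \<Longrightarrow> (\<Sum>x\<in>C. P x y * f x) = f y"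
  using assms by (auto simp: harmonic_kernel_def)

lemma functions_on_subspace: "linear_subspace (functions_on S)"
  by (auto simp: linear_subspace_def functions_on_def)

lemma linear_subspace_harmonic: "linear_subspace {f. harmonic C M f}"
proof -
  have "dirac C M (\<lambda>x. f x + c * g x) x = dirac C M f x + c * dirac C M g x" for f g c x
    by (simp add: dirac_def sum_distrib_left algebra_simps sum.distrib)
  then show ?thesis
    using functions_on_subspace[of C]
    by (auto simp: linear_subspace_def harmonic_def dirac_def)
qed

text \<open>
  The kernel is \<open>P x y = (\<Sum>b\<in>B. b x * b y)\<close> for an orthonormal basis \<open>B\<close> of the harmonic functions.
\<close>

lemma harmonic_kernel_exists:
  assumes "finite C"
  shows "\<exists>P. harmonic_kernel C M P"
proof -
  let ?U = "{f. harmonic C M f}"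
  have "?U \<subseteq> functions_on C" by (auto simp: harmonic_def)
  then obtain B where B: "orthonormal_basis C ?U B"
    using orthonormal_basis_exists[OF assms linear_subspace_harmonic] by blast
  define P where "P x y = (\<Sum>b\<in>B. b y * b x)" for x y
  have "harmonic C M (\<lambda>x. P x y)" for y
    using linear_subspace_sum[OF linear_subspace_harmonic[of C M], of B "\<lambda>b. b" "\<lambda>b. b y"] B
    by (auto simp: orthonormal_basis_def P_def)
  moreover have "(\<Sum>x\<in>C. P x y * f x) = f y" if "harmonic C M f" for f y
  proof -
    have "(\<Sum>x\<in>C. P x y * f x) = (\<Sum>b\<in>B. b y * (\<Sum>x\<in>C. b x * f x))"
      unfolding P_def by (rule inner_sum_left)
    also have "\<dots> = (\<Sum>b\<in>B. (\<Sum>x\<in>C. f x * b x) * b y)"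
      by (simp add: mult.commute)
    also have "\<dots> = f y" using B that by (auto simp: orthonormal_basis_def)
    finally show ?thesis .
  qed
  ultimately show ?thesis unfolding harmonic_kernel_def by blast
qed

text \<open>
  A finite cochain complex of real functions on cells. The entry \<open>M x y\<close> is the coefficient of \<open>f y\<close> in
  \<open>d f x\<close>.
\<close>

locale graded_cochains =
  fixes C :: "'c set" and rk :: "'c \<Rightarrow> nat" and M :: "'c \<Rightarrow> 'c \<Rightarrow> real"
  assumes fin: "finite C"
    and inc: "M x y \<noteq> 0 \<Longrightarrow> x \<in> C \<and> y \<in> C \<and> rk x = Suc (rk y)"
    and d_squared: "(\<Sum>y\<in>C. M x y * M y z) = 0"
begin

definition d :: "('c \<Rightarrow> real) \<Rightarrow> 'c \<Rightarrow> real" where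
  "d f = (\<lambda>x. \<Sum>y\<in>C. M x y * f y)"

definition codiff :: "('c \<Rightarrow> real) \<Rightarrow> 'c \<Rightarrow> real" where
  "codiff f = (\<lambda>x. \<Sum>y\<in>C. M y x * f y)"

definition level :: "nat \<Rightarrow> 'c set" where
  "level k = {x \<in> C. rk x = k}"

text \<open>
  The cells of dimension \<open>k - 1\<close>; there are none for \<open>k = 0\<close>.
\<close>

definition below :: "nat \<Rightarrow> 'c set" where
  "below k = {x \<in> C. Suc (rk x) = k}"

definition Z :: "nat \<Rightarrow> ('c \<Rightarrow> real) set" where
  "Z k = {f \<in> functions_on (level k). d f = (\<lambda>_. 0)}"

definition B :: "nat \<Rightarrow> ('c \<Rightarrow> real) set" where
  "B k = d ` functions_on (below k)"

lemma d_linear: "d (\<lambda>x. f x + c * g x) = (\<lambda>x. d f x + c * d g x)"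
  by (simp add: d_def fun_eq_iff sum_distrib_left algebra_simps sum.distrib)

lemma d_zero: "d (\<lambda>_. 0) = (\<lambda>_. 0)"
  by (simp add: d_def)

lemma inc_zero:
  "x \<notin> C \<Longrightarrow> M x y = 0" "y \<notin> C \<Longrightarrow> M x y = 0" "rk x \<noteq> Suc (rk y) \<Longrightarrow> M x y = 0"
  using inc by blast+

lemma d_outside: "x \<notin> C \<Longrightarrow> d f x = 0" "x \<notin> C \<Longrightarrow> codiff f x = 0"
  by (simp_all add: d_def codiff_def inc_zero)

lemma adjoint: "(\<Sum>x\<in>C. d g x * f x) = (\<Sum>x\<in>C. g x * codiff f x)"
  unfolding d_def codiff_def sum_distrib_left sum_distrib_right
  by (subst sum.swap) (simp add: mult_ac)

lemma d_d: "d (d f) = (\<lambda>_. 0)"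
proof
  fix x
  have "d (d f) x = (\<Sum>z\<in>C. (\<Sum>y\<in>C. M x y * M y z) * f z)"
    unfolding d_def sum_distrib_left sum_distrib_right
    by (subst sum.swap) (simp add: mult_ac)
  then show "d (d f) x = 0" by (simp add: d_squared)
qed

lemma dirac_eq: "dirac C M f = (\<lambda>x. d f x + codiff f x)"
  by (simp add: dirac_def d_def codiff_def fun_eq_iff distrib_right sum.distrib)

text \<open>
  \<open>d f\<close> and \<open>codiff f\<close> are orthogonal, since \<open>d (d f) = 0\<close>. If their sum vanishes, then so do
  both.
\<close>

lemma harmonic_iff:
  "harmonic C M f \<longleftrightarrow> f \<in> functions_on C \<and> d f = (\<lambda>_. 0) \<and> codiff f = (\<lambda>_. 0)"
proof
  assume h: "harmonic C M f"
  then have zero: "d f x + codiff f x = 0" if "x \<in> C" for x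
    using that by (auto simp: harmonic_def dirac_eq)
  have orth: "(\<Sum>x\<in>C. d f x * codiff f x) = 0"
    using adjoint[of "d f" f] by (simp add: d_d)
  have "(\<Sum>x\<in>C. d f x * d f x) = (\<Sum>x\<in>C. d f x * (d f x + codiff f x))"
    using orth by (simp add: distrib_left sum.distrib)
  also have "\<dots> = 0" using zero by simp
  finally have "\<forall>x\<in>C. d f x * d f x = 0"
    using fin by (subst (asm) sum_nonneg_eq_0_iff) auto
  then have "d f x = 0" for x using d_outside(1) by (cases "x \<in> C") auto
  moreover from this have "codiff f x = 0" for x
    using zero[of x] d_outside(2) by (cases "x \<in> C") auto
  ultimately show "f \<in> functions_on C \<and> d f = (\<lambda>_. 0) \<and> codiff f = (\<lambda>_. 0)"
    using h by (auto simp: harmonic_def)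
qed (auto simp: harmonic_def dirac_eq)

text \<open>
  The derivative raises the dimension by one and its adjoint lowers it by one, so both vanish in each
  dimension separately.
\<close>

lemma harmonic_restrict:
  assumes "harmonic C M f"
  shows "harmonic C M (\<lambda>x. if x \<in> level k then f x else 0)"
proof -
  let ?g = "\<lambda>x. if x \<in> level k then f x else 0"
  have f: "d f = (\<lambda>_. 0)" "codiff f = (\<lambda>_. 0)" using assms by (auto simp: harmonic_iff)
  have "d ?g x = (if rk x = Suc k then d f x else 0)" for x
    unfolding d_def by (auto intro!: sum.cong sum.neutral simp: level_def inc_zero)
  moreover have "codiff ?g x = (if Suc (rk x) = k then codiff f x else 0)" for x
    unfolding codiff_def by (auto intro!: sum.cong sum.neutral simp: level_def inc_zero)
  ultimately show ?thesis
    using f by (auto simp: harmonic_iff functions_on_def level_def fun_eq_iff)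
qed

definition H :: "nat \<Rightarrow> ('c \<Rightarrow> real) set" where
  "H k = {f \<in> functions_on (level k). harmonic C M f}"

lemma level_sum:
  assumes "g \<in> functions_on (level k)"
  shows "(\<Sum>x\<in>C. f x * g x) = (\<Sum>x\<in>level k. f x * g x)"
  using fin assms by (intro sum.mono_neutral_right) (auto simp: level_def functions_on_def)

lemma linear_subspace_H: "linear_subspace (H k)"
  using linear_subspace_harmonic[of C M] functions_on_subspace[of "level k"]
  by (auto simp: linear_subspace_def H_def)

lemma linear_subspace_B: "linear_subspace (B k)"
  unfolding linear_subspace_def
proof (intro conjI ballI allI)
  show "(\<lambda>_. 0) \<in> B k"
    using d_zero linear_subspaceD(1)[OF functions_on_subspace] by (force simp: B_def image_iff)
next
  fix f g c assume "f \<in> B k" "g \<in> B k"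
  then obtain f' g' where "f' \<in> functions_on (below k)" "f = d f'"
    "g' \<in> functions_on (below k)" "g = d g'" by (auto simp: B_def)
  then show "(\<lambda>x. f x + c * g x) \<in> B k"
    using linear_subspaceD(2)[OF functions_on_subspace, of f' "below k" g' c]
    by (simp add: B_def d_linear[symmetric])
qed

lemma B_subset_Z: "B k \<subseteq> Z k"
proof
  fix f assume "f \<in> B k"
  then obtain g where g: "g \<in> functions_on (below k)" "f = d g" by (auto simp: B_def)
  have "d g x = 0" if "x \<notin> level k" for x
    unfolding d_def
  proof (intro sum.neutral ballI)
    show "M x y * g y = 0" for y
      using that g inc[of x y]
      by (cases "M x y = 0") (auto simp: level_def below_def functions_on_def)
  qed
  then show "f \<in> Z k" using g by (auto simp: Z_def d_d functions_on_def)
qed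

lemma B_orthogonal_H:
  assumes "f \<in> B k" "harmonic C M h"
  shows "(\<Sum>x\<in>C. f x * h x) = 0"
  using assms by (auto simp: B_def adjoint harmonic_iff)

text \<open>
  Here \<open>w\<close> is the orthogonal projection of \<open>f\<close> to the coboundaries. The remainder is orthogonal to all
  \<open>d g\<close>, and the functions \<open>g\<close> supported at one point show that its codifferential vanishes.
\<close>

lemma hodge_decomposition:
  assumes "f \<in> Z k"
  shows "\<exists>w\<in>B k. (\<lambda>x. f x - w x) \<in> H k"
proof -
  have BZ: "B k \<subseteq> functions_on C"
    using B_subset_Z by (fastforce simp: Z_def functions_on_def level_def)
  obtain A where A: "orthonormal_basis C (B k) A"
    using orthonormal_basis_exists[OF fin linear_subspace_B BZ] by blast
  then have finA: "finite A" and onA: "\<forall>a\<in>A. \<forall>b\<in>A. (\<Sum>x\<in>C. a x * b x) = of_bool (a = b)"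
    and AB: "A \<subseteq> B k"
    and expA: "\<And>g x. g \<in> B k \<Longrightarrow> g x = (\<Sum>b\<in>A. (\<Sum>y\<in>C. g y * b y) * b x)"
    by (auto simp: orthonormal_basis_def)
  define w where "w = (\<lambda>x. \<Sum>b\<in>A. (\<Sum>y\<in>C. f y * b y) * b x)"
  have wB: "w \<in> B k"
    unfolding w_def using AB by (intro linear_subspace_sum[OF linear_subspace_B finA]) auto
  define h where "h = (\<lambda>x. f x - w x)"
  have ha: "(\<Sum>x\<in>C. a x * h x) = 0" if "a \<in> A" for a
    using inner_orthonormal_sum[OF finA onA that, of "\<lambda>b. \<Sum>y\<in>C. f y * b y"]
    by (simp add: h_def w_def right_diff_distrib sum_subtractf mult.commute)
  have hB: "(\<Sum>x\<in>C. g x * h x) = 0" if "g \<in> B k" for g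
  proof -
    have "(\<Sum>x\<in>C. g x * h x) = (\<Sum>x\<in>C. (\<Sum>b\<in>A. (\<Sum>y\<in>C. g y * b y) * b x) * h x)"
      by (intro sum.cong refl arg_cong2[where f = "(*)"] expA[OF that])
    also have "\<dots> = (\<Sum>b\<in>A. (\<Sum>y\<in>C. g y * b y) * (\<Sum>x\<in>C. b x * h x))"
      by (rule inner_sum_left)
    finally have "(\<Sum>x\<in>C. g x * h x) = (\<Sum>b\<in>A. (\<Sum>y\<in>C. g y * b y) * (\<Sum>x\<in>C. b x * h x))" .
    then show ?thesis using ha by simp
  qed
  have hZ: "h \<in> Z k"
  proof -
    have "d h = (\<lambda>x. d f x + (- 1) * d w x)"
      using d_linear[of f "-1" w] by (simp add: h_def)
    moreover have "h \<in> functions_on (level k)"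
      using assms wB B_subset_Z linear_subspaceD(4)[OF functions_on_subspace]
      unfolding h_def Z_def by fastforce
    ultimately show ?thesis using assms wB B_subset_Z unfolding Z_def by fastforce
  qed
  have "codiff h y = 0" for y
  proof (cases "y \<in> below k")
    case True
    then have y: "y \<in> C" by (simp add: below_def)
    let ?\<delta> = "\<lambda>x. if x = y then 1 else 0"
    have "d ?\<delta> \<in> B k" using True by (auto simp: B_def functions_on_def)
    then have "(\<Sum>x\<in>C. ?\<delta> x * codiff h x) = 0" using hB adjoint by metis
    moreover have "(\<Sum>x\<in>C. ?\<delta> x * codiff h x) = codiff h y"
      using fin y by (simp add: if_distrib[of "\<lambda>c. c * _"] cong: if_cong)
    ultimately show ?thesis by simp
  next
    case False
    show ?thesis unfolding codiff_def
    proof (intro sum.neutral ballI)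
      show "M x y * h x = 0" for x
        using False hZ inc[of x y]
        by (cases "M x y = 0") (auto simp: Z_def level_def below_def functions_on_def)
    qed
  qed
  then have "h \<in> H k"
    using hZ by (auto simp: H_def harmonic_iff Z_def functions_on_def level_def)
  then show ?thesis using wB by (auto simp: h_def)
qed

text \<open>
  By the decomposition, harmonic functions represent all classes; they are independent modulo
  coboundaries because they are orthogonal to these.
\<close>

lemma quotient_basis_of_harmonic:
  assumes A: "orthonormal_basis C (H k) A"
  shows "quotient_basis (Z k) (B k) A"
  unfolding quotient_basis_def
proof (intro conjI allI impI ballI)
  have finA: "finite A" and AH: "A \<subseteq> H k"
    and onA: "\<forall>a\<in>A. \<forall>b\<in>A. (\<Sum>x\<in>C. a x * b x) = of_bool (a = b)"
    and expA: "\<And>g x. g \<in> H k \<Longrightarrow> g x = (\<Sum>b\<in>A. (\<Sum>y\<in>C. g y * b y) * b x)"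
    using A by (auto simp: orthonormal_basis_def)
  show "finite A" by fact
  show "A \<subseteq> Z k" using AH by (auto simp: H_def Z_def harmonic_iff)
  show "c a = 0" if "(\<lambda>x. \<Sum>b\<in>A. c b * b x) \<in> B k" "a \<in> A" for c a
    using inner_orthonormal_sum[OF finA onA that(2), of c] B_orthogonal_H[OF that(1), of a] AH that(2)
    by (auto simp: H_def)
  show "\<exists>c. (\<lambda>x. f x - (\<Sum>b\<in>A. c b * b x)) \<in> B k" if fZ: "f \<in> Z k" for f
  proof -
    obtain w where w: "w \<in> B k" "(\<lambda>x. f x - w x) \<in> H k"
      using hodge_decomposition[OF fZ] by blast
    have "f x - (\<Sum>b\<in>A. (\<Sum>y\<in>C. (f y - w y) * b y) * b x) = w x" for x
      using expA[OF w(2), of x] by linarith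
    then have "(\<lambda>x. f x - (\<Sum>b\<in>A. (\<Sum>y\<in>C. (f y - w y) * b y) * b x)) = w" by (rule ext)
    then show ?thesis using w(1) by (intro exI[of _ "\<lambda>b. \<Sum>y\<in>C. (f y - w y) * b y"]) (simp only:)
  qed
qed

text \<open>
  For an orthonormal basis of the harmonic functions in dimension \<open>k\<close>, the diagonal entry at \<open>y\<close> is
  the sum of the squares \<open>b y * b y\<close>. Summing over \<open>y\<close> counts the elements of the basis.
\<close>

lemma quotient_dim_eq_trace:
  assumes P: "harmonic_kernel C M P"
  shows "real (quotient_dim (Z k) (B k)) = (\<Sum>x\<in>level k. P x x)"
proof -
  have "H k \<subseteq> functions_on C" by (auto simp: H_def harmonic_def)
  then obtain A where A: "orthonormal_basis C (H k) A"
    using orthonormal_basis_exists[OF fin linear_subspace_H] by blast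
  have AH: "A \<subseteq> H k"
    and onA: "\<forall>a\<in>A. \<forall>b\<in>A. (\<Sum>x\<in>C. a x * b x) = of_bool (a = b)"
    and expA: "\<And>g x. g \<in> H k \<Longrightarrow> g x = (\<Sum>b\<in>A. (\<Sum>y\<in>C. g y * b y) * b x)"
    using A by (auto simp: orthonormal_basis_def)
  have diag: "P y y = (\<Sum>b\<in>A. b y * b y)" if y: "y \<in> level k" for y
  proof -
    let ?p = "\<lambda>x. if x \<in> level k then P x y else 0"
    have yX: "y \<in> C" using y by (simp add: level_def)
    have "harmonic C M ?p"
      using P yX by (intro harmonic_restrict) (auto simp: harmonic_kernel_def)
    then have pH: "?p \<in> H k" by (auto simp: H_def functions_on_def)
    have "(\<Sum>x\<in>C. ?p x * b x) = b y" if "b \<in> A" for b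
    proof -
      have b: "harmonic C M b" "b \<in> functions_on (level k)" using that AH by (auto simp: H_def)
      have "(\<Sum>x\<in>C. ?p x * b x) = (\<Sum>x\<in>C. P x y * b x)"
        using b(2) by (intro sum.cong) (auto simp: functions_on_def)
      then show ?thesis using P b(1) yX by (auto simp: harmonic_kernel_def)
    qed
    then show ?thesis using expA[OF pH, of y] y by simp
  qed
  have "(\<Sum>x\<in>level k. P x x) = (\<Sum>b\<in>A. \<Sum>x\<in>level k. b x * b x)"
    by (subst sum.swap) (simp add: diag)
  also have "\<dots> = (\<Sum>b\<in>A. \<Sum>x\<in>C. b x * b x)"
    using AH by (intro sum.cong refl level_sum[symmetric]) (auto simp: H_def)
  also have "\<dots> = (\<Sum>b\<in>A. 1)" using onA by (intro sum.cong refl) simp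
  also have "\<dots> = real (card A)" by simp
  also have "card A = quotient_dim (Z k) (B k)"
    by (rule quotient_dim_eq_card[OF linear_subspace_B quotient_basis_of_harmonic[OF A], symmetric])
  finally show ?thesis by (rule sym)
qed

end

section \<open>Harmonic kernels of products, relabellings and disjoint unions\<close>

definition trace_poly :: "'c set \<Rightarrow> ('c \<Rightarrow> nat) \<Rightarrow> ('c \<Rightarrow> 'c \<Rightarrow> real) \<Rightarrow> real poly" where
  "trace_poly C rk P = (\<Sum>x\<in>C. Polynomial.monom (P x x) (rk x))"

lemma coeff_trace_poly:
  "finite C \<Longrightarrow> poly.coeff (trace_poly C rk P) k = (\<Sum>x | x \<in> C \<and> rk x = k. P x x)"
  by (simp add: trace_poly_def coeff_sum coeff_monom sum.inter_filter)

text \<open>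
  As cells of product complexes are lists, the product of a complex with cells \<open>x\<close> and one with cells
  \<open>xs\<close> is formed on the lists \<open>x # xs\<close>. The first condition confines the matrix to the product: for
  \<open>x = y\<close> outside \<open>C\<close> the second summand need not vanish by itself.
\<close>

definition cons_incidence ::
  "'b set \<Rightarrow> 'b list set \<Rightarrow> ('b \<Rightarrow> nat) \<Rightarrow> ('b \<Rightarrow> 'b \<Rightarrow> real) \<Rightarrow> ('b list \<Rightarrow> 'b list \<Rightarrow> real)
    \<Rightarrow> 'b list \<Rightarrow> 'b list \<Rightarrow> real" where
  "cons_incidence C Y rk M N zs ws =
     (case (zs, ws) of
        (x # xs, y # ys) \<Rightarrow> of_bool (x \<in> C \<and> xs \<in> Y) *
          (M x y * of_bool (xs = ys) + (-1) ^ rk x * of_bool (x = y) * N xs ys)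
      | _ \<Rightarrow> 0)"

definition cons_kernel ::
  "('b \<Rightarrow> 'b \<Rightarrow> real) \<Rightarrow> ('b list \<Rightarrow> 'b list \<Rightarrow> real) \<Rightarrow> 'b list \<Rightarrow> 'b list \<Rightarrow> real" where
  "cons_kernel P Q zs ws =
     (case (zs, ws) of (x # xs, y # ys) \<Rightarrow> P x y * Q xs ys | _ \<Rightarrow> 0)"

lemma cons_simps:
  "cons_incidence C Y rk M N (x # xs) (y # ys) = of_bool (x \<in> C \<and> xs \<in> Y) *
     (M x y * of_bool (xs = ys) + (-1) ^ rk x * of_bool (x = y) * N xs ys)"
  "cons_kernel P Q (x # xs) (y # ys) = P x y * Q xs ys"
  by (simp_all add: cons_incidence_def cons_kernel_def)

lemma set_Cons_eq: "set_Cons C Y = (\<lambda>(x, xs). x # xs) ` (C \<times> Y)"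
  by (auto simp: set_Cons_def)

lemma sum_set_Cons: "(\<Sum>z\<in>set_Cons C Y. f z) = (\<Sum>x\<in>C. \<Sum>y\<in>Y. f (x # y))"
proof -
  have "inj_on (\<lambda>(x, xs). x # xs) (C \<times> Y)" by (auto simp: inj_on_def)
  then show ?thesis
    unfolding set_Cons_eq by (simp add: sum.reindex sum.cartesian_product case_prod_unfold)
qed

lemma Cons_in_set_Cons [simp]: "x # xs \<in> set_Cons C Y \<longleftrightarrow> x \<in> C \<and> xs \<in> Y"
  by (auto simp: set_Cons_def)

lemma dirac_cons:
  assumes "finite C" "finite Y" "x \<in> C" "y \<in> Y" and "\<And>x. M x x = 0"
  shows "dirac (set_Cons C Y) (cons_incidence C Y rk M N) f (x # y) =
    dirac C M (\<lambda>x'. f (x' # y)) x + (-1) ^ rk x * dirac Y N (\<lambda>y'. f (x # y')) y"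
proof -
  have "dirac (set_Cons C Y) (cons_incidence C Y rk M N) f (x # y) =
    (\<Sum>x'\<in>C. \<Sum>y'\<in>Y. of_bool (y' = y) * ((M x x' + M x' x) * f (x' # y)))
    + (\<Sum>x'\<in>C. \<Sum>y'\<in>Y. of_bool (x' = x) * ((-1) ^ rk x * ((N y y' + N y' y) * f (x # y'))))"
    unfolding dirac_def sum_set_Cons sum.distrib[symmetric]
    by (intro sum.cong refl) (use assms in \<open>auto simp: cons_simps algebra_simps\<close>)
  also have "(\<Sum>x'\<in>C. \<Sum>y'\<in>Y. of_bool (y' = y) * ((M x x' + M x' x) * f (x' # y)))
     = dirac C M (\<lambda>x'. f (x' # y)) x"
    using assms by (simp add: dirac_def of_bool_def if_distrib[of "\<lambda>c. c * _"] cong: if_cong)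
  also have "(\<Sum>x'\<in>C. \<Sum>y'\<in>Y. of_bool (x' = x) * ((-1) ^ rk x * ((N y y' + N y' y) * f (x # y'))))
     = (-1) ^ rk x * dirac Y N (\<lambda>y'. f (x # y')) y"
    using assms by (subst sum.swap)
      (simp add: dirac_def of_bool_def sum_distrib_left if_distrib[of "\<lambda>c. c * _"] cong: if_cong)
  finally show ?thesis .
qed

text \<open>
  The central point of the Kuenneth formula. Write the operator of the product as \<open>F + s G\<close>, where \<open>F\<close>
  acts on the first variable and \<open>G\<close> on the second, and \<open>s\<close> is the sign \<open>(-1) ^ rk x\<close>. As \<open>F\<close> connects
  only cells \<open>x\<close> of opposite parity, it anticommutes with \<open>s\<close>. Hence the mixed term \<open>T\<close> in the norm of
  \<open>F + s G\<close> equals \<open>- T\<close>, so it is zero, and \<open>F + s G = 0\<close> forces \<open>F = G = 0\<close>.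
\<close>

lemma harmonic_cons_iff:
  assumes "finite C" "finite Y" and inc: "\<And>x y. M x y \<noteq> 0 \<Longrightarrow> rk x = Suc (rk y)"
  shows "harmonic (set_Cons C Y) (cons_incidence C Y rk M N) f \<longleftrightarrow>
    f \<in> functions_on (set_Cons C Y) \<and>
    (\<forall>y\<in>Y. harmonic C M (\<lambda>x. f (x # y))) \<and> (\<forall>x\<in>C. harmonic Y N (\<lambda>y. f (x # y)))"
    (is "?L \<longleftrightarrow> ?R")
proof
  have M0: "M x x = 0" for x using inc by fastforce
  define F where "F x y = dirac C M (\<lambda>x'. f (x' # y)) x" for x y
  define G where "G x y = dirac Y N (\<lambda>y'. f (x # y')) y" for x y
  define s where "s x = (-1::real) ^ rk x" for x
  have D: "dirac (set_Cons C Y) (cons_incidence C Y rk M N) f (x # y) = F x y + s x * G x y"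
    if "x \<in> C" "y \<in> Y" for x y
    using dirac_cons[where M = M and N = N and f = f, OF assms(1,2) that M0] by (simp add: F_def G_def s_def)
  show ?R if ?L
  proof -
    have f: "f \<in> functions_on (set_Cons C Y)"
      and zero: "\<And>x y. x \<in> C \<Longrightarrow> y \<in> Y \<Longrightarrow> F x y + s x * G x y = 0"
      using \<open>?L\<close> by (auto simp: harmonic_def D[symmetric])
    (* Cells joined by M have dimensions of opposite parity. *)
    have skew: "s x * (M x x' + M x' x) = - (s x' * (M x' x + M x x'))" for x x'
    proof (cases "M x x' = 0 \<and> M x' x = 0")
      case False
      then have "rk x = Suc (rk x') \<or> rk x' = Suc (rk x)" using inc by blast
      then have "s x' = - s x" by (elim disjE) (simp_all add: s_def)
      then show ?thesis by (simp add: add.commute)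
    qed simp
    define T where "T = (\<Sum>x\<in>C. \<Sum>y\<in>Y. s x * F x y * G x y)"
    (* The summand of T after expanding F and G; exchanging the primed and unprimed cells negates it. *)
    define W where "W x y x' y' = s x * ((M x x' + M x' x) * f (x' # y) *
        ((N y y' + N y' y) * f (x # y')))" for x y x' y'
    have W: "W x y x' y' = - W x' y' x y" for x y x' y'
    proof -
      have "W x y x' y' = (s x * (M x x' + M x' x)) * ((N y y' + N y' y) * f (x' # y) * f (x # y'))"
        by (simp only: W_def mult_ac)
      also have "\<dots> = - (s x' * (M x' x + M x x')) * ((N y y' + N y' y) * f (x' # y) * f (x # y'))"
        by (simp only: skew[of x x'])
      also have "\<dots> = - W x' y' x y"
        by (simp only: W_def mult_ac add.commute[of "N y' y"] minus_mult_left)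
      finally show ?thesis .
    qed
    have "s x * F x y * G x y = (\<Sum>q\<in>C\<times>Y. W x y (fst q) (snd q))" for x y
    proof -
      have "F x y * G x y = (\<Sum>x'\<in>C. \<Sum>y'\<in>Y. (M x x' + M x' x) * f (x' # y) *
          ((N y y' + N y' y) * f (x # y')))"
        unfolding F_def G_def dirac_def by (rule sum_product)
      then show ?thesis by (simp only: mult.assoc[of "s x"] sum_distrib_left W_def
            sum.cartesian_product case_prod_unfold)
    qed
    then have "T = (\<Sum>x\<in>C. \<Sum>y\<in>Y. \<Sum>q\<in>C\<times>Y. W x y (fst q) (snd q))"
      by (simp only: T_def)
    then have T: "T = (\<Sum>p\<in>C\<times>Y. \<Sum>q\<in>C\<times>Y. W (fst p) (snd p) (fst q) (snd q))"
      by (subst (asm) sum.cartesian_product) (simp only: case_prod_unfold)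
    also have "\<dots> = (\<Sum>q\<in>C\<times>Y. \<Sum>p\<in>C\<times>Y. W (fst p) (snd p) (fst q) (snd q))"
      by (rule sum.swap)
    also have "\<dots> = (\<Sum>q\<in>C\<times>Y. \<Sum>p\<in>C\<times>Y. - W (fst q) (snd q) (fst p) (snd p))"
      by (intro sum.cong refl W)
    also have "\<dots> = - T"
      by (simp only: T sum_negf)
    finally have "T = 0" by simp
    have "(\<Sum>x\<in>C. \<Sum>y\<in>Y. (F x y)\<^sup>2 + (G x y)\<^sup>2) = (\<Sum>x\<in>C. \<Sum>y\<in>Y. (F x y + s x * G x y)\<^sup>2) - 2 * T"
      unfolding T_def sum_distrib_left sum_subtractf[symmetric]
      by (intro sum.cong refl) (simp add: power2_sum power_mult_distrib s_def power_mult[symmetric])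
    also have "\<dots> = 0" using zero \<open>T = 0\<close> by simp
    finally have "\<forall>x\<in>C. \<forall>y\<in>Y. (F x y)\<^sup>2 + (G x y)\<^sup>2 = 0"
      using assms by (simp add: sum_nonneg_eq_0_iff sum_nonneg)
    then have "\<forall>x\<in>C. \<forall>y\<in>Y. F x y = 0 \<and> G x y = 0" by (simp add: sum_power2_eq_zero_iff)
    then show ?R using f by (auto simp: harmonic_def F_def G_def functions_on_def)
  qed
  show ?L if ?R
    using that D unfolding harmonic_def F_def G_def by (auto simp: set_Cons_def)
qed

text \<open>
  As harmonic functions are those harmonic in each variable, the reproducing property may be applied
  first in one variable and then in the other.
\<close>

lemma harmonic_kernel_cons:
  assumes "finite C" "finite Y" and inc: "\<And>x y. M x y \<noteq> 0 \<Longrightarrow> rk x = Suc (rk y)"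
    and P: "harmonic_kernel C M P" and Q: "harmonic_kernel Y N Q"
  shows "harmonic_kernel (set_Cons C Y) (cons_incidence C Y rk M N) (cons_kernel P Q)"
  unfolding harmonic_kernel_def
proof (intro conjI ballI allI impI)
  have iff: "harmonic (set_Cons C Y) (cons_incidence C Y rk M N) f \<longleftrightarrow>
    f \<in> functions_on (set_Cons C Y) \<and>
    (\<forall>y\<in>Y. harmonic C M (\<lambda>x. f (x # y))) \<and> (\<forall>x\<in>C. harmonic Y N (\<lambda>y. f (x # y)))" for f
    by (rule harmonic_cons_iff[OF assms(1,2) inc])
  have scale: "harmonic S L (\<lambda>x. c * g x)" "harmonic S L (\<lambda>x. g x * c)"
    if "harmonic S L g" for S L c and g :: "'z \<Rightarrow> real"
    using linear_subspaceD(3)[OF linear_subspace_harmonic[of S L], of g c] that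
    by (auto simp: mult.commute)
  show "harmonic (set_Cons C Y) (cons_incidence C Y rk M N) (\<lambda>z. cons_kernel P Q z w)"
    if wCY: "w \<in> set_Cons C Y" for w
  proof -
    obtain x y where w: "w = x # y" "x \<in> C" "y \<in> Y" using wCY by (auto simp: set_Cons_def)
    have px: "harmonic C M (\<lambda>x'. P x' x)" and qy: "harmonic Y N (\<lambda>y'. Q y' y)"
      using P Q w by (auto simp: harmonic_kernel_def)
    then have "(\<lambda>z. cons_kernel P Q z (x # y)) \<in> functions_on (set_Cons C Y)"
      by (auto simp: harmonic_def functions_on_def cons_kernel_def split: list.splits)
    then show ?thesis using px qy by (auto simp: iff w cons_simps intro: scale)
  qed
  show "(\<Sum>z\<in>set_Cons C Y. cons_kernel P Q z w * f z) = f w"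
    if f: "harmonic (set_Cons C Y) (cons_incidence C Y rk M N) f" and w: "w \<in> set_Cons C Y" for f w
  proof -
    obtain x y where w: "w = x # y" "x \<in> C" "y \<in> Y" using w by (auto simp: set_Cons_def)
    have fy: "harmonic C M (\<lambda>x. f (x # y'))" if "y' \<in> Y" for y'
      using f that unfolding iff by blast
    have fx: "harmonic Y N (\<lambda>y. f (x # y))"
      using f w unfolding iff by blast
    have "(\<Sum>z\<in>set_Cons C Y. cons_kernel P Q z w * f z)
        = (\<Sum>y'\<in>Y. \<Sum>x'\<in>C. P x' x * Q y' y * f (x' # y'))"
      unfolding sum_set_Cons w cons_simps by (rule sum.swap)
    also have "\<dots> = (\<Sum>y'\<in>Y. Q y' y * (\<Sum>x'\<in>C. P x' x * f (x' # y')))"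
      unfolding sum_distrib_left by (intro sum.cong refl) simp
    also have "\<dots> = (\<Sum>y'\<in>Y. Q y' y * f (x # y'))"
      using harmonic_kernelD(2)[OF P fy w(2)] by (intro sum.cong refl) (simp only:)
    also have "\<dots> = f w"
      using harmonic_kernelD(2)[OF Q fx w(3)] by (simp only: w(1))
    finally show ?thesis .
  qed
qed

lemma trace_poly_cons:
  assumes "\<And>x xs. x \<in> C \<Longrightarrow> xs \<in> Y \<Longrightarrow> rk'' (x # xs) = rk x + rk' xs"
  shows "trace_poly (set_Cons C Y) rk'' (cons_kernel P Q)
    = trace_poly C rk P * trace_poly Y rk' Q"
  unfolding trace_poly_def sum_product sum_set_Cons
  by (intro sum.cong refl) (simp add: assms cons_simps mult_monom)

text \<open>
  The map \<open>pull\<close> is a bijection between the harmonic functions of the two complexes: it relabels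
  the cells and changes signs, both of which preserve inner products.
\<close>

lemma harmonic_kernel_gauge:
  assumes bij: "bij_betw \<phi> C Y"
    and eps: "\<And>x. x \<in> C \<Longrightarrow> \<epsilon> x * \<epsilon> x = (1::real)"
    and gauge: "\<And>x y. x \<in> C \<Longrightarrow> y \<in> C \<Longrightarrow> N (\<phi> x) (\<phi> y) = \<epsilon> x * \<epsilon> y * M x y"
    and Q: "harmonic_kernel Y N Q"
  shows "harmonic_kernel C M (\<lambda>x y. of_bool (x \<in> C) * \<epsilon> x * \<epsilon> y * Q (\<phi> x) (\<phi> y))"
proof -
  define \<psi> where "\<psi> = the_inv_into C \<phi>"
  have inj: "inj_on \<phi> C" and img: "\<phi> ` C = Y" using bij by (auto simp: bij_betw_def)
  have reindex: "(\<Sum>y\<in>Y. g y) = (\<Sum>x\<in>C. g (\<phi> x))" for g :: "'b \<Rightarrow> real"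
    using inj by (simp add: img[symmetric] sum.reindex)
  define pull where "pull g = (\<lambda>x. of_bool (x \<in> C) * \<epsilon> x * g (\<phi> x))" for g :: "'b \<Rightarrow> real"
  have dirac_pull: "dirac C M (pull g) x = \<epsilon> x * dirac Y N g (\<phi> x)" if x: "x \<in> C" for g x
    unfolding dirac_def reindex sum_distrib_left
  proof (intro sum.cong refl)
    fix y assume y: "y \<in> C"
    have "(M x y + M y x) * pull g y = (\<epsilon> x * \<epsilon> x) * \<epsilon> y * (M x y + M y x) * g (\<phi> y)"
      using y eps[OF x] by (simp add: pull_def)
    also have "\<dots> = \<epsilon> x * ((N (\<phi> x) (\<phi> y) + N (\<phi> y) (\<phi> x)) * g (\<phi> y))"
      using x y by (simp add: gauge algebra_simps)
    finally show "(M x y + M y x) * pull g y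
      = \<epsilon> x * ((N (\<phi> x) (\<phi> y) + N (\<phi> y) (\<phi> x)) * g (\<phi> y))" .
  qed
  have e0: "\<epsilon> x \<noteq> 0" if "x \<in> C" for x using eps[OF that] by auto
  have pull_harmonic: "harmonic C M (pull g)" if "harmonic Y N g" for g
    using that dirac_pull img by (auto simp: harmonic_def functions_on_def pull_def)
  have push: "\<exists>g. harmonic Y N g \<and> f = pull g" if f: "harmonic C M f" for f
  proof -
    define g where "g y = (if y \<in> Y then \<epsilon> (\<psi> y) * f (\<psi> y) else 0)" for y
    have \<psi>: "\<psi> (\<phi> x) = x" "\<phi> x \<in> Y" if "x \<in> C" for x
      using that inj img by (auto simp: \<psi>_def the_inv_into_f_f)
    have fg: "f = pull g"
    proof
      fix x show "f x = pull g x"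
        using f eps[of x] by (cases "x \<in> C") (auto simp: pull_def g_def \<psi> harmonic_def functions_on_def
            mult.assoc[symmetric])
    qed
    have "dirac Y N g y = 0" if "y \<in> Y" for y
    proof -
      obtain x where x: "x \<in> C" "y = \<phi> x" using \<open>y \<in> Y\<close> img by blast
      have "\<epsilon> x * dirac Y N g (\<phi> x) = 0"
        using dirac_pull[OF x(1), of g] f x by (simp add: fg[symmetric] harmonic_def)
      then show ?thesis using e0 x by simp
    qed
    then have "harmonic Y N g" by (auto simp: harmonic_def functions_on_def g_def)
    with fg show ?thesis by blast
  qed
  show ?thesis
    unfolding harmonic_kernel_def
  proof (intro conjI ballI allI impI)
    fix y assume y: "y \<in> C"
    have "harmonic C M (pull (\<lambda>z. Q z (\<phi> y)))"
      using Q y img by (intro pull_harmonic) (auto simp: harmonic_kernel_def)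
    then have "harmonic C M (\<lambda>x. \<epsilon> y * pull (\<lambda>z. Q z (\<phi> y)) x)"
      using linear_subspaceD(3)[OF linear_subspace_harmonic[of C M]] by auto
    then show "harmonic C M (\<lambda>x. of_bool (x \<in> C) * \<epsilon> x * \<epsilon> y * Q (\<phi> x) (\<phi> y))"
      by (simp add: pull_def mult_ac)
  next
    fix f y assume f: "harmonic C M f" and y: "y \<in> C"
    obtain g where g: "harmonic Y N g" "f = pull g" using push[OF f] by blast
    have "(\<Sum>x\<in>C. of_bool (x \<in> C) * \<epsilon> x * \<epsilon> y * Q (\<phi> x) (\<phi> y) * f x)
        = \<epsilon> y * (\<Sum>x\<in>C. Q (\<phi> x) (\<phi> y) * g (\<phi> x))"
      unfolding sum_distrib_left
    proof (intro sum.cong refl)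
      fix x assume "x \<in> C"
      then show "of_bool (x \<in> C) * \<epsilon> x * \<epsilon> y * Q (\<phi> x) (\<phi> y) * f x
          = \<epsilon> y * (Q (\<phi> x) (\<phi> y) * g (\<phi> x))"
        using eps[of x] by (simp add: g(2) pull_def mult_ac)
    qed
    also have "\<dots> = f y"
      using harmonic_kernelD(2)[OF Q g(1), of "\<phi> y"] y img by (auto simp: reindex g(2) pull_def)
    finally show "(\<Sum>x\<in>C. of_bool (x \<in> C) * \<epsilon> x * \<epsilon> y * Q (\<phi> x) (\<phi> y) * f x) = f y" .
  qed
qed

lemma harmonic_kernel_disjoint_union:
  assumes "finite I" "\<And>i. i \<in> I \<Longrightarrow> finite (C i)"
    and disj: "\<And>i j. i \<in> I \<Longrightarrow> j \<in> I \<Longrightarrow> i \<noteq> j \<Longrightarrow> C i \<inter> C j = {}"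
    and inc: "\<And>i x y. i \<in> I \<Longrightarrow> M i x y \<noteq> 0 \<Longrightarrow> x \<in> C i \<and> y \<in> C i"
    and P: "\<And>i. i \<in> I \<Longrightarrow> harmonic_kernel (C i) (M i) (P i)"
  defines "Q \<equiv> \<lambda>x y. \<Sum>i\<in>I. of_bool (y \<in> C i) * P i x y"
  shows "harmonic_kernel (\<Union>i\<in>I. C i) (\<lambda>x y. \<Sum>i\<in>I. M i x y) Q"
    and "trace_poly (\<Union>i\<in>I. C i) rk Q = (\<Sum>i\<in>I. trace_poly (C i) rk (P i))"
proof -
  let ?C = "\<Union>i\<in>I. C i" and ?M = "\<lambda>x y. \<Sum>i\<in>I. M i x y"
  have single: "(\<Sum>j\<in>I. g j) = g i" if "i \<in> I" "\<And>j. j \<in> I \<Longrightarrow> j \<noteq> i \<Longrightarrow> g j = 0"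
    for i and g :: "'a \<Rightarrow> real"
  proof -
    have "(\<Sum>j\<in>I. g j) = (\<Sum>j\<in>I. if j = i then g i else 0)"
      using that(2) by (intro sum.cong) auto
    then show ?thesis using that(1) assms(1) by simp
  qed
  have Mi: "?M x y = M i x y" "?M y x = M i y x" if "i \<in> I" "x \<in> C i" for i x y
  proof -
    have "M j x y = 0 \<and> M j y x = 0" if "j \<in> I" "j \<noteq> i" for j
      using inc[OF that(1)] disj[OF \<open>i \<in> I\<close> that(1)] that(2) \<open>x \<in> C i\<close> by blast
    then show "?M x y = M i x y" "?M y x = M i y x"
      using single[OF \<open>i \<in> I\<close>] by simp_all
  qed
  have Q: "Q x y = P i x y" if "i \<in> I" "y \<in> C i" for i x y
    unfolding Q_def using that disj by (subst single[of i]) auto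
  have restrict: "(\<Sum>y\<in>?C. g y) = (\<Sum>y\<in>C i. g y)"
    if "i \<in> I" "\<And>y. y \<notin> C i \<Longrightarrow> g y = 0" for g :: "_ \<Rightarrow> real" and i
    using that assms(1,2) by (intro sum.mono_neutral_right) auto
  have dirac: "dirac ?C ?M f x = dirac (C i) (M i) f x" if "i \<in> I" "x \<in> C i" for f i x
  proof -
    have "dirac ?C ?M f x = (\<Sum>y\<in>?C. (M i x y + M i y x) * f y)"
      unfolding dirac_def using Mi[OF that] by simp
    also have "\<dots> = dirac (C i) (M i) f x"
    proof -
      have "M i x y = 0 \<and> M i y x = 0" if "y \<notin> C i" for y
        using inc[OF \<open>i \<in> I\<close>] that by blast
      then show ?thesis unfolding dirac_def by (intro restrict \<open>i \<in> I\<close>) simp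
    qed
    finally show ?thesis .
  qed
  have PX: "P i x y = 0" if "i \<in> I" "y \<in> C i" "x \<notin> C i" for i x y
    using P[OF that(1)] that by (auto simp: harmonic_kernel_def harmonic_def functions_on_def)
  have "harmonic ?C ?M (\<lambda>x. Q x y)" if y: "y \<in> ?C" for y
  proof -
    obtain i where i: "i \<in> I" "y \<in> C i" using y by blast
    have h: "harmonic (C i) (M i) (\<lambda>x. P i x y)"
      using P i by (auto simp: harmonic_kernel_def)
    have "dirac ?C ?M (\<lambda>x. P i x y) x = 0" if xC: "x \<in> ?C" for x
    proof -
      obtain j where j: "j \<in> I" "x \<in> C j" using xC by blast
      show ?thesis
      proof (cases "j = i")
        case True
        then show ?thesis using dirac[OF j] h j by (auto simp: harmonic_def)
      next
        case False
        have zero: "M j x z = 0 \<and> M j z x = 0 \<or> P i z y = 0" for z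
          using inc[OF j(1)] PX[OF i] disj[OF i(1) j(1)] False by blast
        have "(M j x z + M j z x) * P i z y = 0" for z
          using zero[of z] by auto
        then show ?thesis unfolding dirac[OF j] unfolding dirac_def by (intro sum.neutral) blast
      qed
    qed
    then show ?thesis
      using h i by (auto simp: harmonic_def Q functions_on_def)
  qed
  moreover have "(\<Sum>x\<in>?C. Q x y * f x) = f y" if f: "harmonic ?C ?M f" and y: "y \<in> ?C" for f y
  proof -
    obtain i where i: "i \<in> I" "y \<in> C i" using y by blast
    define g where "g x = (if x \<in> C i then f x else 0)" for x
    have "dirac (C i) (M i) g x = 0" if "x \<in> C i" for x
    proof -
      have "dirac (C i) (M i) g x = dirac (C i) (M i) f x"
        unfolding dirac_def g_def by (intro sum.cong) auto
      also have "\<dots> = 0"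
        using dirac[OF i(1) that, of f] f that i by (auto simp: harmonic_def)
      finally show ?thesis .
    qed
    then have "harmonic (C i) (M i) g" by (auto simp: harmonic_def functions_on_def g_def)
    then have "(\<Sum>x\<in>C i. P i x y * g x) = g y"
      using P i by (auto simp: harmonic_kernel_def)
    moreover have "(\<Sum>x\<in>?C. Q x y * f x) = (\<Sum>x\<in>C i. P i x y * g x)"
      using i PX by (subst restrict[OF i(1)]) (auto simp: Q g_def)
    ultimately show ?thesis using i by (simp add: g_def)
  qed
  ultimately show "harmonic_kernel ?C ?M Q" by (auto simp: harmonic_kernel_def)
  have "trace_poly ?C rk Q = (\<Sum>i\<in>I. \<Sum>x\<in>C i. Polynomial.monom (Q x x) (rk x))"
    unfolding trace_poly_def using assms(1,2) disj by (intro sum.UNION_disjoint) auto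
  then show "trace_poly ?C rk Q = (\<Sum>i\<in>I. trace_poly (C i) rk (P i))"
    unfolding trace_poly_def using Q by simp
qed

section \<open>Cell posets and the uniqueness of incidence numbers\<close>

text \<open>
  The combinatorics of the boundaries of convex cells. The entries of \<open>M\<close> are \<open>1\<close> or \<open>-1\<close> at the
  facets \<open>y\<close> of a cell \<open>x\<close> and \<open>0\<close> elsewhere. The assumptions \<open>thin\<close> and \<open>diamond\<close> say that between a
  cell and a face of codimension two there are exactly two cells, which contribute with opposite
  signs; \<open>edge\<close> is the analogue in which the empty cell would be the face of codimension two.
  By \<open>strongly_connected\<close>, two facets of a cell of dimension at least two can be joined by passing
  twice to a facet with a common facet; two steps are enough for products of simplices.
\<close>

locale oriented_cells =
  fixes C :: "'c set" and face :: "'c \<Rightarrow> 'c \<Rightarrow> bool" and rk :: "'c \<Rightarrow> nat"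
    and M :: "'c \<Rightarrow> 'c \<Rightarrow> real"
  assumes fin: "finite C"
    and face_refl: "x \<in> C \<Longrightarrow> face x x"
    and inc: "M x y \<noteq> 0 \<Longrightarrow> x \<in> C \<and> y \<in> C \<and> face y x \<and> rk x = Suc (rk y) \<and> M x y * M x y = 1"
    and facet_above: "x \<in> C \<Longrightarrow> y \<in> C \<Longrightarrow> face y x \<Longrightarrow> y \<noteq> x \<Longrightarrow> \<exists>w. M x w \<noteq> 0 \<and> face y w"
    and facet_exists: "x \<in> C \<Longrightarrow> rk x \<noteq> 0 \<Longrightarrow> \<exists>y. M x y \<noteq> 0"
    and edge: "rk x = 1 \<Longrightarrow> M x y \<noteq> 0 \<Longrightarrow> M x y' \<noteq> 0 \<Longrightarrow> y \<noteq> y' \<Longrightarrow> M x y' = - M x y"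
    and diamond: "M x y \<noteq> 0 \<Longrightarrow> M y z \<noteq> 0 \<Longrightarrow> M x y' \<noteq> 0 \<Longrightarrow> M y' z \<noteq> 0 \<Longrightarrow> y \<noteq> y'
      \<Longrightarrow> M x y' * M y' z = - (M x y * M y z)"
    and thin: "M x y \<noteq> 0 \<Longrightarrow> M y z \<noteq> 0 \<Longrightarrow> \<exists>y'. y' \<noteq> y \<and> M x y' \<noteq> 0 \<and> M y' z \<noteq> 0"
    and strongly_connected: "2 \<le> rk x \<Longrightarrow> M x y \<noteq> 0 \<Longrightarrow> M x y' \<noteq> 0
      \<Longrightarrow> \<exists>w z z'. M x w \<noteq> 0 \<and> M y z \<noteq> 0 \<and> M w z \<noteq> 0 \<and> M w z' \<noteq> 0 \<and> M y' z' \<noteq> 0"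
begin

lemma rank_less:
  assumes "x \<in> C" "y \<in> C" "face y x" "y \<noteq> x"
  shows "rk y < rk x"
  using assms
proof (induction "rk x" arbitrary: x rule: less_induct)
  case less
  obtain w where w: "M x w \<noteq> 0" "face y w" using facet_above[OF less.prems] by blast
  then have "w \<in> C" "rk w < rk x" using inc by fastforce+
  then show ?case
    using less.hyps[OF \<open>rk w < rk x\<close> \<open>w \<in> C\<close> less.prems(2) w(2)] by (cases "y = w") auto
qed

text \<open>
  The support of \<open>M\<close> can be recovered from the order, so it is preserved by isomorphisms of posets.
\<close>

lemma incident_iff_cover:
  "M x y \<noteq> 0 \<longleftrightarrow> x \<in> C \<and> y \<in> C \<and> face y x \<and> y \<noteq> x \<and>
    (\<forall>z\<in>C. face y z \<and> face z x \<longrightarrow> z = y \<or> z = x)"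
proof
  assume xy: "M x y \<noteq> 0"
  have i: "x \<in> C" "y \<in> C" "face y x" "rk x = Suc (rk y)" using inc[OF xy] by auto
  have "z = y \<or> z = x" if z: "z \<in> C" "face y z" "face z x" for z
  proof (rule ccontr)
    assume "\<not> (z = y \<or> z = x)"
    then have "rk y < rk z" "rk z < rk x"
      using rank_less[OF z(1) i(2) z(2)] rank_less[OF i(1) z(1) z(3)] by auto
    with i show False by linarith
  qed
  moreover have "y \<noteq> x" using i(4) by auto
  ultimately show "x \<in> C \<and> y \<in> C \<and> face y x \<and> y \<noteq> x \<and>
      (\<forall>z\<in>C. face y z \<and> face z x \<longrightarrow> z = y \<or> z = x)"
    using i by blast
next
  assume cov: "x \<in> C \<and> y \<in> C \<and> face y x \<and> y \<noteq> x \<and>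
      (\<forall>z\<in>C. face y z \<and> face z x \<longrightarrow> z = y \<or> z = x)"
  then obtain w where w: "M x w \<noteq> 0" "face y w" using facet_above by blast
  have "w \<in> C" "face w x" "w \<noteq> x" using inc[OF w(1)] by auto
  then have "w = y" using cov w(2) by blast
  then show "M x y \<noteq> 0" using w(1) by simp
qed

text \<open>
  Two cells between \<open>x\<close> and \<open>z\<close> have opposite contributions. Hence there are at most two of them, and
  by \<open>thin\<close> not just one.
\<close>

lemma d_squared: "(\<Sum>y\<in>C. M x y * M y z) = 0"
proof (cases "\<exists>y. M x y * M y z \<noteq> 0")
  case True
  then obtain y where y: "M x y \<noteq> 0" "M y z \<noteq> 0" by auto
  then obtain y' where y': "y' \<noteq> y" "M x y' \<noteq> 0" "M y' z \<noteq> 0" using thin by blast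
  note opp = diamond[OF y y'(2,3) y'(1)[symmetric]]
  have "M x u * M u z = 0" if "u \<notin> {y, y'}" for u
  proof (rule ccontr)
    assume "M x u * M u z \<noteq> 0"
    then have u: "M x u \<noteq> 0" "M u z \<noteq> 0" by auto
    have "M x u * M u z = - (M x y * M y z)" "M x u * M u z = - (M x y' * M y' z)"
      using diamond[OF y u] diamond[OF y'(2,3) u] that by auto
    then show False using opp y by simp
  qed
  then have "(\<Sum>y\<in>C. M x y * M y z) = (\<Sum>y\<in>{y, y'}. M x y * M y z)"
    using inc[OF y(1)] inc[OF y'(2)] fin by (intro sum.mono_neutral_right) auto
  also have "\<dots> = 0" using y'(1) opp by simp
  finally show ?thesis .
qed (intro sum.neutral, blast)

sublocale graded_cochains C rk M
  using fin inc d_squared by unfold_locales blast+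

end

text \<open>
  The dimension is preserved since a cell of positive dimension lies one above any of its facets, and
  facets correspond to facets.
\<close>

lemma cells_isomorphism:
  assumes "oriented_cells C face rk M" "oriented_cells C' face' rk' M'"
    and bij: "bij_betw \<phi> C C'"
    and face: "\<And>x y. x \<in> C \<Longrightarrow> y \<in> C \<Longrightarrow> face x y \<longleftrightarrow> face' (\<phi> x) (\<phi> y)"
  shows incident_isomorphism: "x \<in> C \<Longrightarrow> y \<in> C \<Longrightarrow> M' (\<phi> x) (\<phi> y) \<noteq> 0 \<longleftrightarrow> M x y \<noteq> 0"
    and rank_isomorphism: "x \<in> C \<Longrightarrow> rk' (\<phi> x) = rk x"
proof -
  interpret A: oriented_cells C face rk M by fact
  interpret B: oriented_cells C' face' rk' M' by fact
  have img: "\<phi> x \<in> C'" if "x \<in> C" for x using bij that by (auto simp: bij_betw_def)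
  have inj: "\<phi> x = \<phi> y \<longleftrightarrow> x = y" if "x \<in> C" "y \<in> C" for x y
    using bij that by (auto simp: bij_betw_def inj_on_eq_iff)
  have all: "(\<forall>z\<in>C'. R z) \<longleftrightarrow> (\<forall>z\<in>C. R (\<phi> z))" for R
    using bij by (auto simp: bij_betw_def)
  show incident: "M' (\<phi> x) (\<phi> y) \<noteq> 0 \<longleftrightarrow> M x y \<noteq> 0" if "x \<in> C" "y \<in> C" for x y
    unfolding A.incident_iff_cover B.incident_iff_cover all
    using that img by (simp add: inj face cong: ball_cong)
  show "rk' (\<phi> x) = rk x" if "x \<in> C"
    using that
  proof (induction "rk x" arbitrary: x rule: less_induct)
    case less
    show ?case
    proof (cases "rk x = 0")
      case True
      have "rk' (\<phi> x) = 0"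
      proof (rule ccontr)
        assume "rk' (\<phi> x) \<noteq> 0"
        then obtain u where u: "M' (\<phi> x) u \<noteq> 0" using B.facet_exists img less.prems by blast
        then have "u \<in> C'" using B.inc by blast
        then obtain y where "y \<in> C" "u = \<phi> y" using bij by (auto simp: bij_betw_def)
        then have "M x y \<noteq> 0" using incident less.prems u by blast
        then show False using A.inc[of x y] True by simp
      qed
      then show ?thesis using True by simp
    next
      case False
      then obtain y where y: "M x y \<noteq> 0" using A.facet_exists less.prems by blast
      then have yC: "y \<in> C" "rk x = Suc (rk y)" using A.inc by blast+
      then have "rk' (\<phi> x) = Suc (rk' (\<phi> y))" using incident less.prems y B.inc by blast
      then show ?thesis using less.hyps[of y] yC by simp
    qed
  qed
qed

text \<open>
  The signs \<open>r x y\<close> by which two incidence matrices differ must be written as \<open>\<epsilon> x * \<epsilon> y\<close>. Starting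
  with \<open>\<epsilon> = 1\<close> on vertices, the equation dictates the value of \<open>\<epsilon>\<close> at \<open>x\<close> through any facet of \<open>x\<close>.
  Facets with a common facet give the same value because the diamonds of both matrices cancel;
  strong connectivity then covers all pairs of facets, and \<open>edge\<close> those of a one-dimensional cell.
\<close>

lemma gauge_equivalence:
  assumes cells: "oriented_cells C face rk M" "oriented_cells C' face' rk' M'"
    and bij: "bij_betw \<phi> C C'"
    and face: "\<And>x y. x \<in> C \<Longrightarrow> y \<in> C \<Longrightarrow> face x y \<longleftrightarrow> face' (\<phi> x) (\<phi> y)"
  shows "\<exists>\<epsilon>. (\<forall>x. \<epsilon> x * \<epsilon> x = (1::real)) \<and>
    (\<forall>x\<in>C. \<forall>y\<in>C. M' (\<phi> x) (\<phi> y) = \<epsilon> x * \<epsilon> y * M x y)"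
proof -
  interpret A: oriented_cells C face rk M by fact
  interpret B: oriented_cells C' face' rk' M' by fact
  have incident: "M' (\<phi> x) (\<phi> y) \<noteq> 0 \<longleftrightarrow> M x y \<noteq> 0" if "x \<in> C" "y \<in> C" for x y
    by (rule incident_isomorphism[OF cells bij face that])
  have rank: "rk' (\<phi> x) = rk x" if "x \<in> C" for x
    by (rule rank_isomorphism[OF cells bij face that])
  have inj: "\<phi> x \<noteq> \<phi> y" if "x \<in> C" "y \<in> C" "x \<noteq> y" for x y
    using bij that by (auto simp: bij_betw_def inj_on_eq_iff)
  have A: "x \<in> C" "y \<in> C" "rk x = Suc (rk y)" "M x y * M x y = 1"
      and B: "M' (\<phi> x) (\<phi> y) \<noteq> 0" "M' (\<phi> x) (\<phi> y) * M' (\<phi> x) (\<phi> y) = 1"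
    if "M x y \<noteq> 0" for x y
  proof -
    show xy: "x \<in> C" "y \<in> C" "rk x = Suc (rk y)" "M x y * M x y = 1"
      using A.inc[OF that] by auto
    show "M' (\<phi> x) (\<phi> y) \<noteq> 0" using incident[OF xy(1,2)] that by simp
    then show "M' (\<phi> x) (\<phi> y) * M' (\<phi> x) (\<phi> y) = 1" using B.inc by blast
  qed
  define r where "r x y = M' (\<phi> x) (\<phi> y) * M x y" for x y
  have rM: "r x y * M x y = M' (\<phi> x) (\<phi> y)" if "M x y \<noteq> 0" for x y
    using A(4)[OF that] by (simp add: r_def mult.assoc)
  have rr: "r x y * r x y = 1" if "M x y \<noteq> 0" for x y
  proof -
    have "r x y * r x y = (M' (\<phi> x) (\<phi> y) * M' (\<phi> x) (\<phi> y)) * (M x y * M x y)"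
      by (simp only: r_def mult_ac)
    then show ?thesis using A(4)[OF that] B(2)[OF that] by simp
  qed
  have r_edge: "r x y = r x y'" if "rk x = 1" "M x y \<noteq> 0" "M x y' \<noteq> 0" for x y y'
  proof (cases "y = y'")
    case False
    have "M x y' = - M x y" using A.edge[OF that False] .
    moreover have "M' (\<phi> x) (\<phi> y') = - M' (\<phi> x) (\<phi> y)"
      using B.edge[OF _ B(1)[OF that(2)] B(1)[OF that(3)]] inj[OF A(2)[OF that(2)] A(2)[OF that(3)] False]
        rank[OF A(1)[OF that(2)]] that(1) by simp
    ultimately show ?thesis by (simp add: r_def)
  qed simp
  have r_diamond: "r x y * r y z = r x y' * r y' z"
    if n: "M x y \<noteq> 0" "M y z \<noteq> 0" "M x y' \<noteq> 0" "M y' z \<noteq> 0" for x y y' z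
  proof (cases "y = y'")
    case False
    have 1: "M x y' * M y' z = - (M x y * M y z)" using A.diamond[OF n False] .
    have 2: "M' (\<phi> x) (\<phi> y') * M' (\<phi> y') (\<phi> z) = - (M' (\<phi> x) (\<phi> y) * M' (\<phi> y) (\<phi> z))"
      using B.diamond[OF B(1)[OF n(1)] B(1)[OF n(2)] B(1)[OF n(3)] B(1)[OF n(4)]]
        inj[OF A(2)[OF n(1)] A(2)[OF n(3)] False] by blast
    have "r x y' * r y' z = (M' (\<phi> x) (\<phi> y') * M' (\<phi> y') (\<phi> z)) * (M x y' * M y' z)"
      by (simp only: r_def mult_ac)
    also have "\<dots> = (M' (\<phi> x) (\<phi> y) * M' (\<phi> y) (\<phi> z)) * (M x y * M y z)"
      by (simp only: 1 2 minus_mult_minus)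
    also have "\<dots> = r x y * r y z" by (simp only: r_def mult_ac)
    finally show ?thesis by simp
  qed simp
  have "\<exists>\<epsilon>. (\<forall>x. \<epsilon> x * \<epsilon> x = (1::real)) \<and> (\<forall>x. rk x = 0 \<longrightarrow> \<epsilon> x = 1) \<and>
      (\<forall>x y. M x y \<noteq> 0 \<longrightarrow> rk x \<le> n \<longrightarrow> r x y = \<epsilon> x * \<epsilon> y)" for n
  proof (induction n)
    case 0
    show ?case using A(3) by (intro exI[of _ "\<lambda>_. 1"]) auto
  next
    case (Suc n)
    then obtain \<epsilon> where sq: "\<And>x. \<epsilon> x * \<epsilon> x = (1::real)" and base: "\<And>x. rk x = 0 \<Longrightarrow> \<epsilon> x = 1"
      and step: "\<And>x y. M x y \<noteq> 0 \<Longrightarrow> rk x \<le> n \<Longrightarrow> r x y = \<epsilon> x * \<epsilon> y" by blast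
    have via: "r x y * \<epsilon> y = r x y' * \<epsilon> y'"
      if "rk x = Suc n" "M x y \<noteq> 0" "M x y' \<noteq> 0" "M y z \<noteq> 0" "M y' z \<noteq> 0" for x y y' z
    proof -
      have e: "\<epsilon> u = r u z * \<epsilon> z" if "M u z \<noteq> 0" "M x u \<noteq> 0" for u
        using step[OF that(1)] A(3)[OF that(2)] \<open>rk x = Suc n\<close> sq[of z] by (simp add: mult.assoc)
      have "r x y * \<epsilon> y = (r x y * r y z) * \<epsilon> z"
        using e[OF that(4,2)] by (simp only: mult.assoc)
      also have "\<dots> = (r x y' * r y' z) * \<epsilon> z" 
        by (simp only: r_diamond[OF that(2,4,3,5)])
      also have "\<dots> = r x y' * \<epsilon> y'"
        using e[OF that(5,3)] by (simp only: mult.assoc)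
      finally show ?thesis .
    qed
    have wd: "r x y * \<epsilon> y = r x y' * \<epsilon> y'"
      if n: "rk x = Suc n" "M x y \<noteq> 0" "M x y' \<noteq> 0" for x y y'
    proof (cases "n = 0")
      case True
      then show ?thesis
        using r_edge[of x y y'] n A(3)[OF n(2)] A(3)[OF n(3)] base by simp
    next
      case False
      then obtain w z z' where "M x w \<noteq> 0" "M y z \<noteq> 0" "M w z \<noteq> 0" "M w z' \<noteq> 0" "M y' z' \<noteq> 0"
        using A.strongly_connected[OF _ n(2,3)] n(1) by fastforce
      then show ?thesis using via[OF n(1,2), of w z] via[OF n(1) _ n(3), of w z'] by simp
    qed
    (* The value at x is computed through an arbitrarily chosen facet f x. *)
    define f where "f x = (SOME y. M x y \<noteq> 0)" for x
    have f: "M x (f x) \<noteq> 0" if "M x y \<noteq> 0" for x y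
      unfolding f_def using that by (rule someI)
    define \<epsilon>' where "\<epsilon>' x = (if rk x = Suc n \<and> (\<exists>y. M x y \<noteq> 0) then r x (f x) * \<epsilon> (f x) else \<epsilon> x)" for x
    have "\<epsilon>' x * \<epsilon>' x = 1" for x
    proof (cases "rk x = Suc n \<and> (\<exists>y. M x y \<noteq> 0)")
      case True
      have "\<epsilon>' x * \<epsilon>' x = (r x (f x) * r x (f x)) * (\<epsilon> (f x) * \<epsilon> (f x))"
        using True by (simp add: \<epsilon>'_def)
      then show ?thesis using True rr f sq by auto
    qed (auto simp: \<epsilon>'_def sq)
    moreover have "\<epsilon>' x = 1" if "rk x = 0" for x using that base by (simp add: \<epsilon>'_def)
    moreover have "r x y = \<epsilon>' x * \<epsilon>' y" if xy: "M x y \<noteq> 0" and face: "rk x \<le> Suc n" for x y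
    proof -
      have y: "\<epsilon>' y = \<epsilon> y" using A(3)[OF xy] face by (simp add: \<epsilon>'_def)
      show ?thesis
      proof (cases "rk x = Suc n")
        case True
        then have "\<epsilon>' x = r x y * \<epsilon> y"
          using wd[OF True xy f[OF xy]] xy by (auto simp: \<epsilon>'_def)
        then show ?thesis using sq[of y] y by (simp add: mult.assoc)
      next
        case False
        then show ?thesis using step[OF xy] face y by (simp add: \<epsilon>'_def)
      qed
    qed
    ultimately show ?case by blast
  qed
  from this[of "Max (rk ` C)"] obtain \<epsilon> where sq: "\<And>x. \<epsilon> x * \<epsilon> x = (1::real)"
    and eq: "\<And>x y. M x y \<noteq> 0 \<Longrightarrow> rk x \<le> Max (rk ` C) \<Longrightarrow> r x y = \<epsilon> x * \<epsilon> y" by blast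
  have "M' (\<phi> x) (\<phi> y) = \<epsilon> x * \<epsilon> y * M x y" if "x \<in> C" "y \<in> C" for x y
  proof (cases "M x y = 0")
    case True
    then show ?thesis using incident[OF that] by simp
  next
    case False
    have "rk x \<le> Max (rk ` C)" using A.fin that by simp
    then show ?thesis using eq[OF False] rM[OF False] by simp
  qed
  with sq show ?thesis by blast
qed

lemma trace_poly_isomorphism:
  assumes cells: "oriented_cells C face rk M" "oriented_cells C' face' rk' M'"
    and bij: "bij_betw \<phi> C C'"
    and face: "\<And>x y. x \<in> C \<Longrightarrow> y \<in> C \<Longrightarrow> face x y \<longleftrightarrow> face' (\<phi> x) (\<phi> y)"
    and Q: "harmonic_kernel C' M' Q"
  shows "\<exists>P. harmonic_kernel C M P \<and> trace_poly C rk P = trace_poly C' rk' Q"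
proof -
  obtain \<epsilon> where sq: "\<And>x. \<epsilon> x * \<epsilon> x = (1::real)"
    and gauge: "\<And>x y. x \<in> C \<Longrightarrow> y \<in> C \<Longrightarrow> M' (\<phi> x) (\<phi> y) = \<epsilon> x * \<epsilon> y * M x y"
    using gauge_equivalence[OF cells bij face] by blast
  define P where "P x y = of_bool (x \<in> C) * \<epsilon> x * \<epsilon> y * Q (\<phi> x) (\<phi> y)" for x y
  have ker: "harmonic_kernel C M P"
    unfolding P_def using harmonic_kernel_gauge[OF bij sq gauge Q] .
  have "P x x = Q (\<phi> x) (\<phi> x)" if "x \<in> C" for x
    using that sq by (simp add: P_def)
  moreover have rank: "rk' (\<phi> x) = rk x" if "x \<in> C" for x
    by (rule rank_isomorphism[OF cells bij face that])
  ultimately have "trace_poly C rk P = (\<Sum>x\<in>C. Polynomial.monom (Q (\<phi> x) (\<phi> x)) (rk' (\<phi> x)))"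
    unfolding trace_poly_def by (intro sum.cong refl) simp
  also have "\<dots> = trace_poly C' rk' Q"
    unfolding trace_poly_def
    by (rule sum.reindex_bij_betw[OF bij, of "\<lambda>y. Polynomial.monom (Q y y) (rk' y)"])
  finally have "trace_poly C rk P = trace_poly C' rk' Q" .
  with ker show ?thesis by blast
qed

section \<open>Products of cell posets\<close>

text \<open>
  A facet of a product cell changes exactly one coordinate. In a diamond whose two steps change
  different coordinates, the opposite signs come from the factor \<open>(-1) ^ rk x\<close>. Two facets that
  change the same coordinate \<open>x\<close> are joined inside this factor if \<open>x\<close> has dimension at least two, and
  through a facet of the other coordinate if \<open>x\<close> is an edge.
\<close>

lemma oriented_cells_cons:
  assumes "oriented_cells C face rk M" "oriented_cells Y face' rk' N"
    and face: "\<And>x xs y ys. face'' (x # xs) (y # ys) \<longleftrightarrow> face x y \<and> face' xs ys"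
    and rank: "\<And>x xs. rk'' (x # xs) = rk x + rk' xs"
  shows "oriented_cells (set_Cons C Y) face'' rk'' (cons_incidence C Y rk M N)"
proof -
  interpret A: oriented_cells C face rk M by fact
  interpret B: oriented_cells Y face' rk' N by fact
  define I where "I = cons_incidence C Y rk M N"
  have M: "x \<in> C" "y \<in> C" "face y x" "rk x = Suc (rk y)" "M x y * M x y = 1" if "M x y \<noteq> 0" for x y
    using A.inc[OF that] by auto
  have N: "x \<in> Y" "y \<in> Y" "face' y x" "rk' x = Suc (rk' y)" "N x y * N x y = 1"
    if "N x y \<noteq> 0" for x y
    using B.inc[OF that] by auto
  have M0 [simp]: "M x x = 0" and N0 [simp]: "N xs xs = 0" for x xs
    using M(4)[of x x] N(4)[of xs xs] by auto
  have M2: "M y x = 0" if "M x y \<noteq> 0" for x y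
    using M(4)[OF that] M(4)[of y x] by (cases "M y x = 0") auto
  have I1: "I (x # xs) (y # xs) = M x y" if "M x y \<noteq> 0" "xs \<in> Y" for x y xs
    using that M(1)[OF that(1)] by (auto simp: I_def cons_simps)
  have I2: "I (x # xs) (x # ys) = (-1) ^ rk x * N xs ys" if "N xs ys \<noteq> 0" "x \<in> C" for x xs ys
    using that N(1)[OF that(1)] by (auto simp: I_def cons_simps)
  have E: "I (x # xs) w \<noteq> 0 \<longleftrightarrow>
      (\<exists>y. w = y # xs \<and> M x y \<noteq> 0 \<and> xs \<in> Y) \<or> (\<exists>ys. w = x # ys \<and> N xs ys \<noteq> 0 \<and> x \<in> C)"
    for x xs w
    using M(1) N(1) by (cases w) (auto simp: I_def cons_simps cons_incidence_def)
  have facet_pair [consumes 2, case_names both both' m1 m2]: R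
    if "I (x # xs) y \<noteq> 0" "I (x # xs) y' \<noteq> 0"
      and "\<And>y1 y2. y = y1 # xs \<Longrightarrow> y' = y2 # xs \<Longrightarrow> M x y1 \<noteq> 0 \<Longrightarrow> M x y2 \<noteq> 0 \<Longrightarrow> xs \<in> Y \<Longrightarrow> R"
      and "\<And>y1 y2. y = x # y1 \<Longrightarrow> y' = x # y2 \<Longrightarrow> N xs y1 \<noteq> 0 \<Longrightarrow> N xs y2 \<noteq> 0 \<Longrightarrow> x \<in> C \<Longrightarrow> R"
      and "\<And>y1 ys. y = y1 # xs \<Longrightarrow> M x y1 \<noteq> 0 \<Longrightarrow> xs \<in> Y \<Longrightarrow> y' = x # ys \<Longrightarrow> N xs ys \<noteq> 0 \<Longrightarrow> x \<in> C \<Longrightarrow> R"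
      and "\<And>y1 ys. y' = y1 # xs \<Longrightarrow> M x y1 \<noteq> 0 \<Longrightarrow> xs \<in> Y \<Longrightarrow> y = x # ys \<Longrightarrow> N xs ys \<noteq> 0 \<Longrightarrow> x \<in> C \<Longrightarrow> R"
    for x xs y y' R
    using that unfolding E by blast
  have Nil: "I [] w = 0" for w by (simp add: I_def cons_incidence_def)
  show ?thesis
    unfolding I_def[symmetric]
  proof
    show "finite (set_Cons C Y)" using A.fin B.fin by (simp add: set_Cons_eq)
  next
    fix x assume "x \<in> set_Cons C Y"
    then show "face'' x x" by (auto simp: set_Cons_def face A.face_refl B.face_refl)
  next
    fix zs ws assume "I zs ws \<noteq> 0"
    then show "zs \<in> set_Cons C Y \<and> ws \<in> set_Cons C Y \<and> face'' ws zs \<and> rk'' zs = Suc (rk'' ws)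
        \<and> I zs ws * I zs ws = 1"
      using M N A.face_refl B.face_refl
      by (cases zs) (auto simp: E Nil face rank I1 I2 power2_eq_square[symmetric] power_mult_distrib
          power_mult[symmetric])
  next
    fix zs ws assume m: "zs \<in> set_Cons C Y" "ws \<in> set_Cons C Y" "face'' ws zs" "ws \<noteq> zs"
    obtain x xs where zs: "zs = x # xs" "x \<in> C" "xs \<in> Y" using m(1) by (auto simp: set_Cons_def)
    obtain y ys where ws: "ws = y # ys" "y \<in> C" "ys \<in> Y" using m(2) by (auto simp: set_Cons_def)
    have f: "face y x" "face' ys xs" "y \<noteq> x \<or> ys \<noteq> xs" using m(3,4) zs ws by (auto simp: face)
    show "\<exists>w. I zs w \<noteq> 0 \<and> face'' ws w"
    proof (cases "y = x")
      case False
      then obtain w where "M x w \<noteq> 0" "face y w" using A.facet_above zs ws f by blast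
      then show ?thesis using zs ws f by (intro exI[of _ "w # xs"]) (auto simp: E face)
    next
      case True
      then obtain w where "N xs w \<noteq> 0" "face' ys w" using B.facet_above zs ws f True by blast
      then show ?thesis using zs ws f True A.face_refl
        by (intro exI[of _ "x # w"]) (auto simp: E face)
    qed
  next
    fix zs assume "zs \<in> set_Cons C Y" "rk'' zs \<noteq> 0"
    then obtain x xs where zs: "zs = x # xs" "x \<in> C" "xs \<in> Y" "rk x \<noteq> 0 \<or> rk' xs \<noteq> 0"
      by (auto simp: set_Cons_def rank)
    then have "(\<exists>y. M x y \<noteq> 0) \<or> (\<exists>ys. N xs ys \<noteq> 0)"
      using A.facet_exists B.facet_exists by blast
    then show "\<exists>y. I zs y \<noteq> 0"
      unfolding zs(1) E using zs(2,3) by blast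
  next
    fix zs y y' assume r: "rk'' zs = 1" and n: "I zs y \<noteq> 0" "I zs y' \<noteq> 0" "y \<noteq> y'"
    obtain x xs where zs: "zs = x # xs" using n(1) Nil by (cases zs) auto
    have mixed: "R" if "M x u \<noteq> 0" "N xs v \<noteq> 0" for u v R
      using M(4)[OF that(1)] N(4)[OF that(2)] r by (simp add: zs rank)
    from n(1,2)[unfolded zs] show "I zs y' = - I zs y"
    proof (cases rule: facet_pair)
      case (both y1 y2)
      have "rk x = 1" using M(4)[OF both(3)] r by (simp add: zs rank)
      then show ?thesis using A.edge[OF _ both(3,4)] both n(3) by (simp add: zs I1)
    next
      case (both' y1 y2)
      have "rk' xs = 1" using N(4)[OF both'(3)] r by (simp add: zs rank)
      then show ?thesis using B.edge[OF _ both'(3,4)] both' n(3) by (simp add: zs I2)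
    next
      case (m1 y1 ys)
      show ?thesis by (rule mixed[OF m1(2,5)])
    next
      case (m2 y1 ys)
      show ?thesis by (rule mixed[OF m2(2,5)])
    qed
  next
    fix zs y z y'
    assume n: "I zs y \<noteq> 0" "I y z \<noteq> 0" "I zs y' \<noteq> 0" "I y' z \<noteq> 0" and ne: "y \<noteq> y'"
    obtain x xs where zs: "zs = x # xs" using n(1) Nil by (cases zs) auto
    have mixed: "I zs u' * I u' z = - (I zs u * I u z)"
      if u: "u = y1 # xs" "M x y1 \<noteq> 0" "xs \<in> Y" "I u z \<noteq> 0"
        and u': "u' = x # ys" "N xs ys \<noteq> 0" "x \<in> C" "I u' z \<noteq> 0" for u u' y1 ys
    proof -
      have "x \<noteq> y1" "xs \<noteq> ys" using u(2) u'(2) by auto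
      moreover have "\<not> (M y1 x \<noteq> 0)" using M2[OF u(2)] by simp
      ultimately have z: "z = y1 # ys" using u(4) u'(4) unfolding u(1) u'(1) E by auto
      have "(-1::real) ^ rk x = - ((-1) ^ rk y1)" using M(4)[OF u(2)] by simp
      then show ?thesis
        using I1[OF u(2,3)] I2[OF u'(2) M(2)[OF u(2)]] I2[OF u'(2,3)] I1[OF u(2) N(2)[OF u'(2)]]
        by (simp add: zs z u(1) u'(1))
    qed
    from n(1,3)[unfolded zs] show "I zs y' * I y' z = - (I zs y * I y z)"
    proof (cases rule: facet_pair)
      case (both y1 y2)
      have "y1 \<noteq> y2" using ne both by simp
      then obtain z1 where z1: "z = z1 # xs" "M y1 z1 \<noteq> 0" "M y2 z1 \<noteq> 0"
        using n(2,4) unfolding both E by auto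
      have opp: "M x y2 * M y2 z1 = - (M x y1 * M y1 z1)"
        by (rule A.diamond[OF both(3) z1(2) both(4) z1(3) \<open>y1 \<noteq> y2\<close>])
      show ?thesis
        unfolding zs both(1,2) z1(1) I1[OF both(3,5)] I1[OF both(4,5)] I1[OF z1(2) both(5)]
          I1[OF z1(3) both(5)] by (rule opp)
    next
      case (both' y1 y2)
      have "y1 \<noteq> y2" using ne both' by simp
      then obtain z1 where z1: "z = x # z1" "N y1 z1 \<noteq> 0" "N y2 z1 \<noteq> 0"
        using n(2,4) unfolding both' E by auto
      have opp: "N xs y2 * N y2 z1 = - (N xs y1 * N y1 z1)"
        by (rule B.diamond[OF both'(3) z1(2) both'(4) z1(3) \<open>y1 \<noteq> y2\<close>])
      have "I zs (x # v) * I (x # v) z = N xs v * N v z1" if "N xs v \<noteq> 0" "N v z1 \<noteq> 0" for v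
        using I2[OF that(1) both'(5)] I2[OF that(2) both'(5)]
        by (simp add: zs z1(1) flip: power_add)
      then show ?thesis using opp both' z1 by simp
    next
      case (m1 y1 ys)
      then show ?thesis using mixed[OF m1(1-3) n(2) m1(4-6) n(4)] by simp
    next
      case (m2 y1 ys)
      then show ?thesis using mixed[OF m2(1-3) n(4) m2(4-6) n(2)] by simp
    qed
  next
    fix zs y z assume n: "I zs y \<noteq> 0" "I y z \<noteq> 0"
    obtain x xs where zs: "zs = x # xs" using n(1) Nil by (cases zs) auto
    consider (11) y1 z1 where "y = y1 # xs" "M x y1 \<noteq> 0" "xs \<in> Y" "z = z1 # xs" "M y1 z1 \<noteq> 0"
      | (12) y1 ys where "y = y1 # xs" "M x y1 \<noteq> 0" "xs \<in> Y" "z = y1 # ys" "N xs ys \<noteq> 0"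
      | (21) y1 ys where "y = x # ys" "N xs ys \<noteq> 0" "x \<in> C" "z = y1 # ys" "M x y1 \<noteq> 0"
      | (22) y1 z1 where "y = x # y1" "N xs y1 \<noteq> 0" "x \<in> C" "z = x # z1" "N y1 z1 \<noteq> 0"
      using n unfolding zs E by (auto simp: E)
    then show "\<exists>y'. y' \<noteq> y \<and> I zs y' \<noteq> 0 \<and> I y' z \<noteq> 0"
    proof cases
      case 11
      then obtain u where "u \<noteq> y1" "M x u \<noteq> 0" "M u z1 \<noteq> 0" using A.thin by blast
      then show ?thesis using 11 by (intro exI[of _ "u # xs"]) (simp add: zs E)
    next
      case 12
      then have "x \<noteq> y1" by auto
      then show ?thesis using 12 M(1) N(2) by (intro exI[of _ "x # ys"]) (auto simp: zs E)
    next
      case 21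
      then have "x \<noteq> y1" by auto
      then show ?thesis using 21 M(2) N(1) by (intro exI[of _ "y1 # xs"]) (auto simp: zs E)
    next
      case 22
      then obtain u where "u \<noteq> y1" "N xs u \<noteq> 0" "N u z1 \<noteq> 0" using B.thin by blast
      then show ?thesis using 22 by (intro exI[of _ "x # u"]) (simp add: zs E)
    qed
  next
    fix zs y y' assume r: "2 \<le> rk'' zs" and n: "I zs y \<noteq> 0" "I zs y' \<noteq> 0"
    let ?Conn = "\<lambda>y y'. \<exists>w z z'. I zs w \<noteq> 0 \<and> I y z \<noteq> 0 \<and> I w z \<noteq> 0 \<and> I w z' \<noteq> 0 \<and> I y' z' \<noteq> 0"
    obtain x xs where zs: "zs = x # xs" using n(1) Nil by (cases zs) auto
    from n[unfolded zs] show "?Conn y y'"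
    proof (cases rule: facet_pair)
      case (both y1 y2)
      show ?thesis
      proof (cases "2 \<le> rk x")
        case True
        then obtain w z z' where "M x w \<noteq> 0" "M y1 z \<noteq> 0" "M w z \<noteq> 0" "M w z' \<noteq> 0" "M y2 z' \<noteq> 0"
          using A.strongly_connected[OF _ both(3,4)] by blast
        then show ?thesis using both
          by (intro exI[of _ "w # xs"] exI[of _ "z # xs"] exI[of _ "z' # xs"]) (simp add: zs E)
      next
        case False
        then have "rk' xs \<noteq> 0" using r by (simp add: zs rank)
        then obtain ys where ys: "N xs ys \<noteq> 0" using B.facet_exists both(5) by blast
        then show ?thesis using both M(1,2)[OF both(3)] M(2)[OF both(4)] N(2)[OF ys]
          by (intro exI[of _ "x # ys"] exI[of _ "y1 # ys"] exI[of _ "y2 # ys"]) (simp add: zs E)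
      qed
    next
      case (both' y1 y2)
      show ?thesis
      proof (cases "2 \<le> rk' xs")
        case True
        then obtain w z z' where "N xs w \<noteq> 0" "N y1 z \<noteq> 0" "N w z \<noteq> 0" "N w z' \<noteq> 0" "N y2 z' \<noteq> 0"
          using B.strongly_connected[OF _ both'(3,4)] by blast
        then show ?thesis using both'
          by (intro exI[of _ "x # w"] exI[of _ "x # z"] exI[of _ "x # z'"]) (simp add: zs E)
      next
        case False
        then have "rk x \<noteq> 0" using r by (simp add: zs rank)
        then obtain u where u: "M x u \<noteq> 0" using A.facet_exists both'(5) by blast
        then show ?thesis using both' N(1,2)[OF both'(3)] N(2)[OF both'(4)] M(2)[OF u]
          by (intro exI[of _ "u # xs"] exI[of _ "u # y1"] exI[of _ "u # y2"]) (simp add: zs E)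
      qed
    next
      case (m1 y1 ys)
      then show ?thesis using M(2)[OF m1(2)] N(2)[OF m1(5)]
        by (intro exI[of _ "x # ys"] exI[of _ "y1 # ys"]) (simp add: zs E)
    next
      case (m2 y1 ys)
      then show ?thesis using M(2)[OF m2(2)] N(2)[OF m2(5)]
        by (intro exI[of _ "x # ys"] exI[of _ "y1 # ys"]) (simp add: zs E)
    qed
  qed
qed

section \<open>Signs of enumerations\<close>

lemma enumeration_permutation_exists:
  assumes "distinct us" "distinct vs" "set us = set vs"
  shows "\<exists>p. p permutes set us \<and> map p us = vs"
proof -
  have len: "length us = length vs" using assms distinct_card by metis
  define idx where "idx = the_inv_into {..<length us} (\<lambda>i. us ! i)"
  have inj: "inj_on (\<lambda>i. us ! i) {..<length us}" using assms(1) by (auto simp: inj_on_def nth_eq_iff_index_eq)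
  have idx: "idx (us ! i) = i" if "i < length us" for i
    unfolding idx_def using the_inv_into_f_f[OF inj] that by simp
  define p where "p x = (if x \<in> set us then vs ! idx x else x)" for x
  have pm: "map p us = vs" by (rule nth_equalityI) (use len idx in \<open>auto simp: p_def\<close>)
  have "p ` set us = set us" using pm assms(3) by (metis list.set_map)
  moreover have "inj_on p (set us)" using pm assms by (metis distinct_map)
  ultimately have "bij_betw p (set us) (set us)" by (simp add: bij_betw_def)
  then have "p permutes set us" by (rule bij_imp_permutes) (simp add: p_def)
  with pm show ?thesis by blast
qed

lemma enum_sign_eq:
  assumes "p permutes set us" "map p us = vs"
  shows "enum_sign us vs = sign p"
proof -
  have "q = p" if "q permutes set us" "map q us = vs" for q
  proof
    fix x show "q x = p x"
    proof (cases "x \<in> set us")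
      case True
      then show ?thesis using that(2) assms(2) by (metis map_eq_conv)
    next
      case False
      then show ?thesis using that(1) assms(1) by (simp add: permutes_not_in)
    qed
  qed
  then have "(THE p. p permutes set us \<and> map p us = vs) = p" using assms by blast
  then show ?thesis by (simp add: enum_sign_def)
qed

lemma enum_sign_trans:
  assumes "distinct us" "distinct vs" "distinct ws" "set us = set vs" "set vs = set ws"
  shows "enum_sign us vs * enum_sign vs ws = enum_sign us ws"
proof -
  obtain p q where p: "p permutes set us" "map p us = vs" and q: "q permutes set us" "map q vs = ws"
    using enumeration_permutation_exists assms by metis
  have "map (q \<circ> p) us = ws" using p q by (simp add: list.map_comp[symmetric])
  then have "enum_sign us ws = sign (q \<circ> p)"
    using p q by (intro enum_sign_eq permutes_compose)
  also have "\<dots> = sign q * sign p"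
    using p q by (intro sign_compose) (auto intro: permutes_imp_permutation)
  also have "\<dots> = enum_sign us vs * enum_sign vs ws"
    using enum_sign_eq[OF p] enum_sign_eq[of q vs ws] q assms by simp
  finally show ?thesis by simp
qed

lemma enum_sign_Cons:
  assumes "distinct us" "distinct vs" "set us = set vs" and that: "v \<notin> set us"
  shows "enum_sign (v # us) (v # vs) = enum_sign us vs"
proof -
  obtain p where p: "p permutes set us" "map p us = vs"
    using enumeration_permutation_exists assms by blast
  have "p permutes set (v # us)" using p(1) by (rule permutes_subset) auto
  then show ?thesis
    using enum_sign_eq[OF p] enum_sign_eq[of p "v # us" "v # vs"] p that by (simp add: permutes_not_in)
qed

lemma enum_sign_swap:
  assumes "distinct (a # b # us)"
  shows "enum_sign (a # b # us) (b # a # us) = - 1"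
proof -
  have "transpose a b permutes set (a # b # us)" by (rule permutes_swap_id) auto
  moreover have "map (transpose a b) us = us"
    using assms by (intro map_idI) (auto simp: transpose_def)
  then have "map (transpose a b) (a # b # us) = b # a # us" by simp
  ultimately have "enum_sign (a # b # us) (b # a # us) = sign (transpose a b)"
    by (rule enum_sign_eq)
  then show ?thesis using assms by (simp add: sign_swap_id)
qed

lemma enum_sign_refl: "enum_sign us us = 1"
  using enum_sign_eq[of id us us] permutes_id by (simp add: sign_id)

lemma enum_sign_square:
  assumes "distinct us" "distinct vs" "set us = set vs"
  shows "enum_sign us vs * enum_sign us vs = 1"
proof -
  obtain p where "p permutes set us" "map p us = vs"
    using enumeration_permutation_exists assms by blast
  then have "enum_sign us vs = sign p" by (rule enum_sign_eq)
  then show ?thesis by (simp add: sign_def)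
qed

text \<open>
  Moving the vertex at position \<open>i\<close> to the front takes \<open>i\<close> transpositions. This turns the sign of a
  face in the boundary into a sign of enumerations, see \<open>inc_facet\<close> below.
\<close>

lemma enum_sign_move_to_front:
  assumes "distinct us" "i < length us"
  shows "enum_sign us (us ! i # remove1 (us ! i) us) = (-1) ^ i"
  using assms
proof (induction us arbitrary: i)
  case (Cons a us)
  show ?case
  proof (cases i)
    case 0
    then show ?thesis by (simp add: enum_sign_refl)
  next
    case (Suc j)
    define v where "v = us ! j"
    define ts where "ts = remove1 v us"
    have v: "v \<in> set us" "v \<noteq> a" using Cons.prems Suc by (auto simp: v_def)
    have ts: "distinct ts" "set ts = set us - {v}" "a \<notin> set ts" "v \<notin> set ts"
      using Cons.prems by (auto simp: ts_def)
    have "enum_sign (a # us) (v # a # ts)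
      = enum_sign (a # us) (a # v # ts) * enum_sign (a # v # ts) (v # a # ts)"
      using Cons.prems v ts by (intro enum_sign_trans[symmetric]) auto
    also have "enum_sign (a # us) (a # v # ts) = enum_sign us (v # ts)"
      using Cons.prems v ts by (intro enum_sign_Cons) auto
    also have "\<dots> = (-1) ^ j"
      unfolding v_def ts_def using Cons.prems Suc by (intro Cons.IH) auto
    also have "enum_sign (a # v # ts) (v # a # ts) = - 1"
      using v ts by (intro enum_sign_swap) auto
    finally show ?thesis using v Suc by (simp add: v_def ts_def)
  qed
qed simp

section \<open>Simplicial complexes and their products as cell posets\<close>

text \<open>
  The coefficient of \<open>f (x - {v})\<close> in \<open>f (\<delta> x)\<close> is the sign relating the enumeration of \<open>x\<close> to the list
  consisting of \<open>v\<close> and the enumeration of \<open>x - {v}\<close>.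
\<close>

definition simplex_incidence ::
  "('a set set \<Rightarrow> 'a set \<Rightarrow> 'a list) \<Rightarrow> 'a set set \<Rightarrow> 'a set \<Rightarrow> 'a set \<Rightarrow> real" where
  "simplex_incidence ori K x y =
     (if x \<in> K \<and> y \<in> K \<and> (\<exists>v\<in>x. y = x - {v})
      then of_int (enum_sign (ori K x) (the_elem (x - y) # ori K y)) else 0)"

locale orientation =
  fixes ori :: "'a set set \<Rightarrow> 'a set \<Rightarrow> 'a list"
  assumes orientation: "is_orientation ori"

locale oriented_simplicial_complex = orientation ori
  for ori :: "'a set set \<Rightarrow> 'a set \<Rightarrow> 'a list" +
  fixes K :: "'a set set"
  assumes complex: "simplicial_complex K"
begin

abbreviation "enum \<equiv> ori K"
abbreviation "inc \<equiv> simplex_incidence ori K"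

lemma finite_complex: "finite K"
  and finite_simplex: "x \<in> K \<Longrightarrow> finite x"
  and simplex_nonempty: "x \<in> K \<Longrightarrow> x \<noteq> {}"
  and subsimplex: "x \<in> K \<Longrightarrow> y \<subseteq> x \<Longrightarrow> y \<noteq> {} \<Longrightarrow> y \<in> K"
  using complex unfolding simplicial_complex_def by blast+

lemma enumeration: "x \<in> K \<Longrightarrow> distinct (enum x)" "x \<in> K \<Longrightarrow> set (enum x) = x"
  using orientation complex unfolding is_orientation_def by blast+

lemma inc_nonzero_iff: "inc x y \<noteq> 0 \<longleftrightarrow> x \<in> K \<and> y \<in> K \<and> (\<exists>v\<in>x. y = x - {v})"
  and inc_square: "inc x y \<noteq> 0 \<Longrightarrow> inc x y * inc x y = 1"
proof -
  have sq: "enum_sign (enum x) (the_elem (x - y) # enum y) * enum_sign (enum x) (the_elem (x - y) # enum y) = 1"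
    if xy: "x \<in> K" "y \<in> K" "\<exists>v\<in>x. y = x - {v}"
  proof (rule enum_sign_square)
    obtain v where v: "v \<in> x" "y = x - {v}" using xy(3) by blast
    then have "x - y = {v}" by auto
    then have "the_elem (x - y) = v" by simp
    then show "distinct (enum x)" "distinct (the_elem (x - y) # enum y)"
      "set (enum x) = set (the_elem (x - y) # enum y)"
      using xy v enumeration by auto
  qed
  then have "inc x y * inc x y = 1" if "x \<in> K \<and> y \<in> K \<and> (\<exists>v\<in>x. y = x - {v})"
    unfolding simplex_incidence_def if_P[OF that] using that
    by (simp only: of_int_mult[symmetric] of_int_1)
  moreover have "inc x y = 0" if "\<not> (x \<in> K \<and> y \<in> K \<and> (\<exists>v\<in>x. y = x - {v}))"
    unfolding simplex_incidence_def if_not_P[OF that] ..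
  ultimately show "inc x y \<noteq> 0 \<longleftrightarrow> x \<in> K \<and> y \<in> K \<and> (\<exists>v\<in>x. y = x - {v})"
    and "inc x y \<noteq> 0 \<Longrightarrow> inc x y * inc x y = 1"
    by (metis mult_zero_left zero_neq_one)+
qed

lemma inc_facet:
  assumes "x \<in> K" "v \<in> x" "x - {v} \<in> K"
  shows "inc x (x - {v}) = of_int (enum_sign (enum x) (v # enum (x - {v})))"
proof -
  have "x - (x - {v}) = {v}" using assms by auto
  then show ?thesis using assms by (auto simp: simplex_incidence_def)
qed

text \<open>
  Removing two vertices in the opposite order exchanges the first two entries of the second list, and
  so changes the sign.
\<close>

lemma inc_chain:
  assumes "x \<in> K" "v \<in> x" "w \<in> x" "v \<noteq> w" "x - {v, w} \<in> K"
  shows "inc x (x - {v}) * inc (x - {v}) (x - {v, w})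
    = of_int (enum_sign (enum x) (v # w # enum (x - {v, w})))"
proof -
  have y: "x - {v} \<in> K" using assms by (intro subsimplex[OF assms(1)]) auto
  have xvw: "x - {v, w} = x - {v} - {w}" by auto
  have 1: "inc x (x - {v}) = of_int (enum_sign (enum x) (v # enum (x - {v})))"
    by (rule inc_facet[OF assms(1,2) y])
  have "inc (x - {v}) (x - {v, w}) = of_int (enum_sign (enum (x - {v})) (w # enum (x - {v, w})))"
    unfolding xvw by (rule inc_facet[OF y]) (use assms(3,4,5) in \<open>simp_all only: xvw, auto\<close>)
  moreover have "enum_sign (enum (x - {v})) (w # enum (x - {v, w}))
    = enum_sign (v # enum (x - {v})) (v # w # enum (x - {v, w}))"
    using assms y enumeration by (intro enum_sign_Cons[symmetric]) auto
  ultimately have 2: "inc (x - {v}) (x - {v, w})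
    = of_int (enum_sign (v # enum (x - {v})) (v # w # enum (x - {v, w})))" by (simp only:)
  have "enum_sign (enum x) (v # enum (x - {v})) * enum_sign (v # enum (x - {v})) (v # w # enum (x - {v, w}))
    = enum_sign (enum x) (v # w # enum (x - {v, w}))"
    using assms y enumeration by (intro enum_sign_trans) auto
  then show ?thesis unfolding 1 2 of_int_mult[symmetric] by (simp only:)
qed

lemma oriented_cells_simplicial_complex:
  "oriented_cells K (\<subseteq>) (\<lambda>x. card x - 1) inc"
proof
  show "finite K" by (rule finite_complex)
next
  fix x y assume nz: "inc x y \<noteq> 0"
  obtain v where v: "x \<in> K" "y \<in> K" "v \<in> x" "y = x - {v}" and sq: "inc x y * inc x y = 1"
    using nz inc_nonzero_iff[of x y] inc_square[of x y] by blast
  have "card y \<noteq> 0" using finite_simplex[OF v(2)] simplex_nonempty[OF v(2)] by simp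
  moreover have yx: "y \<subseteq> x" using v(4) by blast
  moreover have "card x = Suc (card y)"
    by (simp only: v(4) card_Suc_Diff1[OF finite_simplex[OF v(1)] v(3)])
  ultimately show "x \<in> K \<and> y \<in> K \<and> y \<subseteq> x \<and> card x - 1 = Suc (card y - 1) \<and> inc x y * inc x y = 1"
    using v(1,2) sq yx by simp
next
  fix x y assume x: "x \<in> K" "y \<in> K" "y \<subseteq> x" "y \<noteq> x"
  then obtain v where "v \<in> x" "v \<notin> y" by blast
  moreover from this have "x - {v} \<in> K" using x simplex_nonempty[OF x(2)] by (intro subsimplex[OF x(1)]) auto
  ultimately show "\<exists>w. inc x w \<noteq> 0 \<and> y \<subseteq> w"
    using x by (intro exI[of _ "x - {v}"]) (auto simp: inc_nonzero_iff)
next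
  fix x assume x: "x \<in> K" "card x - 1 \<noteq> 0"
  obtain v where v: "v \<in> x" using simplex_nonempty[OF x(1)] by blast
  have "x \<noteq> {v}" using x(2) by auto
  then have "x - {v} \<noteq> {}" using v by blast
  then have "x - {v} \<in> K" using x by (intro subsimplex[OF x(1)]) auto
  then show "\<exists>y. inc x y \<noteq> 0" using x v by (intro exI[of _ "x - {v}"]) (auto simp: inc_nonzero_iff)
next
  fix x y y' assume x2: "card x - 1 = 1" and n: "inc x y \<noteq> 0" "inc x y' \<noteq> 0" "y \<noteq> y'"
  then obtain v w where v: "x \<in> K" "v \<in> x" "y = x - {v}" "y \<in> K" and w: "w \<in> x" "y' = x - {w}" "y' \<in> K"
    by (auto simp: inc_nonzero_iff)
  have "v \<noteq> w" using n v w by auto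
  have "card x = 2" using x2 by simp
  then have x: "x = {v, w}" using v w \<open>v \<noteq> w\<close> finite_simplex[OF v(1)]
    by (intro card_seteq[symmetric]) auto
  have single: "enum {u} = [u]" if "{u} \<in> K" for u
  proof -
    have "length (enum {u}) = 1" using enumeration[OF that] distinct_card[of "enum {u}"] by simp
    then obtain u' where "enum {u} = [u']" by (auto simp: length_Suc_conv)
    then show ?thesis using enumeration(2)[OF that] by simp
  qed
  have y: "x - {v} = {w}" "x - {w} = {v}" using x \<open>v \<noteq> w\<close> by auto
  have "enum_sign (enum x) [v, w] * enum_sign [v, w] [w, v] = enum_sign (enum x) [w, v]"
    using enumeration[OF v(1)] x \<open>v \<noteq> w\<close> by (intro enum_sign_trans) auto
  then have "enum_sign (enum x) [w, v] = - enum_sign (enum x) [v, w]"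
    using enum_sign_swap[of v w "[]"] \<open>v \<noteq> w\<close> by simp
  then show "inc x y' = - inc x y"
    using inc_facet[OF v(1,2)] inc_facet[OF v(1) w(1)] v w single by (simp add: y)
next
  fix x y z y'
  assume n: "inc x y \<noteq> 0" "inc y z \<noteq> 0" "inc x y' \<noteq> 0" "inc y' z \<noteq> 0" "y \<noteq> y'"
  obtain v w where v: "x \<in> K" "v \<in> x" "y = x - {v}" and w: "w \<in> x" "y' = x - {w}" and z: "z \<in> K"
    using n by (auto simp: inc_nonzero_iff)
  obtain a b where a: "a \<in> y" "z = y - {a}" and b: "b \<in> y'" "z = y' - {b}"
    using n by (auto simp: inc_nonzero_iff)
  have vw: "v \<noteq> w" using n v w by auto
  have z1: "z = x - {v, w}" using a b v w vw by auto
  then have z2: "z = x - {w, v}" by auto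
  have "enum_sign (enum x) (v # w # enum z) * enum_sign (v # w # enum z) (w # v # enum z)
      = enum_sign (enum x) (w # v # enum z)"
    using enumeration[OF v(1)] enumeration[OF z] z1 vw v w by (intro enum_sign_trans) auto
  then have "enum_sign (enum x) (w # v # enum z) = - enum_sign (enum x) (v # w # enum z)"
    using enum_sign_swap[of v w "enum z"] enumeration[OF z] vw z1 by simp
  then show "inc x y' * inc y' z = - (inc x y * inc y z)"
    using inc_chain[OF v(1,2) w(1) vw] inc_chain[OF v(1) w(1) v(2) vw[symmetric]] z
    by (simp add: v(3) w(2) flip: z1 z2)
next
  fix x y z assume n: "inc x y \<noteq> 0" "inc y z \<noteq> 0"
  obtain v w where v: "x \<in> K" "v \<in> x" "y = x - {v}" and w: "w \<in> y" "z = y - {w}" "z \<in> K"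
    using n by (auto simp: inc_nonzero_iff)
  have "x - {w} \<in> K" using v w simplex_nonempty[OF w(3)] by (intro subsimplex[OF v(1)]) auto
  then show "\<exists>y'. y' \<noteq> y \<and> inc x y' \<noteq> 0 \<and> inc y' z \<noteq> 0"
    using v w by (intro exI[of _ "x - {w}"]) (auto simp: inc_nonzero_iff)
next
  fix x y y' assume c: "2 \<le> card x - 1" and n: "inc x y \<noteq> 0" "inc x y' \<noteq> 0"
  obtain v w where v: "x \<in> K" "v \<in> x" "y = x - {v}" "y \<in> K" and w: "w \<in> x" "y' = x - {w}" "y' \<in> K"
    using n by (auto simp: inc_nonzero_iff)
  (* Removing v and u gives a common facet of both y and y'. *)
  obtain u where u: "u \<in> x" "u \<noteq> v" "v = w \<or> u = w"
  proof (cases "v = w")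
    case True
    have "x - {v} \<noteq> {}" using v(4) simplex_nonempty[OF v(4)] by (simp add: v(3))
    then show ?thesis using that True by blast
  next
    case False
    then show ?thesis using that w(1) by blast
  qed
  have "card (x - {v, u}) \<noteq> 0"
    using c v u finite_simplex[OF v(1)] by (simp add: card_Diff_subset)
  then have "x - {v, u} \<noteq> {}" by (metis card.empty)
  then have "x - {v, u} \<in> K"
    by (intro subsimplex[OF v(1)]) auto
  moreover have "x - {v, u} = y - {u}" "x - {v, u} = y' - {v} \<or> x - {v, u} = y' - {u}"
    using v w u by auto
  moreover have "u \<in> y" "v \<noteq> w \<Longrightarrow> v \<in> y'" "v = w \<Longrightarrow> u \<in> y'" using u v w by auto
  ultimately have "inc y (x - {v, u}) \<noteq> 0" "inc y' (x - {v, u}) \<noteq> 0"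
    using v w u unfolding inc_nonzero_iff by auto
  then show "\<exists>w z z'. inc x w \<noteq> 0 \<and> inc y z \<noteq> 0 \<and> inc w z \<noteq> 0 \<and> inc w z' \<noteq> 0 \<and> inc y' z' \<noteq> 0"
    using n by blast
qed auto

text \<open>
  The power of \<open>-1\<close> in the boundary moves \<open>v\<close> to the front, and the other sign compares the
  remaining vertices with the enumeration of the face.
\<close>

lemma eval_boundary_eq:
  assumes x: "x \<in> K"
  shows "eval_boundary ori K f x = (\<Sum>y\<in>K. inc x y * f y)"
proof -
  let ?I = "{i. i < length (enum x) \<and> x - {enum x ! i} \<in> K}"
  let ?face = "\<lambda>i. x - {enum x ! i}"
  note ox = enumeration[OF x]
  have mem: "enum x ! i \<in> x" if "i \<in> ?I" for i using that ox(2) nth_mem by force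
  have inj: "inj_on ?face ?I"
  proof (rule inj_onI)
    fix i j assume "i \<in> ?I" "j \<in> ?I" "?face i = ?face j"
    then have "enum x ! i = enum x ! j" using mem by blast
    then show "i = j" using \<open>i \<in> ?I\<close> \<open>j \<in> ?I\<close> ox(1) by (simp add: nth_eq_iff_index_eq)
  qed
  have sgn: "(-1) ^ i * of_int (enum_sign (remove1 (enum x ! i) (enum x)) (enum (?face i))) = inc x (?face i)"
    if i: "i \<in> ?I" for i
  proof -
    let ?v = "enum x ! i"
    have fK: "?face i \<in> K" using i by simp
    note oy = enumeration[OF fK]
    have "enum_sign (remove1 ?v (enum x)) (enum (?face i)) = enum_sign (?v # remove1 ?v (enum x)) (?v # enum (?face i))"
      using ox oy by (intro enum_sign_Cons[symmetric]) auto
    moreover have "(-1) ^ i = enum_sign (enum x) (?v # remove1 ?v (enum x))"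
      using i ox by (intro enum_sign_move_to_front[symmetric]) auto
    moreover have "enum_sign (enum x) (?v # remove1 ?v (enum x))
        * enum_sign (?v # remove1 ?v (enum x)) (?v # enum (?face i)) = enum_sign (enum x) (?v # enum (?face i))"
      using ox oy mem[OF i] by (intro enum_sign_trans) auto
    ultimately have "(-1) ^ i * enum_sign (remove1 ?v (enum x)) (enum (?face i))
        = enum_sign (enum x) (?v # enum (?face i))" by simp
    then have "of_int ((-1) ^ i * enum_sign (remove1 ?v (enum x)) (enum (?face i)))
        = (of_int (enum_sign (enum x) (?v # enum (?face i))) :: real)" by (simp only:)
    then show ?thesis using inc_facet[OF x mem[OF i] fK] by simp
  qed
  have "eval_boundary ori K f x = (\<Sum>i\<in>?I. inc x (?face i) * f (?face i))"
    unfolding eval_boundary_def Let_def by (intro sum.cong refl) (simp only: sgn)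
  also have "\<dots> = (\<Sum>y\<in>?face ` ?I. inc x y * f y)"
    using inj by (simp add: sum.reindex)
  also have "\<dots> = (\<Sum>y\<in>K. inc x y * f y)"
  proof (rule sum.mono_neutral_left)
    show "\<forall>y\<in>K - ?face ` ?I. inc x y * f y = 0"
    proof
      fix y assume y: "y \<in> K - ?face ` ?I"
      have "inc x y = 0"
      proof (rule ccontr)
        assume "inc x y \<noteq> 0"
        then obtain v where "v \<in> x" "y = x - {v}" by (auto simp: inc_nonzero_iff)
        then obtain i where "i < length (enum x)" "y = ?face i" using ox(2) by (metis in_set_conv_nth)
        then show False using y by blast
      qed
      then show "inc x y * f y = 0" by simp
    qed
  qed (use finite_complex in auto)
  finally show ?thesis .
qed

end

lemma cell_dim_simps [simp]:
  "cell_dim [] = 0" "cell_dim (x # xs) = (card x - 1) + cell_dim xs"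
  by (simp_all add: cell_dim_def)

fun incidence ::
  "('a set set \<Rightarrow> 'a set \<Rightarrow> 'a list) \<Rightarrow> 'a set set list \<Rightarrow> 'a set list \<Rightarrow> 'a set list \<Rightarrow> real" where
  "incidence ori [] = (\<lambda>_ _. 0)"
| "incidence ori (K # Gs) =
     cons_incidence K (listset Gs) (\<lambda>x. card x - 1) (simplex_incidence ori K) (incidence ori Gs)"

context orientation
begin

lemma oriented_cells_product:
  assumes "\<forall>K\<in>set Gs. simplicial_complex K"
  shows "oriented_cells (listset Gs) (list_all2 (\<subseteq>)) cell_dim (incidence ori Gs)"
  using assms
proof (induction Gs)
  case Nil
  show ?case by unfold_locales auto
next
  case (Cons K Gs)
  interpret oriented_simplicial_complex ori K
    using Cons.prems by unfold_locales auto
  have "oriented_cells (listset Gs) (list_all2 (\<subseteq>)) cell_dim (incidence ori Gs)"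
    using Cons by simp
  then show ?case
    unfolding listset.simps incidence.simps
    by (intro oriented_cells_cons[OF oriented_cells_simplicial_complex]) simp_all
qed

lemma ext_deriv_eq:
  assumes "\<forall>K\<in>set Gs. simplicial_complex K" "xs \<in> listset Gs"
  shows "ext_deriv ori Gs f xs = (\<Sum>ys\<in>listset Gs. incidence ori Gs xs ys * f ys)"
  using assms
proof (induction Gs arbitrary: xs f)
  case Nil
  then show ?case by simp
next
  case (Cons K Gs)
  interpret oriented_simplicial_complex ori K
    using Cons.prems by unfold_locales auto
  interpret T: oriented_cells "listset Gs" "list_all2 (\<subseteq>)" cell_dim "incidence ori Gs"
    using oriented_cells_product Cons.prems by simp
  obtain z zs where xs: "xs = z # zs" "z \<in> K" "zs \<in> listset Gs"
    using Cons.prems(2) by (auto simp: set_Cons_def)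
  have "(\<Sum>ys\<in>listset (K # Gs). incidence ori (K # Gs) xs ys * f ys)
    = (\<Sum>y\<in>K. \<Sum>ys\<in>listset Gs. of_bool (ys = zs) * (inc z y * f (y # zs)))
    + (\<Sum>y\<in>K. \<Sum>ys\<in>listset Gs. of_bool (y = z) * ((-1) ^ (card z - 1) * (incidence ori Gs zs ys * f (z # ys))))"
    unfolding listset.simps incidence.simps sum_set_Cons sum.distrib[symmetric] xs
    by (intro sum.cong refl) (use xs in \<open>auto simp: cons_simps algebra_simps\<close>)
  also have "(\<Sum>y\<in>K. \<Sum>ys\<in>listset Gs. of_bool (ys = zs) * (inc z y * f (y # zs)))
    = (\<Sum>y\<in>K. inc z y * f (y # zs))"
    using xs T.fin by (simp add: of_bool_def if_distrib[of "\<lambda>c. c * _"] cong: if_cong)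
  also have "\<dots> = eval_boundary ori K (\<lambda>y. f (y # zs)) z"
    using eval_boundary_eq[OF xs(2)] by simp
  also have "(\<Sum>y\<in>K. \<Sum>ys\<in>listset Gs. of_bool (y = z) * ((-1) ^ (card z - 1) * (incidence ori Gs zs ys * f (z # ys))))
    = (-1) ^ (card z - 1) * (\<Sum>ys\<in>listset Gs. incidence ori Gs zs ys * f (z # ys))"
    using xs finite_complex by (subst sum.swap)
      (simp add: of_bool_def sum_distrib_left if_distrib[of "\<lambda>c. c * _"] cong: if_cong)
  also have "(\<Sum>ys\<in>listset Gs. incidence ori Gs zs ys * f (z # ys)) = ext_deriv ori Gs (\<lambda>ys. f (z # ys)) zs"
    using Cons xs by simp
  finally show ?case by (simp add: xs)
qed

text \<open>
  The coboundary has the incidence matrix constructed above, so the Hodge theorem applies to it.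
\<close>

lemma betti_eq_trace:
  assumes Gs: "\<forall>K\<in>set Gs. simplicial_complex K"
    and P: "harmonic_kernel (listset Gs) (incidence ori Gs) P"
  shows "real (betti ori k Gs) = poly.coeff (trace_poly (listset Gs) cell_dim P) k"
proof -
  interpret oriented_cells "listset Gs" "list_all2 (\<subseteq>)" cell_dim "incidence ori Gs"
    by (rule oriented_cells_product[OF Gs])
  have cob: "coboundary ori Gs f = d f" for f
    using ext_deriv_eq[OF Gs] d_outside(1) by (auto simp: coboundary_def d_def fun_eq_iff)
  have "cocycles ori k Gs = Z k" by (simp add: cocycles_def Z_def cob level_def)
  moreover have "coboundaries ori k Gs = B k"
    by (simp add: coboundaries_def B_def cob[abs_def] below_def)
  ultimately show ?thesis
    using quotient_dim_eq_trace[OF P, of k] fin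
    by (simp add: betti_def coeff_trace_poly level_def)
qed

end

section \<open>Betti polynomials of product complexes\<close>

text \<open>
  All assumptions on cell posets speak of a cell and faces below it, and these lie in one and the same
  part.
\<close>

lemma oriented_cells_disjoint_union:
  assumes finI: "finite I" and cells: "\<And>i. i \<in> I \<Longrightarrow> oriented_cells (C i) face rk (M i)"
    and disj: "\<And>i j. i \<in> I \<Longrightarrow> j \<in> I \<Longrightarrow> i \<noteq> j \<Longrightarrow> C i \<inter> C j = {}"
    and sep: "\<And>i j x y. i \<in> I \<Longrightarrow> j \<in> I \<Longrightarrow> x \<in> C i \<Longrightarrow> y \<in> C j \<Longrightarrow> face y x \<Longrightarrow> i = j"
  shows "oriented_cells (\<Union>i\<in>I. C i) face rk (\<lambda>x y. \<Sum>i\<in>I. M i x y)"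
proof -
  define N where "N x y = (\<Sum>i\<in>I. M i x y)" for x y
  have Minc: "x \<in> C i \<and> y \<in> C i \<and> face y x \<and> rk x = Suc (rk y) \<and> M i x y * M i x y = 1"
    if "i \<in> I" "M i x y \<noteq> 0" for i x y
    using oriented_cells.inc[OF cells[OF that(1)] that(2)] .
  have N: "N x y = M i x y" if "i \<in> I" "x \<in> C i" for i x y
  proof -
    have "M j x y = (if j = i then M i x y else 0)" if "j \<in> I" for j
      using Minc[OF that, of x y] disj[OF that \<open>i \<in> I\<close>] \<open>x \<in> C i\<close> by auto
    then have "N x y = (\<Sum>j\<in>I. if j = i then M i x y else 0)"
      unfolding N_def by (rule sum.cong[OF refl])
    then show ?thesis using finI that by simp
  qed
  have Nc: "\<exists>i\<in>I. x \<in> C i \<and> y \<in> C i" if nz: "N x y \<noteq> 0" for x y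
  proof -
    obtain i where "i \<in> I" "M i x y \<noteq> 0"
      using nz unfolding N_def by (meson sum.neutral)
    then show ?thesis using Minc by blast
  qed
  show ?thesis
    unfolding N_def[symmetric]
  proof
    show "finite (\<Union>i\<in>I. C i)" using finI oriented_cells.fin[OF cells] by blast
  next
    fix x assume "x \<in> (\<Union>i\<in>I. C i)"
    then show "face x x" using oriented_cells.face_refl[OF cells] by blast
  next
    fix x y assume nz: "N x y \<noteq> 0"
    then obtain i where i: "i \<in> I" "x \<in> C i" "y \<in> C i" using Nc by blast
    then show "x \<in> (\<Union>i\<in>I. C i) \<and> y \<in> (\<Union>i\<in>I. C i) \<and> face y x \<and> rk x = Suc (rk y) \<and> N x y * N x y = 1"
      using Minc[OF i(1), of x y] nz N[OF i(1,2)] by auto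
  next
    fix x y assume xy: "x \<in> (\<Union>i\<in>I. C i)" "y \<in> (\<Union>i\<in>I. C i)" "face y x" "y \<noteq> x"
    then obtain i where i: "i \<in> I" "x \<in> C i" "y \<in> C i" using sep by (metis UN_E)
    then show "\<exists>w. N x w \<noteq> 0 \<and> face y w"
      using oriented_cells.facet_above[OF cells[OF i(1)] i(2,3) xy(3,4)] N[OF i(1,2)] by simp
  next
    fix x assume x: "x \<in> (\<Union>i\<in>I. C i)" "rk x \<noteq> 0"
    then obtain i where i: "i \<in> I" "x \<in> C i" by blast
    then show "\<exists>y. N x y \<noteq> 0"
      using oriented_cells.facet_exists[OF cells[OF i(1)] i(2) x(2)] N[OF i(1,2)] by simp
  next
    fix x y y' assume r: "rk x = 1" and n: "N x y \<noteq> 0" "N x y' \<noteq> 0" "y \<noteq> y'"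
    obtain i where i: "i \<in> I" "x \<in> C i" using Nc[OF n(1)] by blast
    show "N x y' = - N x y"
      using oriented_cells.edge[OF cells[OF i(1)] r] n unfolding N[OF i] by blast
  next
    fix x y z y' assume n: "N x y \<noteq> 0" "N y z \<noteq> 0" "N x y' \<noteq> 0" "N y' z \<noteq> 0" "y \<noteq> y'"
    obtain i where i: "i \<in> I" "x \<in> C i" using Nc[OF n(1)] by blast
    have y: "y \<in> C i" "y' \<in> C i" using Minc[OF i(1)] n(1,3) unfolding N[OF i] by blast+
    show "N x y' * N y' z = - (N x y * N y z)"
      using oriented_cells.diamond[OF cells[OF i(1)]] n
      unfolding N[OF i] N[OF i(1) y(1)] N[OF i(1) y(2)] by blast
  next
    fix x y z assume n: "N x y \<noteq> 0" "N y z \<noteq> 0"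
    obtain i where i: "i \<in> I" "x \<in> C i" using Nc[OF n(1)] by blast
    have y: "u \<in> C i" if "M i x u \<noteq> 0" for u using Minc[OF i(1) that] by blast
    have "M i x y \<noteq> 0" "M i y z \<noteq> 0" using n N[OF i] N[OF i(1) y] by auto
    then obtain u where u: "u \<noteq> y" "M i x u \<noteq> 0" "M i u z \<noteq> 0"
      using oriented_cells.thin[OF cells[OF i(1)]] by blast
    then show "\<exists>y'. y' \<noteq> y \<and> N x y' \<noteq> 0 \<and> N y' z \<noteq> 0"
      using N[OF i] N[OF i(1) y] by auto
  next
    fix x y y' assume r: "2 \<le> rk x" and n: "N x y \<noteq> 0" "N x y' \<noteq> 0"
    obtain i where i: "i \<in> I" "x \<in> C i" using Nc[OF n(1)] by blast
    have y: "N u v = M i u v" if "M i x u \<noteq> 0" for u v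
      using Minc[OF i(1) that] by (intro N i(1)) blast
    have n': "M i x y \<noteq> 0" "M i x y' \<noteq> 0" using n N[OF i] by auto
    obtain w z z' where w: "M i x w \<noteq> 0" "M i y z \<noteq> 0" "M i w z \<noteq> 0" "M i w z' \<noteq> 0" "M i y' z' \<noteq> 0"
      using oriented_cells.strongly_connected[OF cells[OF i(1)] r n'] by blast
    have "N x w \<noteq> 0" "N y z \<noteq> 0" "N w z \<noteq> 0" "N w z' \<noteq> 0" "N y' z' \<noteq> 0"
      using w by (simp_all add: N[OF i] y[OF n'(1)] y[OF n'(2)] y[OF w(1)])
    then show "\<exists>w z z'. N x w \<noteq> 0 \<and> N y z \<noteq> 0 \<and> N w z \<noteq> 0 \<and> N w z' \<noteq> 0 \<and> N y' z' \<noteq> 0"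
      by blast
  qed
qed

text \<open>
  The choice of the kernel does not affect the value, as the coefficients are the Betti numbers.
\<close>

definition betti_poly ::
  "('a set set \<Rightarrow> 'a set \<Rightarrow> 'a list) \<Rightarrow> 'a set set list \<Rightarrow> real poly" where
  "betti_poly ori Gs = trace_poly (listset Gs) cell_dim (SOME P. harmonic_kernel (listset Gs) (incidence ori Gs) P)"

context orientation
begin

lemma coeff_betti_poly:
  assumes "\<forall>K\<in>set Gs. simplicial_complex K"
  shows "poly.coeff (betti_poly ori Gs) k = real (betti ori k Gs)"
proof -
  have "\<exists>P. harmonic_kernel (listset Gs) (incidence ori Gs) P"
    by (rule harmonic_kernel_exists[OF oriented_cells.fin[OF oriented_cells_product[OF assms]]])
  then have "harmonic_kernel (listset Gs) (incidence ori Gs)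
      (SOME P. harmonic_kernel (listset Gs) (incidence ori Gs) P)" by (rule someI_ex)
  from betti_eq_trace[OF assms this] show ?thesis by (simp add: betti_poly_def)
qed

lemma betti_poly_eq_trace:
  assumes "\<forall>K\<in>set Gs. simplicial_complex K"
    and "harmonic_kernel (listset Gs) (incidence ori Gs) P"
  shows "betti_poly ori Gs = trace_poly (listset Gs) cell_dim P"
  by (rule poly_eqI) (simp add: coeff_betti_poly[OF assms(1)] betti_eq_trace[OF assms])

lemma obtain_kernel:
  assumes "\<forall>K\<in>set Gs. simplicial_complex K"
  obtains P where "harmonic_kernel (listset Gs) (incidence ori Gs) P"
  using harmonic_kernel_exists[OF oriented_cells.fin[OF oriented_cells_product[OF assms]]] by blast

lemma betti_poly_Nil: "betti_poly ori [] = 1"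
proof -
  have "harmonic_kernel (listset []) (incidence ori []) (\<lambda>x y. of_bool (x = []))"
    by (auto simp: harmonic_kernel_def harmonic_def functions_on_def dirac_def)
  from betti_poly_eq_trace[OF _ this] show ?thesis by (simp add: trace_poly_def)
qed

text \<open>
  The factor \<open>p\<close>, the same for all \<open>Gs\<close>, is the trace polynomial of \<open>K\<close> with its simplices as cells.
\<close>

lemma betti_poly_Cons:
  assumes K: "simplicial_complex K"
  obtains p where "\<And>Gs. \<forall>G\<in>set Gs. simplicial_complex G \<Longrightarrow> betti_poly ori (K # Gs) = p * betti_poly ori Gs"
proof -
  interpret oriented_simplicial_complex ori K
    using orientation K by unfold_locales
  interpret A: oriented_cells K "(\<subseteq>)" "\<lambda>x. card x - 1" inc
    by (rule oriented_cells_simplicial_complex)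
  obtain P where P: "harmonic_kernel K inc P" using harmonic_kernel_exists[OF A.fin] by blast
  have "betti_poly ori (K # Gs) = trace_poly K (\<lambda>x. card x - 1) P * betti_poly ori Gs"
    if Gs: "\<forall>G\<in>set Gs. simplicial_complex G" for Gs
  proof -
    obtain Q where Q: "harmonic_kernel (listset Gs) (incidence ori Gs) Q" using obtain_kernel[OF Gs] .
    have rank: "card x - 1 = Suc (card y - 1)" if "inc x y \<noteq> 0" for x y
      using A.inc[OF that] by blast
    have "harmonic_kernel (listset (K # Gs)) (incidence ori (K # Gs)) (cons_kernel P Q)"
      unfolding listset.simps incidence.simps
      using A.fin oriented_cells.fin[OF oriented_cells_product[OF Gs]] rank P Q by (rule harmonic_kernel_cons)
    then have "betti_poly ori (K # Gs) = trace_poly (listset (K # Gs)) cell_dim (cons_kernel P Q)"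
      using Gs K by (intro betti_poly_eq_trace) auto
    also have "\<dots> = trace_poly K (\<lambda>x. card x - 1) P * trace_poly (listset Gs) cell_dim Q"
      unfolding listset.simps by (rule trace_poly_cons) simp
    finally show ?thesis using betti_poly_eq_trace[OF Gs Q] by simp
  qed
  then show ?thesis by (rule that)
qed

theorem betti_poly_append:
  assumes "\<forall>K\<in>set Gs. simplicial_complex K" "\<forall>K\<in>set Hs. simplicial_complex K"
  shows "betti_poly ori (Gs @ Hs) = betti_poly ori Gs * betti_poly ori Hs"
  using assms(1)
proof (induction Gs)
  case Nil
  then show ?case by (simp add: betti_poly_Nil)
next
  case (Cons K Gs)
  obtain p where "\<And>Gs. \<forall>G\<in>set Gs. simplicial_complex G \<Longrightarrow> betti_poly ori (K # Gs) = p * betti_poly ori Gs"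
    using betti_poly_Cons[of K] Cons.prems by auto
  then show ?case using Cons assms(2) by (simp add: ball_Un mult.assoc)
qed

end

lemma in_listset_iff: "xs \<in> listset Gs \<longleftrightarrow> list_all2 (\<in>) xs Gs"
  by (induction Gs arbitrary: xs) (auto simp: set_Cons_def list_all2_Cons2)

lemma listset_nonempty_iff: "listset xs \<noteq> {} \<longleftrightarrow> {} \<notin> set xs"
  by (induction xs) (auto simp: set_Cons_def)

lemma set_Cons_subset_iff:
  assumes "x \<noteq> {}" "A \<noteq> {}"
  shows "set_Cons x A \<subseteq> set_Cons y B \<longleftrightarrow> x \<subseteq> y \<and> A \<subseteq> B"
proof
  assume sub: "set_Cons x A \<subseteq> set_Cons y B"
  have "u \<in> y \<and> v \<in> B" if "u \<in> x" "v \<in> A" for u v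
  proof -
    have "u # v \<in> set_Cons y B" using sub that by (intro subsetD[OF sub]) simp
    then show ?thesis by simp
  qed
  then show "x \<subseteq> y \<and> A \<subseteq> B" using assms by blast
qed (auto simp: set_Cons_def)

text \<open>
  Cells as sets and tuples of simplices carry the same order. An empty simplex would make the
  product empty and so included in everything.
\<close>

lemma listset_subset_iff:
  assumes "{} \<notin> set xs"
  shows "listset xs \<subseteq> listset ys \<longleftrightarrow> list_all2 (\<subseteq>) xs ys"
  using assms
proof (induction xs arbitrary: ys)
  case Nil
  then show ?case by (cases ys) (auto simp: set_Cons_def)
next
  case (Cons x xs)
  have ne: "x \<noteq> {}" "listset xs \<noteq> {}" using Cons.prems listset_nonempty_iff by auto
  then obtain u v where "u \<in> x" "v \<in> listset xs" by blast
  then have uv: "u # v \<in> listset (x # xs)" by simp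
  have nil: "\<not> listset (x # xs) \<subseteq> listset []"
  proof
    assume "listset (x # xs) \<subseteq> listset []"
    with uv have "u # v \<in> listset []" by blast
    then show False by simp
  qed
  show ?case
    by (cases ys) (use nil Cons.IH Cons.prems set_Cons_subset_iff[OF ne] in auto)
qed

lemma list_all2_subset_antisym:
  "list_all2 (\<subseteq>) xs ys \<Longrightarrow> list_all2 (\<subseteq>) ys xs \<Longrightarrow> xs = ys"
  by (rule list_all2_antisym[of "(\<subseteq>)" "(\<subseteq>)"]) auto

lemma listset_inject:
  assumes "{} \<notin> set xs" "{} \<notin> set ys" "listset xs = listset ys"
  shows "xs = ys"
  using assms listset_subset_iff[OF assms(1), of ys] listset_subset_iff[OF assms(2), of xs]
  by (intro list_all2_subset_antisym) auto

lemma nonempty_simplices: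
  assumes "\<forall>K\<in>set Gs. simplicial_complex K" "xs \<in> listset Gs"
  shows "{} \<notin> set xs"
proof
  assume "{} \<in> set xs"
  then obtain i where "i < length xs" "xs ! i = {}" by (auto simp: in_set_conv_nth)
  then have "{} \<in> Gs ! i" "Gs ! i \<in> set Gs"
    using assms(2) by (auto simp: in_listset_iff list_all2_conv_all_nth)
  then show False using assms(1) by (auto simp: simplicial_complex_def)
qed

lemma bij_betw_listset_cells:
  assumes "product_complex Gs"
  shows "bij_betw listset (listset Gs) (cells Gs)"
  unfolding bij_betw_def cells_def
  using assms nonempty_simplices by (auto simp: inj_on_def product_complex_def intro: listset_inject)

context orientation
begin

text \<open>
  The isomorphism of cells is moved to tuples of simplices, on which the incidence matrices live.
\<close>

theorem betti_poly_isomorphic: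
  assumes Gs: "product_complex Gs" and Hs: "product_complex Hs" and iso: "isomorphic_complexes Gs Hs"
  shows "betti_poly ori Gs = betti_poly ori Hs"
proof -
  note sGs = Gs[unfolded product_complex_def, THEN conjunct2]
  note sHs = Hs[unfolded product_complex_def, THEN conjunct2]
  obtain f where f: "bij_betw f (cells Gs) (cells Hs)"
    and m: "\<forall>x\<in>cells Gs. \<forall>y\<in>cells Gs. x \<subseteq> y \<longleftrightarrow> f x \<subseteq> f y"
    using iso unfolding isomorphic_complexes_def by (elim exE conjE)
  have mono: "x \<subseteq> y \<longleftrightarrow> f x \<subseteq> f y" if "x \<in> cells Gs" "y \<in> cells Gs" for x y
    by (rule bspec[OF bspec[OF m that(1)] that(2)])
  define g where "g = the_inv_into (listset Hs) listset"
  have g: "bij_betw g (cells Hs) (listset Hs)"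
    unfolding g_def by (rule bij_betw_the_inv_into[OF bij_betw_listset_cells[OF Hs]])
  have gi: "listset (g c) = c" if "c \<in> cells Hs" for c
    unfolding g_def using f_the_inv_into_f_bij_betw[OF bij_betw_listset_cells[OF Hs]] that by blast
  define \<phi> where "\<phi> = g \<circ> (f \<circ> listset)"
  have bij: "bij_betw \<phi> (listset Gs) (listset Hs)"
    unfolding \<phi>_def by (intro bij_betw_trans[OF _ g] bij_betw_trans[OF bij_betw_listset_cells[OF Gs] f])
  have L: "listset (\<phi> x) = f (listset x)" if "x \<in> listset Gs" for x
  proof -
    have "f (listset x) \<in> cells Hs" using that f by (auto simp: bij_betw_def cells_def)
    then show ?thesis by (simp add: \<phi>_def gi)
  qed
  have face: "list_all2 (\<subseteq>) x y \<longleftrightarrow> list_all2 (\<subseteq>) (\<phi> x) (\<phi> y)"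
    if xy: "x \<in> listset Gs" "y \<in> listset Gs" for x y
  proof -
    have "\<phi> x \<in> listset Hs" using bij xy by (auto simp: bij_betw_def)
    then have "list_all2 (\<subseteq>) (\<phi> x) (\<phi> y) \<longleftrightarrow> f (listset x) \<subseteq> f (listset y)"
      using listset_subset_iff[OF nonempty_simplices[OF sHs], of "\<phi> x" "\<phi> y"] L xy by simp
    also have "\<dots> \<longleftrightarrow> listset x \<subseteq> listset y"
      using mono[of "listset x" "listset y"] xy by (simp add: cells_def)
    also have "\<dots> \<longleftrightarrow> list_all2 (\<subseteq>) x y"
      by (rule listset_subset_iff[OF nonempty_simplices[OF sGs xy(1)]])
    finally show ?thesis by simp
  qed
  obtain Q where Q: "harmonic_kernel (listset Hs) (incidence ori Hs) Q" using obtain_kernel[OF sHs] .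
  obtain P where "harmonic_kernel (listset Gs) (incidence ori Gs) P"
    "trace_poly (listset Gs) cell_dim P = trace_poly (listset Hs) cell_dim Q"
    using trace_poly_isomorphism[OF oriented_cells_product[OF sGs] oriented_cells_product[OF sHs] bij face Q] by blast
  then show ?thesis using betti_poly_eq_trace[OF sGs] betti_poly_eq_trace[OF sHs Q] by simp
qed

end

section \<open>Connected components of products\<close>

abbreviation linked :: "'a set set list \<Rightarrow> ('a list set \<times> 'a list set) set" where
  "linked Gs \<equiv> (comparable_cells Gs)\<^sup>*"

lemma equiv_linked: "equiv UNIV (linked Gs)"
proof (rule equivI)
  have "sym (comparable_cells Gs)" by (auto simp: sym_def comparable_cells_def)
  then show "sym (linked Gs)" by (rule sym_rtrancl)
qed (auto simp: refl_rtrancl trans_rtrancl)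

lemma linked_in_cells: "(c, e) \<in> linked Gs \<Longrightarrow> c \<in> cells Gs \<Longrightarrow> e \<in> cells Gs"
  by (induction rule: rtrancl_induct) (auto simp: comparable_cells_def)

lemma connected_componentsI:
  "product_complex Cs \<Longrightarrow> c \<in> cells Gs \<Longrightarrow> cells Cs = linked Gs `` {c} \<Longrightarrow> Cs \<in> connected_components Gs"
  by (auto simp: connected_components_def quotient_def)

lemma connected_componentsE:
  assumes "Cs \<in> connected_components Gs"
  obtains c where "product_complex Cs" "c \<in> cells Gs" "cells Cs = linked Gs `` {c}"
  using assms by (auto simp: connected_components_def quotient_def)

lemma cells_inject:
  assumes "product_complex Cs" "product_complex Ds" "cells Cs = cells Ds" "cells Cs \<noteq> {}"
  shows "Cs = Ds"
proof -
  have sub: "listset Cs \<subseteq> listset Ds"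
    if C: "product_complex Cs" and D: "product_complex Ds" and eq: "cells Cs = cells Ds"
    for Cs Ds :: "'a set set list"
  proof
    fix xs assume xs: "xs \<in> listset Cs"
    then have "listset xs \<in> listset ` listset Ds" using eq by (auto simp: cells_def)
    then obtain ys where ys: "ys \<in> listset Ds" "listset xs = listset ys" by blast
    have "xs = ys"
      using listset_inject[OF nonempty_simplices nonempty_simplices ys(2)] xs ys C D
      by (auto simp: product_complex_def)
    then show "xs \<in> listset Ds" using ys by simp
  qed
  have eq: "listset Cs = listset Ds"
    using sub[OF assms(1-3)] sub[OF assms(2,1) assms(3)[symmetric]] by blast
  moreover have "{} \<notin> set Cs" "{} \<notin> set Ds"
    using assms(3,4) eq listset_nonempty_iff by (auto simp: cells_def)
  ultimately show ?thesis by (intro listset_inject) auto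
qed

lemma component_cells:
  assumes "Cs \<in> connected_components Gs"
  shows "product_complex Cs" "cells Cs \<subseteq> cells Gs" "cells Cs \<noteq> {}"
    "e \<in> cells Cs \<Longrightarrow> cells Cs = linked Gs `` {e}"
proof -
  obtain c where c: "product_complex Cs" "c \<in> cells Gs" "cells Cs = linked Gs `` {c}"
    using assms by (rule connected_componentsE)
  show "product_complex Cs" by fact
  show "cells Cs \<subseteq> cells Gs" using c linked_in_cells by auto
  show "cells Cs \<noteq> {}" using c by auto
  show "cells Cs = linked Gs `` {e}" if "e \<in> cells Cs"
    using equiv_class_eq[OF equiv_linked, of c e Gs] that c by auto
qed

lemma component_unique:
  assumes "Cs \<in> connected_components Gs" "Ds \<in> connected_components Gs"
    "e \<in> cells Cs" "e \<in> cells Ds"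
  shows "Cs = Ds"
proof (rule cells_inject)
  show "cells Cs = cells Ds"
    using component_cells(4)[OF assms(1,3)] component_cells(4)[OF assms(2,4)] by (simp only:)
qed (rule component_cells[OF assms(1)] component_cells[OF assms(2)])+

lemma finite_listset: "\<forall>K\<in>set Gs. finite K \<Longrightarrow> finite (listset Gs)"
  by (induction Gs) (auto simp: set_Cons_eq)

lemma finite_cells: "product_complex Gs \<Longrightarrow> finite (cells Gs)"
  unfolding cells_def product_complex_def simplicial_complex_def
  by (intro finite_imageI finite_listset) blast

lemma finite_components:
  assumes "product_complex Gs"
  shows "finite (connected_components Gs)"
proof (rule inj_on_finite)
  show "inj_on cells (connected_components Gs)"
    by (intro inj_onI cells_inject) (auto dest: component_cells(1,3))
  show "cells ` connected_components Gs \<subseteq> Pow (cells Gs)"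
    by (intro image_subsetI PowI component_cells(2))
  show "finite (Pow (cells Gs))" using finite_cells[OF assms] by simp
qed

definition cell_append :: "'a list set \<Rightarrow> 'a list set \<Rightarrow> 'a list set" where
  "cell_append a b = {u @ v | u v. u \<in> a \<and> v \<in> b}"

lemma listset_append: "listset (xs @ ys) = cell_append (listset xs) (listset ys)"
proof (induction xs)
  case Nil
  then show ?case by (auto simp: cell_append_def)
next
  case (Cons x xs)
  have "cell_append (set_Cons x A) B = set_Cons x (cell_append A B)" for A B
  proof (rule subset_antisym; rule subsetI)
    fix z assume "z \<in> cell_append (set_Cons x A) B"
    then obtain a w v where "a \<in> x" "w \<in> A" "v \<in> B" "z = (a # w) @ v"
      unfolding cell_append_def set_Cons_def by blast
    moreover from this have "w @ v \<in> cell_append A B" unfolding cell_append_def by blast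
    ultimately show "z \<in> set_Cons x (cell_append A B)" by simp
  next
    fix z assume "z \<in> set_Cons x (cell_append A B)"
    then obtain a w v where z: "a \<in> x" "w \<in> A" "v \<in> B" "z = a # (w @ v)"
      unfolding cell_append_def set_Cons_def by blast
    then show "z \<in> cell_append (set_Cons x A) B"
      unfolding cell_append_def by (intro CollectI exI[of _ "a # w"] exI[of _ v]) simp
  qed
  with Cons show ?case by simp
qed

lemma cells_append:
  "cells (Gs @ Hs) = {cell_append a b | a b. a \<in> cells Gs \<and> b \<in> cells Hs}"
proof -
  have L: "listset (Gs @ Hs) = {xs @ ys | xs ys. xs \<in> listset Gs \<and> ys \<in> listset Hs}"
    by (simp only: listset_append cell_append_def)
  show ?thesis
  proof (rule subset_antisym; rule subsetI)
    fix c assume "c \<in> cells (Gs @ Hs)"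
    then obtain zs where "zs \<in> listset (Gs @ Hs)" "c = listset zs" by (auto simp only: cells_def)
    then obtain xs ys where "xs \<in> listset Gs" "ys \<in> listset Hs" "c = listset (xs @ ys)"
      unfolding L by blast
    then have "c = cell_append (listset xs) (listset ys)" "listset xs \<in> cells Gs" "listset ys \<in> cells Hs"
      by (simp_all only: listset_append cells_def imageI)
    then show "c \<in> {cell_append a b | a b. a \<in> cells Gs \<and> b \<in> cells Hs}" by blast
  next
    fix c assume "c \<in> {cell_append a b | a b. a \<in> cells Gs \<and> b \<in> cells Hs}"
    then obtain a b where ab: "a \<in> cells Gs" "b \<in> cells Hs" "c = cell_append a b" by blast
    obtain xs where xs: "xs \<in> listset Gs" "a = listset xs" using ab(1) by (auto simp only: cells_def)
    obtain ys where ys: "ys \<in> listset Hs" "b = listset ys" using ab(2) by (auto simp only: cells_def)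
    have "c = listset (xs @ ys)" by (simp only: ab(3) xs(2) ys(2) listset_append)
    moreover have "xs @ ys \<in> listset (Gs @ Hs)" unfolding L using xs(1) ys(1) by blast
    ultimately show "c \<in> cells (Gs @ Hs)" by (simp only: cells_def imageI)
  qed
qed

lemma cell_length: "c \<in> cells Gs \<Longrightarrow> u \<in> c \<Longrightarrow> length u = length Gs"
  by (auto simp: cells_def in_listset_iff dest!: list_all2_lengthD)

lemma cell_nonempty:
  assumes "product_complex Gs" "c \<in> cells Gs"
  shows "c \<noteq> {}"
  using assms nonempty_simplices[of Gs] listset_nonempty_iff
  by (auto simp: cells_def product_complex_def)

text \<open>
  All lists in the first factor have the same length, so a concatenation can be split again; each
  inclusion follows since the cell in the other factor is not empty.
\<close>

lemma cell_append_subset_iff: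
  assumes "product_complex Gs" "product_complex Hs"
    and "a \<in> cells Gs" "a' \<in> cells Gs" "b \<in> cells Hs" "b' \<in> cells Hs"
  shows "cell_append a b \<subseteq> cell_append a' b' \<longleftrightarrow> a \<subseteq> a' \<and> b \<subseteq> b'"
proof
  assume sub: "cell_append a b \<subseteq> cell_append a' b'"
  have "u \<in> a' \<and> v \<in> b'" if uv: "u \<in> a" "v \<in> b" for u v
  proof -
    have "u @ v \<in> cell_append a b" using uv by (auto simp: cell_append_def)
    then have "u @ v \<in> cell_append a' b'" by (rule subsetD[OF sub])
    then obtain u' v' where "u' \<in> a'" "v' \<in> b'" "u @ v = u' @ v'" by (auto simp: cell_append_def)
    moreover have "length u = length u'" using cell_length assms uv calculation by metis
    ultimately show ?thesis by simp
  qed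
  then show "a \<subseteq> a' \<and> b \<subseteq> b'"
    using cell_nonempty[OF assms(1,3)] cell_nonempty[OF assms(2,5)] by blast
qed (auto simp: cell_append_def)

lemma product_complex_append:
  "product_complex Gs \<Longrightarrow> product_complex Hs \<Longrightarrow> product_complex (Gs @ Hs)"
  by (auto simp: product_complex_def)

text \<open>
  A chain in the product projects to chains in both factors. Conversely, chains in the factors are
  followed one after the other, with the other coordinate kept fixed.
\<close>

lemma linked_append:
  assumes G: "product_complex Gs" and H: "product_complex Hs" and a: "a \<in> cells Gs" and b: "b \<in> cells Hs"
  shows "linked (Gs @ Hs) `` {cell_append a b}
    = {cell_append a' b' | a' b'. a' \<in> linked Gs `` {a} \<and> b' \<in> linked Hs `` {b}}"
proof -
  have comparable: "(cell_append x y, cell_append x' y') \<in> comparable_cells (Gs @ Hs) \<longleftrightarrow>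
      x \<subseteq> x' \<and> y \<subseteq> y' \<or> x' \<subseteq> x \<and> y' \<subseteq> y"
    if "x \<in> cells Gs" "x' \<in> cells Gs" "y \<in> cells Hs" "y' \<in> cells Hs" for x x' y y'
    using that cell_append_subset_iff[OF G H]
    by (auto simp: comparable_cells_def cells_append)
  have forward: "\<exists>a' b'. q = cell_append a' b' \<and> (a, a') \<in> linked Gs \<and> (b, b') \<in> linked Hs"
    if "(cell_append a b, q) \<in> linked (Gs @ Hs)" for q
    using that
  proof (induction rule: rtrancl_induct)
    case base
    then show ?case by blast
  next
    case (step q r)
    then obtain a' b' where q: "q = cell_append a' b'" and l: "(a, a') \<in> linked Gs" "(b, b') \<in> linked Hs"
      by blast
    have c: "a' \<in> cells Gs" "b' \<in> cells Hs" using linked_in_cells l a b by blast+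
    obtain a'' b'' where r: "r = cell_append a'' b''" "a'' \<in> cells Gs" "b'' \<in> cells Hs"
      using step.hyps(2) by (auto simp: comparable_cells_def cells_append)
    have "a' \<subseteq> a'' \<and> b' \<subseteq> b'' \<or> a'' \<subseteq> a' \<and> b'' \<subseteq> b'"
      using step.hyps(2) comparable[OF c(1) r(2) c(2) r(3)] by (simp add: q r(1))
    then have "(a', a'') \<in> comparable_cells Gs" "(b', b'') \<in> comparable_cells Hs"
      using c r by (auto simp: comparable_cells_def)
    then have "(a, a'') \<in> linked Gs" "(b, b'') \<in> linked Hs"
      using l by (auto intro: rtrancl.rtrancl_into_rtrancl)
    then show ?case using r(1) by blast
  qed
  have first: "(cell_append a b, cell_append a' b) \<in> linked (Gs @ Hs)" if "(a, a') \<in> linked Gs" for a'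
    using that
  proof (induction rule: rtrancl_induct)
    case (step x x')
    have "x \<in> cells Gs" "x' \<in> cells Gs" "x \<subseteq> x' \<or> x' \<subseteq> x"
      using step.hyps(2) by (auto simp: comparable_cells_def)
    then have "(cell_append x b, cell_append x' b) \<in> comparable_cells (Gs @ Hs)"
      using comparable b by blast
    then show ?case using step.IH by (meson rtrancl.rtrancl_into_rtrancl)
  qed simp
  have second: "(cell_append a' b, cell_append a' b') \<in> linked (Gs @ Hs)"
    if "(b, b') \<in> linked Hs" and a': "a' \<in> cells Gs" for a' b'
    using that(1)
  proof (induction rule: rtrancl_induct)
    case (step x x')
    have "x \<in> cells Hs" "x' \<in> cells Hs" "x \<subseteq> x' \<or> x' \<subseteq> x"
      using step.hyps(2) by (auto simp: comparable_cells_def)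
    then have "(cell_append a' x, cell_append a' x') \<in> comparable_cells (Gs @ Hs)"
      using comparable a' by blast
    then show ?case using step.IH by (meson rtrancl.rtrancl_into_rtrancl)
  qed simp
  have backward: "(cell_append a b, cell_append a' b') \<in> linked (Gs @ Hs)"
    if "(a, a') \<in> linked Gs" "(b, b') \<in> linked Hs" for a' b'
    using first[OF that(1)] second[OF that(2) linked_in_cells[OF that(1) a]] by (rule rtrancl_trans)
  show ?thesis
  proof (rule subset_antisym; rule subsetI)
    fix q assume "q \<in> linked (Gs @ Hs) `` {cell_append a b}"
    then have "(cell_append a b, q) \<in> linked (Gs @ Hs)" by simp
    from forward[OF this]
    show "q \<in> {cell_append a' b' | a' b'. a' \<in> linked Gs `` {a} \<and> b' \<in> linked Hs `` {b}}" by simp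
  next
    fix q assume "q \<in> {cell_append a' b' | a' b'. a' \<in> linked Gs `` {a} \<and> b' \<in> linked Hs `` {b}}"
    then obtain a' b' where "q = cell_append a' b'" "(a, a') \<in> linked Gs" "(b, b') \<in> linked Hs"
      by auto
    then show "q \<in> linked (Gs @ Hs) `` {cell_append a b}" using backward by simp
  qed
qed

lemma linked_append_component:
  assumes G: "product_complex Gs" and H: "product_complex Hs" and a: "a \<in> cells Gs" and b: "b \<in> cells Hs"
    and "cells Cs = linked Gs `` {a}" "cells Ds = linked Hs `` {b}"
  shows "cells (Cs @ Ds) = linked (Gs @ Hs) `` {cell_append a b}"
  unfolding linked_append[OF G H a b] cells_append assms(5,6) ..

text \<open>
  For one simplicial complex, the simplices linked to a given one form a subcomplex. For more factors
  the components of the factors are multiplied.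
\<close>

lemma component_exists:
  assumes "product_complex Gs" "c \<in> cells Gs"
  shows "\<exists>Cs\<in>connected_components Gs. c \<in> cells Cs"
proof -
  have single: "\<exists>Cs. product_complex Cs \<and> cells Cs = linked [K] `` {c}"
    if K: "simplicial_complex K" and c: "c \<in> cells [K]" for K :: "'a set set" and c
  proof -
    have "listset [L] = (\<lambda>x. [x]) ` L" for L :: "'a set set"
      by (auto simp: set_Cons_def)
    then have cK: "cells [L] = (\<lambda>x. listset [x]) ` L" for L :: "'a set set"
      by (simp only: cells_def image_image)
    define L where "L = {y \<in> K. listset [y] \<in> linked [K] `` {c}}"
    have "z \<in> L" if z: "y \<in> L" "z \<subseteq> y" "z \<noteq> {}" for y z
    proof -
      have y: "y \<in> K" "(c, listset [y]) \<in> linked [K]" using z by (auto simp: L_def)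
      have zK: "z \<in> K" using K y z unfolding simplicial_complex_def by blast
      have "listset [z] \<subseteq> listset [y]" using z(2) by (auto simp: set_Cons_def)
      then have "(listset [y], listset [z]) \<in> comparable_cells [K]"
        using y zK by (auto simp: comparable_cells_def cK simp del: listset.simps)
      then have "(c, listset [z]) \<in> linked [K]" using y(2) by (rule rtrancl.rtrancl_into_rtrancl[rotated])
      then show ?thesis using zK by (simp add: L_def del: listset.simps)
    qed
    moreover have "finite L" "\<forall>x\<in>L. finite x \<and> x \<noteq> {}"
      using K unfolding simplicial_complex_def L_def by auto
    ultimately have "simplicial_complex L" unfolding simplicial_complex_def by blast
    then have "product_complex [L]" by (simp add: product_complex_def)
    moreover have "cells [L] = linked [K] `` {c}"
      using linked_in_cells[of c _ "[K]"] c by (auto simp: cK L_def simp del: listset.simps)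
    ultimately show ?thesis by blast
  qed
  have "\<exists>Cs. product_complex Cs \<and> cells Cs = linked Gs `` {c}"
    using assms
  proof (induction Gs arbitrary: c)
    case (Cons K Gs)
    have K: "simplicial_complex K" using Cons.prems by (simp add: product_complex_def)
    show ?case
    proof (cases "Gs = []")
      case True
      then show ?thesis using single[OF K] Cons.prems by simp
    next
      case False
      have Gs: "product_complex Gs" using Cons.prems False by (simp add: product_complex_def)
      have K': "product_complex [K]" using K by (simp add: product_complex_def)
      have "c \<in> cells ([K] @ Gs)" using Cons.prems by simp
      then obtain a b where c: "c = cell_append a b" "a \<in> cells [K]" "b \<in> cells Gs"
        unfolding cells_append by blast
      obtain Cs where Cs: "product_complex Cs" "cells Cs = linked [K] `` {a}" using single[OF K c(2)] by blast
      obtain Ds where Ds: "product_complex Ds" "cells Ds = linked Gs `` {b}"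
        using Cons.IH[OF Gs c(3)] by blast
      show ?thesis
        using linked_append_component[OF K' Gs c(2,3) Cs(2) Ds(2)] product_complex_append[OF Cs(1) Ds(1)]
        by (intro exI[of _ "Cs @ Ds"]) (simp add: c(1))
    qed
  qed (simp add: product_complex_def)
  then obtain Cs where "product_complex Cs" "cells Cs = linked Gs `` {c}" by blast
  then show ?thesis using assms(2) by (intro bexI[of _ Cs] connected_componentsI) auto
qed

text \<open>
  Products of components are components by \<open>linked_append\<close>. As every cell lies in such a product and
  components with a common cell coincide, there are no others.
\<close>

lemma components_append:
  assumes G: "product_complex Gs" and H: "product_complex Hs"
  shows "connected_components (Gs @ Hs)
    = (\<lambda>(Cs, Ds). Cs @ Ds) ` (connected_components Gs \<times> connected_components Hs)"
    and "inj_on (\<lambda>(Cs, Ds). Cs @ Ds) (connected_components Gs \<times> connected_components Hs)"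
proof -
  have app: "Cs @ Ds \<in> connected_components (Gs @ Hs)"
    if C: "Cs \<in> connected_components Gs" and D: "Ds \<in> connected_components Hs" for Cs Ds
  proof -
    obtain a where a: "product_complex Cs" "a \<in> cells Gs" "cells Cs = linked Gs `` {a}"
      using C by (rule connected_componentsE)
    obtain b where b: "product_complex Ds" "b \<in> cells Hs" "cells Ds = linked Hs `` {b}"
      using D by (rule connected_componentsE)
    show ?thesis
      using linked_append_component[OF G H a(2) b(2) a(3) b(3)] product_complex_append[OF a(1) b(1)] a b
      by (intro connected_componentsI[of _ "cell_append a b"]) (auto simp: cells_append)
  qed
  have "\<exists>Cs\<in>connected_components Gs. \<exists>Ds\<in>connected_components Hs. Es = Cs @ Ds"
    if E: "Es \<in> connected_components (Gs @ Hs)" for Es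
  proof -
    obtain c where c: "c \<in> cells Es" using component_cells(3)[OF E] by blast
    then have "c \<in> cells (Gs @ Hs)" using component_cells(2)[OF E] by blast
    then obtain a b where ab: "c = cell_append a b" "a \<in> cells Gs" "b \<in> cells Hs"
      unfolding cells_append by blast
    obtain Cs where C: "Cs \<in> connected_components Gs" "a \<in> cells Cs"
      using component_exists[OF G ab(2)] by blast
    obtain Ds where D: "Ds \<in> connected_components Hs" "b \<in> cells Ds"
      using component_exists[OF H ab(3)] by blast
    have "c \<in> cells (Cs @ Ds)" using C D ab by (auto simp: cells_append)
    then have "Es = Cs @ Ds" using component_unique[OF E app[OF C(1) D(1)] c] by blast
    then show ?thesis using C D by blast
  qed
  then show "connected_components (Gs @ Hs)
    = (\<lambda>(Cs, Ds). Cs @ Ds) ` (connected_components Gs \<times> connected_components Hs)"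
    using app by fastforce
  have len: "length Cs = length Gs" if C: "Cs \<in> connected_components Gs" for Cs
  proof -
    obtain c where "c \<in> cells Cs" using component_cells(3)[OF C] by blast
    moreover from this have "c \<in> cells Gs" using component_cells(2)[OF C] by blast
    moreover from this obtain u where "u \<in> c" using cell_nonempty[OF G] by blast
    ultimately show ?thesis using cell_length by metis
  qed
  show "inj_on (\<lambda>(Cs, Ds). Cs @ Ds) (connected_components Gs \<times> connected_components Hs)"
    using len by (auto simp: inj_on_def)
qed

lemma components_of_component:
  assumes C: "Cs \<in> connected_components Gs"
  shows "connected_components Cs = {Cs}"
proof -
  note cc = component_cells[OF C]
  have linked: "linked Cs `` {c} = cells Cs" if c: "c \<in> cells Cs" for c
  proof
    show "linked Cs `` {c} \<subseteq> cells Cs" using linked_in_cells c by blast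
    show "cells Cs \<subseteq> linked Cs `` {c}"
    proof
      fix e assume "e \<in> cells Cs"
      then have "(c, e) \<in> linked Gs" using cc(4)[OF c] by blast
      then have "(c, e) \<in> linked Cs"
      proof (induction rule: rtrancl_induct)
        case (step x y)
        then have "(c, y) \<in> linked Gs" by (meson rtrancl.rtrancl_into_rtrancl)
        then have "x \<in> cells Cs" "y \<in> cells Cs" using step.hyps(1) cc(4)[OF c] by blast+
        then have "(x, y) \<in> comparable_cells Cs"
          using step.hyps(2) by (auto simp: comparable_cells_def)
        then show ?case using step.IH by (meson rtrancl.rtrancl_into_rtrancl)
      qed simp
      then show "e \<in> linked Cs `` {c}" by simp
    qed
  qed
  obtain c where c: "c \<in> cells Cs" using cc(3) by blast
  have "Cs \<in> connected_components Cs" using linked[OF c] cc(1) c by (intro connected_componentsI) auto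
  moreover have "Ds = Cs" if D: "Ds \<in> connected_components Cs" for Ds
  proof -
    obtain e where "product_complex Ds" "e \<in> cells Cs" "cells Ds = linked Cs `` {e}"
      using D by (rule connected_componentsE)
    then show ?thesis using linked cc(1,3) by (intro cells_inject) auto
  qed
  ultimately show ?thesis by blast
qed

context orientation
begin

text \<open>
  The incidence matrix \<open>?M\<close> glued from the matrices of the components may differ from that of the
  whole complex, as components may be oriented differently. Both belong to the same poset, so they
  are equivalent, and the kernel of \<open>?M\<close> is block diagonal.
\<close>

theorem betti_poly_components:
  assumes G: "product_complex Gs"
  shows "betti_poly ori Gs = (\<Sum>Cs\<in>connected_components Gs. betti_poly ori Cs)"
proof -
  let ?I = "connected_components Gs"
  note sG = G[unfolded product_complex_def, THEN conjunct2]
  have sC: "\<forall>K\<in>set Cs. simplicial_complex K" if "Cs \<in> ?I" for Cs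
    using component_cells(1)[OF that] by (simp add: product_complex_def)
  have finI: "finite ?I" by (rule finite_components[OF G])
  have cellI: "listset x \<in> cells Cs \<longleftrightarrow> x \<in> listset Cs"
    if "Cs \<in> ?I" "{} \<notin> set x" for Cs x
  proof
    assume "listset x \<in> cells Cs"
    then obtain y where "y \<in> listset Cs" "listset x = listset y" by (auto simp: cells_def)
    then show "x \<in> listset Cs"
      using listset_inject[OF that(2) nonempty_simplices[OF sC[OF that(1)]]] by blast
  qed (simp add: cells_def)
  have ne: "{} \<notin> set x" if "x \<in> listset Cs" "Cs \<in> ?I" for x Cs
    using nonempty_simplices[OF sC[OF that(2)] that(1)] .
  have disj: "listset Cs \<inter> listset Ds = {}" if "Cs \<in> ?I" "Ds \<in> ?I" "Cs \<noteq> Ds" for Cs Ds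
    using component_unique[OF that(1,2)] that(3) by (auto simp: cells_def)
  have sep: "Cs = Ds"
    if I: "Cs \<in> ?I" "Ds \<in> ?I" and x: "x \<in> listset Cs" and y: "y \<in> listset Ds"
      and f: "list_all2 (\<subseteq>) y x" for Cs Ds x y
  proof -
    have c: "listset x \<in> cells Cs" "listset y \<in> cells Ds" using x y by (auto simp: cells_def)
    moreover have "listset y \<subseteq> listset x" using listset_subset_iff[OF ne[OF y I(2)]] f by blast
    ultimately have "(listset x, listset y) \<in> comparable_cells Gs"
      using component_cells(2)[OF I(1)] component_cells(2)[OF I(2)] by (auto simp: comparable_cells_def)
    then have "listset y \<in> cells Cs" using component_cells(4)[OF I(1) c(1)] by blast
    then show ?thesis using component_unique[OF I _ c(2)] by blast
  qed
  have union: "(\<Union>Cs\<in>?I. listset Cs) = listset Gs"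
  proof
    show "(\<Union>Cs\<in>?I. listset Cs) \<subseteq> listset Gs"
    proof
      fix x assume "x \<in> (\<Union>Cs\<in>?I. listset Cs)"
      then obtain Cs where C: "Cs \<in> ?I" "x \<in> listset Cs" by blast
      then have "listset x \<in> cells Gs" using component_cells(2)[OF C(1)] by (auto simp: cells_def)
      then obtain y where "y \<in> listset Gs" "listset x = listset y" by (auto simp: cells_def)
      then show "x \<in> listset Gs"
        using listset_inject[OF ne[OF C(2,1)] nonempty_simplices[OF sG]] by blast
    qed
    show "listset Gs \<subseteq> (\<Union>Cs\<in>?I. listset Cs)"
    proof
      fix x assume x: "x \<in> listset Gs"
      then have "listset x \<in> cells Gs" by (simp add: cells_def)
      then obtain Cs where C: "Cs \<in> ?I" "listset x \<in> cells Cs" using component_exists[OF G] by blast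
      then show "x \<in> (\<Union>Cs\<in>?I. listset Cs)" using cellI[OF C(1) nonempty_simplices[OF sG x]] by blast
    qed
  qed
  let ?M = "\<lambda>x y. \<Sum>Cs\<in>?I. incidence ori Cs x y"
  have "\<forall>Cs\<in>?I. \<exists>P. harmonic_kernel (listset Cs) (incidence ori Cs) P"
    using obtain_kernel[OF sC] by blast
  then have "\<exists>P. \<forall>Cs\<in>?I. harmonic_kernel (listset Cs) (incidence ori Cs) (P Cs)" by (rule bchoice)
  then obtain P where P: "\<And>Cs. Cs \<in> ?I \<Longrightarrow> harmonic_kernel (listset Cs) (incidence ori Cs) (P Cs)"
    by blast
  define Q where "Q x y = (\<Sum>Cs\<in>?I. of_bool (y \<in> listset Cs) * P Cs x y)" for x y
  have fin: "finite (listset Cs)" if "Cs \<in> ?I" for Cs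
    using oriented_cells.fin[OF oriented_cells_product[OF sC[OF that]]] .
  have supp: "x \<in> listset Cs \<and> y \<in> listset Cs" if "Cs \<in> ?I" "incidence ori Cs x y \<noteq> 0" for Cs x y
    using oriented_cells.inc[OF oriented_cells_product[OF sC[OF that(1)]] that(2)] by blast
  have Q: "harmonic_kernel (listset Gs) ?M Q"
    using harmonic_kernel_disjoint_union(1)[where C = listset and M = "incidence ori" and P = P,
        OF finI fin disj supp P]
    unfolding union Q_def by blast
  have trQ: "trace_poly (listset Gs) cell_dim Q = (\<Sum>Cs\<in>?I. trace_poly (listset Cs) cell_dim (P Cs))"
    using harmonic_kernel_disjoint_union(2)[where C = listset and M = "incidence ori" and P = P,
        OF finI fin disj supp P, of cell_dim]
    unfolding union Q_def by blast
  have "oriented_cells (\<Union>Cs\<in>?I. listset Cs) (list_all2 (\<subseteq>)) cell_dim ?M"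
    by (rule oriented_cells_disjoint_union[where C = listset and M = "incidence ori"])
      (fact finI oriented_cells_product[OF sC] disj sep)+
  then have cellsM: "oriented_cells (listset Gs) (list_all2 (\<subseteq>)) cell_dim ?M"
    unfolding union .
  obtain R where "harmonic_kernel (listset Gs) (incidence ori Gs) R"
    "trace_poly (listset Gs) cell_dim R = trace_poly (listset Gs) cell_dim Q"
    using trace_poly_isomorphism[OF oriented_cells_product[OF sG] cellsM, of "\<lambda>x. x", OF bij_betw_id[unfolded id_def] _ Q]
    by blast
  then have "betti_poly ori Gs = (\<Sum>Cs\<in>?I. trace_poly (listset Cs) cell_dim (P Cs))"
    using betti_poly_eq_trace[OF sG] trQ by simp
  also have "\<dots> = (\<Sum>Cs\<in>?I. betti_poly ori Cs)"
    using betti_poly_eq_trace[OF sC P] by simp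
  finally show ?thesis .
qed

end

section \<open>The strong ring\<close>

lemma signed_empty: "is_signed_complex {#}"
  and signed_single: "is_signed_complex {#(s, Gs)#} \<longleftrightarrow> s \<in> {1, -1} \<and> product_complex Gs"
  and signed_plus: "is_signed_complex (A + B) \<longleftrightarrow> is_signed_complex A \<and> is_signed_complex B"
  by (auto simp: is_signed_complex_def)

lemma signed_add_mset:
  "is_signed_complex (add_mset (s, Gs) A) \<longleftrightarrow> s \<in> {1, -1} \<and> product_complex Gs \<and> is_signed_complex A"
  by (auto simp: is_signed_complex_def)

lemma signed_minus_signed: "is_signed_complex A \<Longrightarrow> is_signed_complex (signed_minus A)"
  by (auto simp: is_signed_complex_def signed_minus_def)

lemma signed_times_empty [simp]: "signed_times {#} B = {#}" "signed_times A {#} = {#}"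
  by (auto simp: signed_times_def)

lemma signed_times_plus:
  "signed_times (A + A') B = signed_times A B + signed_times A' B"
  "signed_times A (B + B') = signed_times A B + signed_times A B'"
  by (simp_all add: signed_times_def case_prod_unfold sum_mset.distrib)

lemma signed_times_single: "signed_times {#(s, Gs)#} {#(t, Hs)#} = {#(s * t, Gs @ Hs)#}"
  by (simp add: signed_times_def)

lemma signed_times_add_mset:
  "signed_times (add_mset (s, Gs) A) B = image_mset (\<lambda>(t, Hs). (s * t, Gs @ Hs)) B + signed_times A B"
  by (simp add: signed_times_def)

lemma signed_complex_induct [consumes 1, case_names empty add]:
  assumes "is_signed_complex A" "P {#}"
    and "\<And>A s Gs. is_signed_complex A \<Longrightarrow> s \<in> {1, -1} \<Longrightarrow> product_complex Gs \<Longrightarrow> P A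
      \<Longrightarrow> P (A + {#(s, Gs)#})"
  shows "P A"
  using assms(1)
proof (induction A)
  case empty
  show ?case by fact
next
  case (add x A)
  obtain s Gs where x: "x = (s, Gs)" by (cases x)
  have "is_signed_complex A" "s \<in> {1, -1}" "product_complex Gs"
    using add.prems by (auto simp: is_signed_complex_def x)
  then have "P (A + {#(s, Gs)#})" using add.IH assms(3) by blast
  then show ?case by (simp add: x)
qed

lemma signed_times_signed:
  assumes "is_signed_complex A" "is_signed_complex B"
  shows "is_signed_complex (signed_times A B)"
  using assms(1)
proof (induction A rule: signed_complex_induct)
  case (add A s Gs)
  have "t \<in> {1, -1} \<and> product_complex Hs" if "(t, Hs) \<in># B" for t Hs
    using assms(2) that by (auto simp: is_signed_complex_def)
  then have "is_signed_complex (signed_times {#(s, Gs)#} B)"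
    using add.hyps product_complex_append[of Gs]
    by (fastforce simp: signed_times_add_mset is_signed_complex_def)
  then show ?case unfolding signed_times_plus signed_plus using add.IH by blast
qed (simp add: signed_empty)

lemma signed_times_assoc:
  "signed_times (signed_times A B) C = signed_times A (signed_times B C)"
proof -
  have "signed_times (image_mset (\<lambda>(t, Hs). (s * t, Gs @ Hs)) B) C
      = image_mset (\<lambda>(t, Hs). (s * t, Gs @ Hs)) (signed_times B C)" for s Gs
    by (induction B)
      (auto simp: signed_times_add_mset image_mset.compositionality o_def case_prod_unfold mult.assoc)
  then show ?thesis
    by (induction A) (auto simp: signed_times_add_mset signed_times_plus)
qed

lemma signed_times_minus: "signed_times (signed_minus A) B = signed_minus (signed_times A B)"
  by (induction A) (auto simp: signed_minus_def signed_times_add_mset image_mset.compositionality o_def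
      case_prod_unfold)

abbreviation strong_equiv :: "'a signed_complex \<Rightarrow> 'a signed_complex \<Rightarrow> bool" (infix "\<approx>" 50) where
  "A \<approx> B \<equiv> equivclp strong_step A B"

lemma strong_step_signed:
  assumes "strong_step A B"
  shows "is_signed_complex A \<and> is_signed_complex B"
  using assms
proof cases
  case (splitting C s Gs)
  have fin: "finite (connected_components Gs)" by (rule finite_components[OF splitting(5)])
  then show ?thesis
    using splitting component_cells(1)[of _ Gs] by (auto simp: is_signed_complex_def)
next
  case (isomorphism C s Gs Hs)
  then show ?thesis by (auto simp: signed_add_mset)
next
  case (cancellation B)
  then show ?thesis by (auto simp: signed_plus signed_minus_signed)
qed

lemma strong_step_plus:
  assumes "strong_step A A'" "is_signed_complex B"
  shows "strong_step (A + B) (A' + B)"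
  using assms(1)
proof cases
  case (isomorphism C s Gs Hs)
  then show ?thesis
    using strong_step.isomorphism[of "C + B" s Gs Hs] assms(2) by (simp add: signed_plus ac_simps)
next
  case (splitting C s Gs)
  then show ?thesis
    using strong_step.splitting[of "C + B" s Gs] assms(2) by (simp add: signed_plus ac_simps)
next
  case (cancellation C)
  then show ?thesis
    using strong_step.cancellation[of "A' + B" C] assms(2) by (simp add: signed_plus ac_simps)
qed

lemma strong_equiv_lift:
  fixes h :: "'a signed_complex \<Rightarrow> 'b signed_complex"
  assumes step: "\<And>A B. strong_step A B \<Longrightarrow> h A \<approx> h B" and "A \<approx> B"
  shows "h A \<approx> h B"
proof (rule equivclp_induct[OF assms(2)])
  fix C D :: "'a signed_complex" assume "strong_step C D \<or> strong_step D C"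
  then have "h C \<approx> h D"
    by (rule disjE) (rule step, assumption, rule equivclp_sym, rule step, assumption)
  moreover assume "h A \<approx> h C"
  ultimately show "h A \<approx> h D" by (rule equivclp_trans[rotated])
qed simp

lemma strong_equiv_signed:
  assumes "A \<approx> B" "is_signed_complex A"
  shows "is_signed_complex B"
  using assms by (induction rule: equivclp_induct) (auto dest: strong_step_signed)

lemma strong_equiv_plus:
  assumes "A \<approx> A'" "B \<approx> B'" "is_signed_complex A" "is_signed_complex B"
  shows "A + B \<approx> A' + B'"
proof -
  have left: "C + D \<approx> C' + D" if "C \<approx> C'" "is_signed_complex D" for C C' D :: "'a signed_complex"
    by (rule strong_equiv_lift[where h = "\<lambda>C. C + D", OF _ that(1)])
      (use strong_step_plus that(2) in blast)
  have "A + B \<approx> A' + B" by (rule left[OF assms(1,4)])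
  also have "B + A' \<approx> B' + A'"
    using left[OF assms(2)] strong_equiv_signed[OF assms(1,3)] by blast
  then have "A' + B \<approx> A' + B'" by (simp add: add.commute)
  finally show ?thesis .
qed

text \<open>
  Cells of products are given by pairs of cells of the factors. An isomorphism is most easily specified
  by two parametrisations \<open>p\<close> and \<open>q\<close> of the cells by the same set.
\<close>

lemma isomorphic_by_parametrisation:
  assumes p: "p ` S = cells Gs" and q: "q ` S = cells Hs"
    and mono: "\<And>i j. i \<in> S \<Longrightarrow> j \<in> S \<Longrightarrow> p i \<subseteq> p j \<longleftrightarrow> q i \<subseteq> q j"
  shows "isomorphic_complexes Gs Hs"
proof -
  have eq: "p i = p j \<longleftrightarrow> q i = q j" if "i \<in> S" "j \<in> S" for i j
    using mono[OF that] mono[OF that(2,1)] by (simp add: set_eq_subset)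
  define \<phi> where "\<phi> c = q (inv_into S p c)" for c
  have \<phi>: "\<phi> (p i) = q i" if "i \<in> S" for i
  proof -
    have "p (inv_into S p (p i)) = p i" using that by (intro f_inv_into_f imageI)
    moreover have "inv_into S p (p i) \<in> S" using that by (intro inv_into_into imageI)
    ultimately show ?thesis using eq that by (simp add: \<phi>_def)
  qed
  have "bij_betw \<phi> (cells Gs) (cells Hs)"
  proof (rule bij_betw_imageI)
    show "inj_on \<phi> (cells Gs)"
      unfolding p[symmetric] by (rule inj_onI, elim imageE) (simp only: \<phi> eq)
    show "\<phi> ` cells Gs = cells Hs" unfolding p[symmetric] q[symmetric] image_image by (simp add: \<phi>)
  qed
  moreover have "\<forall>x\<in>cells Gs. \<forall>y\<in>cells Gs. x \<subseteq> y \<longleftrightarrow> \<phi> x \<subseteq> \<phi> y"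
    unfolding p[symmetric] ball_simps(9) using mono by (simp add: \<phi>)
  ultimately show ?thesis unfolding isomorphic_complexes_def by (intro exI[of _ \<phi>] conjI)
qed

lemma cells_append_image:
  "(\<lambda>(a, b). cell_append a b) ` (cells Gs \<times> cells Hs) = cells (Gs @ Hs)"
  unfolding cells_append by auto

lemma isomorphic_append:
  assumes G: "product_complex Gs" and G': "product_complex Gs'" and H: "product_complex Hs"
    and iso: "isomorphic_complexes Gs Gs'"
  shows "isomorphic_complexes (Gs @ Hs) (Gs' @ Hs)"
proof -
  obtain f where f: "bij_betw f (cells Gs) (cells Gs')"
    and m: "\<forall>x\<in>cells Gs. \<forall>y\<in>cells Gs. x \<subseteq> y \<longleftrightarrow> f x \<subseteq> f y"
    using iso unfolding isomorphic_complexes_def by (elim exE conjE)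
  have img: "f ` cells Gs = cells Gs'" using f by (simp add: bij_betw_def)
  have fG: "f a \<in> cells Gs'" if "a \<in> cells Gs" for a unfolding img[symmetric] using that by (rule imageI)
  show ?thesis
  proof (rule isomorphic_by_parametrisation[OF cells_append_image])
    show "(\<lambda>(a, b). cell_append (f a) b) ` (cells Gs \<times> cells Hs) = cells (Gs' @ Hs)"
      unfolding cells_append img[symmetric] by auto
    fix i j assume "i \<in> cells Gs \<times> cells Hs" "j \<in> cells Gs \<times> cells Hs"
    then obtain a b c d where ij: "i = (a, b)" "j = (c, d)"
      and mem: "a \<in> cells Gs" "b \<in> cells Hs" "c \<in> cells Gs" "d \<in> cells Hs" by blast
    have "a \<subseteq> c \<longleftrightarrow> f a \<subseteq> f c" by (rule bspec[OF bspec[OF m mem(1)] mem(3)])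
    then show "(case i of (a, b) \<Rightarrow> cell_append a b) \<subseteq> (case j of (a, b) \<Rightarrow> cell_append a b) \<longleftrightarrow>
        (case i of (a, b) \<Rightarrow> cell_append (f a) b) \<subseteq> (case j of (a, b) \<Rightarrow> cell_append (f a) b)"
      unfolding ij prod.case cell_append_subset_iff[OF G H mem(1,3,2,4)]
        cell_append_subset_iff[OF G' H fG[OF mem(1)] fG[OF mem(3)] mem(2,4)] by simp
  qed
qed

lemma isomorphic_commute:
  assumes G: "product_complex Gs" and H: "product_complex Hs"
  shows "isomorphic_complexes (Gs @ Hs) (Hs @ Gs)"
proof (rule isomorphic_by_parametrisation[OF cells_append_image])
  show "(\<lambda>(a, b). cell_append b a) ` (cells Gs \<times> cells Hs) = cells (Hs @ Gs)"
    unfolding cells_append by auto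
  fix i j assume "i \<in> cells Gs \<times> cells Hs" "j \<in> cells Gs \<times> cells Hs"
  then obtain a b c d where ij: "i = (a, b)" "j = (c, d)"
    and mem: "a \<in> cells Gs" "b \<in> cells Hs" "c \<in> cells Gs" "d \<in> cells Hs" by blast
  show "(case i of (a, b) \<Rightarrow> cell_append a b) \<subseteq> (case j of (a, b) \<Rightarrow> cell_append a b) \<longleftrightarrow>
      (case i of (a, b) \<Rightarrow> cell_append b a) \<subseteq> (case j of (a, b) \<Rightarrow> cell_append b a)"
    unfolding ij prod.case cell_append_subset_iff[OF G H mem(1,3,2,4)]
      cell_append_subset_iff[OF H G mem(2,4,1,3)] by (rule conj_commute)
qed

lemma product_complex_one_point: "product_complex [one_point]"
  by (auto simp: product_complex_def simplicial_complex_def one_point_def)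

lemma isomorphic_one_point:
  assumes G: "product_complex Gs"
  shows "isomorphic_complexes ([one_point] @ Gs) Gs"
proof -
  let ?p = "listset [{undefined}] :: 'a list set"
  have point: "cells [one_point] = {?p}" by (auto simp: cells_def one_point_def set_Cons_def)
  show ?thesis
  proof (rule isomorphic_by_parametrisation[where p = "cell_append ?p" and q = "\<lambda>b. b"])
    show "cell_append ?p ` cells Gs = cells ([one_point] @ Gs)" unfolding cells_append point by auto
  qed (use cell_append_subset_iff[OF product_complex_one_point G, of ?p ?p] point in auto)
qed

lemma isomorphic_equiv:
  assumes "s \<in> {1, -1}" "product_complex Gs" "product_complex Hs" "isomorphic_complexes Gs Hs"
  shows "{#(s, Gs)#} \<approx> {#(s, Hs)#}"
  using strong_step.isomorphism[OF signed_empty assms] by (simp add: r_into_equivclp)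

lemma splitting_equiv:
  assumes "s \<in> {1, -1}" "product_complex Gs"
  shows "{#(s, Gs)#} \<approx> image_mset (\<lambda>Cs. (s, Cs)) (mset_set (connected_components Gs))"
  using strong_step.splitting[OF signed_empty assms] by (simp add: r_into_equivclp)

lemma image_mset_set_sum:
  assumes "finite S"
  shows "image_mset f (mset_set S) = (\<Sum>x\<in>S. {#f x#})"
  using assms by (induction S rule: finite_induct) simp_all

lemma strong_equiv_sum:
  assumes "finite S" "\<And>x. x \<in> S \<Longrightarrow> A x \<approx> B x" "\<And>x. x \<in> S \<Longrightarrow> is_signed_complex (A x)"
  shows "(\<Sum>x\<in>S. A x) \<approx> (\<Sum>x\<in>S. B x) \<and> is_signed_complex (\<Sum>x\<in>S. A x)"
  using assms
proof (induction S rule: finite_induct)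
  case (insert x S)
  then show ?case by (auto simp: signed_plus intro: strong_equiv_plus)
qed (simp add: signed_empty)

text \<open>
  Both sides split further into the products \<open>Cs @ Ds\<close> of components of the two factors: the right-hand
  side because \<open>Cs\<close>, being connected, is its own only component.
\<close>

lemma splitting_times_equiv:
  assumes s: "s \<in> {1, -1}" and G: "product_complex Gs" and H: "product_complex Hs"
  shows "{#(s, Gs @ Hs)#} \<approx> (\<Sum>Cs\<in>connected_components Gs. {#(s, Cs @ Hs)#})"
proof -
  let ?I = "connected_components Gs" and ?J = "connected_components Hs"
  have fin: "finite ?I" "finite ?J" using finite_components G H by auto
  have C: "product_complex Cs" if "Cs \<in> ?I" for Cs using component_cells(1)[OF that] .
  have "{#(s, Cs @ Hs)#} \<approx> (\<Sum>Ds\<in>?J. {#(s, Cs @ Ds)#})" if I: "Cs \<in> ?I" for Cs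
  proof -
    have "{#(s, Cs @ Hs)#} \<approx> (\<Sum>Es\<in>connected_components (Cs @ Hs). {#(s, Es)#})"
      using splitting_equiv[OF s product_complex_append[OF C[OF I] H]]
        finite_components[OF product_complex_append[OF C[OF I] H]]
      by (simp add: image_mset_set_sum)
    also have "connected_components (Cs @ Hs) = (\<lambda>Ds. Cs @ Ds) ` ?J"
      using components_append(1)[OF C[OF I] H] components_of_component[OF I] by auto
    also have "(\<Sum>Es\<in>(\<lambda>Ds. Cs @ Ds) ` ?J. {#(s, Es)#}) = (\<Sum>Ds\<in>?J. {#(s, Cs @ Ds)#})"
      by (subst sum.reindex) (auto simp: inj_on_def)
    finally show ?thesis .
  qed
  moreover have "is_signed_complex {#(s, Cs @ Hs)#}" if "Cs \<in> ?I" for Cs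
    using s product_complex_append[OF C[OF that] H] by (simp add: signed_single)
  ultimately have right: "(\<Sum>Cs\<in>?I. {#(s, Cs @ Hs)#}) \<approx> (\<Sum>Cs\<in>?I. \<Sum>Ds\<in>?J. {#(s, Cs @ Ds)#})"
    by (rule conjunct1[OF strong_equiv_sum[OF fin(1)]])
  have "{#(s, Gs @ Hs)#} \<approx> (\<Sum>Es\<in>connected_components (Gs @ Hs). {#(s, Es)#})"
    using splitting_equiv[OF s product_complex_append[OF G H]]
      finite_components[OF product_complex_append[OF G H]]
    by (simp add: image_mset_set_sum)
  also have "(\<Sum>Es\<in>connected_components (Gs @ Hs). {#(s, Es)#})
      = (\<Sum>Cs\<in>?I. \<Sum>Ds\<in>?J. {#(s, Cs @ Ds)#})"
    unfolding components_append(1)[OF G H] sum.reindex[OF components_append(2)[OF G H]]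
    by (simp add: sum.cartesian_product case_prod_unfold)
  finally show ?thesis by (rule equivclp_trans) (rule equivclp_sym[OF right])
qed

lemma strong_step_times_single:
  assumes "strong_step A A'" and t: "t \<in> {1, -1}" and H: "product_complex Hs"
  shows "signed_times A {#(t, Hs)#} \<approx> signed_times A' {#(t, Hs)#}"
  using assms(1)
proof cases
  case (isomorphism C s Gs Gs')
  have st: "s * t \<in> {1, -1}" using isomorphism(4) t by auto
  have "{#(s * t, Gs @ Hs)#} \<approx> {#(s * t, Gs' @ Hs)#}"
    using isomorphism H st by (intro isomorphic_equiv isomorphic_append product_complex_append) auto
  then have "signed_times C {#(t, Hs)#} + {#(s * t, Gs @ Hs)#}
      \<approx> signed_times C {#(t, Hs)#} + {#(s * t, Gs' @ Hs)#}"
    using isomorphism H st t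
    by (intro strong_equiv_plus) (auto simp: signed_single product_complex_append intro: signed_times_signed)
  then show ?thesis using isomorphism by (simp only: signed_times_plus signed_times_single)
next
  case (splitting C s Gs)
  have st: "s * t \<in> {1, -1}" using splitting(4) t by auto
  have fin: "finite (connected_components Gs)" using splitting finite_components by blast
  have "signed_times (image_mset (\<lambda>Cs. (s, Cs)) (mset_set (connected_components Gs))) {#(t, Hs)#}
      = (\<Sum>Cs\<in>connected_components Gs. {#(s * t, Cs @ Hs)#})"
    unfolding image_mset_set_sum[OF fin] using fin
    by (induction rule: finite_induct) (simp_all add: signed_times_add_mset)
  moreover have "signed_times C {#(t, Hs)#} + {#(s * t, Gs @ Hs)#}
      \<approx> signed_times C {#(t, Hs)#} + (\<Sum>Cs\<in>connected_components Gs. {#(s * t, Cs @ Hs)#})"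
    using splitting H st t splitting_times_equiv
    by (intro strong_equiv_plus) (auto simp: signed_single product_complex_append intro: signed_times_signed)
  ultimately show ?thesis using splitting by (simp only: signed_times_plus signed_times_single)
next
  case (cancellation B)
  let ?T = "{#(t, Hs)#}"
  have T: "is_signed_complex ?T" using t H by (simp add: signed_single)
  have "strong_step (signed_times A' ?T + (signed_times B ?T + signed_minus (signed_times B ?T)))
      (signed_times A' ?T)"
    using cancellation T by (intro strong_step.cancellation signed_times_signed)
  then show ?thesis
    using cancellation by (simp add: signed_times_plus signed_times_minus r_into_equivclp)
qed

lemma strong_equiv_times_left:
  assumes "A \<approx> A'" "is_signed_complex A" "is_signed_complex B"
  shows "signed_times A B \<approx> signed_times A' B"
  using assms(3)
proof (induction B rule: signed_complex_induct)
  case (add B t Hs)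
  have T: "is_signed_complex {#(t, Hs)#}" using add.hyps by (simp add: signed_single)
  have "signed_times A {#(t, Hs)#} \<approx> signed_times A' {#(t, Hs)#}"
    using strong_equiv_lift[where h = "\<lambda>A. signed_times A {#(t, Hs)#}", OF strong_step_times_single assms(1)]
      add.hyps by blast
  then show ?case
    unfolding signed_times_plus using add T assms(2)
    by (intro strong_equiv_plus signed_times_signed) auto
qed simp

lemma signed_times_commute:
  assumes "is_signed_complex A" "is_signed_complex B"
  shows "signed_times A B \<approx> signed_times B A"
  using assms(1)
proof (induction A rule: signed_complex_induct)
  case (add A s Gs)
  have S: "is_signed_complex {#(s, Gs)#}" using add.hyps by (simp add: signed_single)
  have "signed_times {#(s, Gs)#} B \<approx> signed_times B {#(s, Gs)#}"
    using assms(2)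
  proof (induction B rule: signed_complex_induct)
    case (add B t Hs)
    have T: "is_signed_complex {#(t, Hs)#}" using add.hyps by (simp add: signed_single)
    have "{#(s * t, Gs @ Hs)#} \<approx> {#(t * s, Hs @ Gs)#}"
      unfolding mult.commute[of t s] using add.hyps \<open>s \<in> {1, -1}\<close> \<open>product_complex Gs\<close>
      by (intro isomorphic_equiv isomorphic_commute product_complex_append) auto
    then have "signed_times {#(s, Gs)#} {#(t, Hs)#} \<approx> signed_times {#(t, Hs)#} {#(s, Gs)#}"
      by (simp only: signed_times_single)
    then show ?case
      unfolding signed_times_plus using add T S
      by (intro strong_equiv_plus signed_times_signed) auto
  qed simp
  then show ?case
    unfolding signed_times_plus using add S assms(2)
    by (intro strong_equiv_plus signed_times_signed) auto
qed simp

lemma strong_equiv_times: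
  assumes "A \<approx> A'" "B \<approx> B'" "is_signed_complex A" "is_signed_complex B"
  shows "signed_times A B \<approx> signed_times A' B'"
proof -
  have s: "is_signed_complex A'" "is_signed_complex B'"
    using strong_equiv_signed assms by blast+
  have "signed_times A B \<approx> signed_times A' B" by (rule strong_equiv_times_left[OF assms(1,3,4)])
  also have "\<dots> \<approx> signed_times B A'" by (rule signed_times_commute[OF s(1) assms(4)])
  also have "\<dots> \<approx> signed_times B' A'" by (rule strong_equiv_times_left[OF assms(2,4) s(1)])
  also have "\<dots> \<approx> signed_times A' B'" by (rule signed_times_commute[OF s(2,1)])
  finally show ?thesis .
qed

lemma signed_times_one:
  assumes "is_signed_complex A"
  shows "signed_times {#(1, [one_point])#} A \<approx> A"
  using assms
proof (induction A rule: signed_complex_induct)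
  case (add A s Gs)
  have one: "is_signed_complex {#(1, [one_point])#}"
    by (simp add: signed_single product_complex_one_point)
  have S: "is_signed_complex {#(s, Gs)#}" using add.hyps by (simp add: signed_single)
  have "{#(s, [one_point] @ Gs)#} \<approx> {#(s, Gs)#}"
    using add.hyps
    by (intro isomorphic_equiv isomorphic_one_point product_complex_append product_complex_one_point) auto
  then have "signed_times {#(1, [one_point])#} {#(s, Gs)#} \<approx> {#(s, Gs)#}"
    by (simp only: signed_times_single mult_1_left)
  then show ?case
    unfolding signed_times_plus using add S one
    by (intro strong_equiv_plus signed_times_signed) auto
qed simp

lemma strong_class_eq_iff: "strong_class A = strong_class B \<longleftrightarrow> A \<approx> B"
proof
  assume eq: "strong_class A = strong_class B"
  have "B \<in> strong_class B" by (simp add: strong_class_def)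
  then have "B \<in> strong_class A" unfolding eq .
  then show "A \<approx> B" by (simp add: strong_class_def)
next
  assume eq: "A \<approx> B"
  have "A \<approx> D \<longleftrightarrow> B \<approx> D" for D
    using equivclp_trans[OF eq, of D] equivclp_trans[OF equivclp_sym[OF eq], of D] by (rule iffI[rotated])
  then show "strong_class A = strong_class B" by (simp add: strong_class_def)
qed

text \<open>
  The union that defines the sum of two classes is a union of equal sets.
\<close>

lemma strong_class_plus:
  assumes "is_signed_complex A" "is_signed_complex B"
  shows "(\<Union>A'\<in>strong_class A. \<Union>B'\<in>strong_class B. strong_class (A' + B')) = strong_class (A + B)"
proof -
  have eq: "strong_class (A' + B') = strong_class (A + B)"
    if "A' \<in> strong_class A" "B' \<in> strong_class B" for A' B'
  proof -
    have "A \<approx> A'" "B \<approx> B'" using that by (simp_all add: strong_class_def)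
    then have "A + B \<approx> A' + B'" using assms by (rule strong_equiv_plus)
    then show ?thesis unfolding strong_class_eq_iff by (rule equivclp_sym)
  qed
  have mem: "A \<in> strong_class A" "B \<in> strong_class B" by (simp_all add: strong_class_def)
  show ?thesis
  proof (rule subset_antisym; rule subsetI)
    fix D assume "D \<in> (\<Union>A'\<in>strong_class A. \<Union>B'\<in>strong_class B. strong_class (A' + B'))"
    then obtain A' B' where "A' \<in> strong_class A" "B' \<in> strong_class B" "D \<in> strong_class (A' + B')"
      by blast
    then show "D \<in> strong_class (A + B)" using eq by simp
  next
    fix D assume "D \<in> strong_class (A + B)"
    with mem show "D \<in> (\<Union>A'\<in>strong_class A. \<Union>B'\<in>strong_class B. strong_class (A' + B'))"
      by (intro UN_I)
  qed
qed

lemma strong_class_times: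
  assumes "is_signed_complex A" "is_signed_complex B"
  shows "(\<Union>A'\<in>strong_class A. \<Union>B'\<in>strong_class B. strong_class (signed_times A' B'))
    = strong_class (signed_times A B)"
proof -
  have eq: "strong_class (signed_times A' B') = strong_class (signed_times A B)"
    if "A' \<in> strong_class A" "B' \<in> strong_class B" for A' B'
  proof -
    have "A \<approx> A'" "B \<approx> B'" using that by (simp_all add: strong_class_def)
    then have "signed_times A B \<approx> signed_times A' B'" using assms by (rule strong_equiv_times)
    then show ?thesis unfolding strong_class_eq_iff by (rule equivclp_sym)
  qed
  have mem: "A \<in> strong_class A" "B \<in> strong_class B" by (simp_all add: strong_class_def)
  show ?thesis
  proof (rule subset_antisym; rule subsetI)
    fix D assume "D \<in> (\<Union>A'\<in>strong_class A. \<Union>B'\<in>strong_class B. strong_class (signed_times A' B'))"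
    then obtain A' B' where "A' \<in> strong_class A" "B' \<in> strong_class B" "D \<in> strong_class (signed_times A' B')"
      by blast
    then show "D \<in> strong_class (signed_times A B)" using eq by simp
  next
    fix D assume "D \<in> strong_class (signed_times A B)"
    with mem show "D \<in> (\<Union>A'\<in>strong_class A. \<Union>B'\<in>strong_class B. strong_class (signed_times A' B'))"
      by (intro UN_I)
  qed
qed

lemma strong_ring_simps:
  "carrier strong_ring = strong_class ` {A. is_signed_complex A}"
  "\<one>\<^bsub>strong_ring\<^esub> = strong_class {#(1, [one_point])#}"
  "\<zero>\<^bsub>strong_ring\<^esub> = strong_class {#}"
  "is_signed_complex A \<Longrightarrow> is_signed_complex B \<Longrightarrow>
    strong_class A \<otimes>\<^bsub>strong_ring\<^esub> strong_class B = strong_class (signed_times A B)"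
  "is_signed_complex A \<Longrightarrow> is_signed_complex B \<Longrightarrow>
    strong_class A \<oplus>\<^bsub>strong_ring\<^esub> strong_class B = strong_class (A + B)"
  by (simp_all add: strong_ring_def strong_class_plus strong_class_times)

lemma signed_one: "is_signed_complex {#(1, [one_point])#}"
  by (simp add: signed_single product_complex_one_point)

theorem cring_strong_ring: "cring (strong_ring :: 'a signed_complex set ring)"
proof (rule cringI)
  show "abelian_group (strong_ring :: 'a signed_complex set ring)"
  proof (rule abelian_groupI)
    fix P :: "'a signed_complex set" assume "P \<in> carrier strong_ring"
    then obtain A where A: "P = strong_class A" "is_signed_complex A" by (auto simp: strong_ring_simps)
    have "strong_step ({#} + (A + signed_minus A)) {#}"
      by (rule strong_step.cancellation[OF signed_empty A(2)])
    then have "signed_minus A + A \<approx> {#}" by (simp add: r_into_equivclp add.commute)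
    then show "\<exists>Q\<in>carrier strong_ring. Q \<oplus>\<^bsub>strong_ring\<^esub> P = \<zero>\<^bsub>strong_ring\<^esub>"
      using A signed_minus_signed[OF A(2)]
      by (intro bexI[of _ "strong_class (signed_minus A)"]) (auto simp: strong_ring_simps strong_class_eq_iff)
  qed (auto simp: strong_ring_simps signed_plus signed_empty add_ac)
  have "strong_class (signed_times {#(1, [one_point])#} A) = strong_class A" if "is_signed_complex A"
    for A :: "'a signed_complex"
    unfolding strong_class_eq_iff by (rule signed_times_one[OF that])
  moreover have "strong_class (signed_times A B) = strong_class (signed_times B A)"
    if "is_signed_complex A" "is_signed_complex B" for A B :: "'a signed_complex"
    unfolding strong_class_eq_iff by (rule signed_times_commute[OF that])
  ultimately show "comm_monoid (strong_ring :: 'a signed_complex set ring)"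
    by (intro comm_monoidI)
      (auto simp only: strong_ring_simps signed_times_signed signed_one signed_times_assoc
        mem_Collect_eq image_iff intro: imageI)
qed (auto simp: strong_ring_simps signed_plus signed_times_plus signed_times_signed)

section \<open>The Poincare polynomial as a ring homomorphism\<close>

text \<open>
  The Poincare polynomial with real coefficients, where the trace polynomials live.
\<close>

definition signed_poly ::
  "('a set set \<Rightarrow> 'a set \<Rightarrow> 'a list) \<Rightarrow> 'a signed_complex \<Rightarrow> real poly" where
  "signed_poly ori A = (\<Sum>(s, Gs)\<in>#A. smult (of_int s) (betti_poly ori Gs))"

lemma signed_poly_simps:
  "signed_poly ori {#} = 0"
  "signed_poly ori (A + B) = signed_poly ori A + signed_poly ori B"
  "signed_poly ori {#(s, Gs)#} = smult (of_int s) (betti_poly ori Gs)"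
  "signed_poly ori (add_mset (s, Gs) A) = smult (of_int s) (betti_poly ori Gs) + signed_poly ori A"
  by (simp_all add: signed_poly_def)

context orientation
begin

lemma coeff_signed_poly:
  assumes "is_signed_complex A"
  shows "poly.coeff (signed_poly ori A) k = of_int (signed_betti ori k A)"
  using assms
proof (induction A rule: signed_complex_induct)
  case (add A s Gs)
  then have "poly.coeff (betti_poly ori Gs) k = real (betti ori k Gs)"
    by (intro coeff_betti_poly) (simp add: product_complex_def)
  then show ?case using add.IH by (simp add: signed_poly_simps signed_betti_def)
qed (simp add: signed_poly_def signed_betti_def)

text \<open>
  The degree of the real polynomial bounds the range of the sum in the definition of the integral
  one.
\<close>

lemma coeff_poincare_poly:
  assumes "is_signed_complex A"
  shows "of_int (poly.coeff (poincare_poly ori A) k) = poly.coeff (signed_poly ori A) k"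
proof -
  have "{k. signed_betti ori k A \<noteq> 0} \<subseteq> {..degree (signed_poly ori A)}"
    using coeff_signed_poly[OF assms] by (auto intro!: le_degree)
  then have "finite {k. signed_betti ori k A \<noteq> 0}" by (rule finite_subset) simp
  then have "poly.coeff (poincare_poly ori A) k = signed_betti ori k A"
    by (auto simp: poincare_poly_def coeff_sum)
  then show ?thesis using coeff_signed_poly[OF assms] by simp
qed

lemma poincare_poly_eqI:
  assumes "is_signed_complex A"
    and "\<And>k. of_int (poly.coeff p k) = poly.coeff (signed_poly ori A) k"
  shows "poincare_poly ori A = p"
proof (rule poly_eqI)
  fix k
  have "(of_int (poly.coeff (poincare_poly ori A) k) :: real) = of_int (poly.coeff p k)"
    using coeff_poincare_poly[OF assms(1)] assms(2) by simp
  then show "poly.coeff (poincare_poly ori A) k = poly.coeff p k" by (simp only: of_int_eq_iff)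
qed

lemma signed_poly_times:
  assumes "is_signed_complex A" "is_signed_complex B"
  shows "signed_poly ori (signed_times A B) = signed_poly ori A * signed_poly ori B"
  using assms(1)
proof (induction A rule: signed_complex_induct)
  case (add A s Gs)
  have "signed_poly ori (signed_times {#(s, Gs)#} B) = signed_poly ori {#(s, Gs)#} * signed_poly ori B"
    using assms(2)
  proof (induction B rule: signed_complex_induct)
    case (add B t Hs)
    have "betti_poly ori (Gs @ Hs) = betti_poly ori Gs * betti_poly ori Hs"
      using add.hyps \<open>product_complex Gs\<close> by (intro betti_poly_append) (auto simp: product_complex_def)
    then show ?case using add.IH
      unfolding signed_times_plus signed_times_single signed_poly_simps distrib_left
      by (simp add: mult.commute)
  qed (simp add: signed_poly_simps)
  then show ?case unfolding signed_times_plus signed_poly_simps distrib_right using add.IH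
    by (simp add: signed_poly_simps)
qed (simp add: signed_poly_simps)

text \<open>
  The three identifications correspond to the dependence on the poset of cells only, to additivity over
  components, and to signs.
\<close>

lemma signed_poly_step:
  assumes "strong_step A B"
  shows "signed_poly ori A = signed_poly ori B"
  using assms
proof cases
  case (isomorphism C s Gs Hs)
  then show ?thesis using betti_poly_isomorphic by (simp add: signed_poly_simps)
next
  case (splitting C s Gs)
  have "signed_poly ori (image_mset (\<lambda>Cs. (s, Cs)) (mset_set (connected_components Gs)))
      = (\<Sum>Cs\<in>connected_components Gs. smult (of_int s) (betti_poly ori Cs))"
    by (simp add: signed_poly_def image_mset.compositionality o_def sum_unfold_sum_mset)
  also have "\<dots> = smult (of_int s) (betti_poly ori Gs)"
    unfolding betti_poly_components[OF splitting(5)]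
    by (rule poly_eqI) (simp add: coeff_sum sum_distrib_left)
  finally show ?thesis using splitting by (simp add: signed_poly_simps)
next
  case (cancellation C)
  have "signed_poly ori (signed_minus C) = - signed_poly ori C"
    by (induction C) (auto simp: signed_poly_def signed_minus_def)
  then show ?thesis using cancellation by (simp add: signed_poly_simps)
qed

lemma poincare_poly_equiv:
  assumes "A \<approx> B" "is_signed_complex A"
  shows "poincare_poly ori A = poincare_poly ori B"
proof -
  have "signed_poly ori A = signed_poly ori B"
    using assms(1) by (induction rule: equivclp_induct) (auto dest: signed_poly_step)
  then show ?thesis
    using coeff_poincare_poly[OF strong_equiv_signed[OF assms]] assms(2)
    by (intro poincare_poly_eqI) simp_all
qed

lemma poincare_map_strong_class:
  assumes "is_signed_complex A"
  shows "poincare_map ori (strong_class A) = poincare_poly ori A"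
proof -
  have "poincare_poly ori ` strong_class A = {poincare_poly ori A}"
    using poincare_poly_equiv[OF _ assms] by (auto simp: strong_class_def intro!: image_eqI[of _ _ A])
  then show ?thesis by (simp add: poincare_map_def)
qed

lemma poincare_poly_plus:
  assumes "is_signed_complex A" "is_signed_complex B"
  shows "poincare_poly ori (A + B) = poincare_poly ori A + poincare_poly ori B"
  using assms
  by (intro poincare_poly_eqI) (simp_all add: signed_plus signed_poly_simps coeff_poincare_poly)

lemma poincare_poly_times:
  assumes "is_signed_complex A" "is_signed_complex B"
  shows "poincare_poly ori (signed_times A B) = poincare_poly ori A * poincare_poly ori B"
  using assms
  by (intro poincare_poly_eqI signed_times_signed)
    (simp_all add: signed_poly_times coeff_mult coeff_poincare_poly)

text \<open>
  There is a single cell and no incidence, so every function is harmonic.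
\<close>

lemma betti_poly_one_point: "betti_poly ori [one_point] = 1"
proof -
  let ?p = "{undefined} :: 'a set"
  have "simplex_incidence ori one_point x y = 0" for x y
    by (auto simp: simplex_incidence_def one_point_def)
  then have zero: "incidence ori [one_point] xs ys = 0" for xs ys
    by (auto simp: cons_incidence_def split: list.splits)
  have cells: "listset [one_point] = {[?p]}" by (auto simp: one_point_def set_Cons_def)
  have "harmonic_kernel (listset [one_point]) (incidence ori [one_point]) (\<lambda>x y. of_bool (x = [?p]))"
    unfolding cells
    by (auto simp: harmonic_kernel_def harmonic_def functions_on_def dirac_def zero simp del: incidence.simps)
  moreover have "\<forall>K\<in>set [one_point]. simplicial_complex (K :: 'a set set)"
    using product_complex_one_point by (simp add: product_complex_def)
  ultimately have "betti_poly ori [one_point]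
      = trace_poly (listset [one_point]) cell_dim (\<lambda>x y. of_bool (x = [?p]))"
    by (intro betti_poly_eq_trace)
  then show ?thesis unfolding cells by (simp add: trace_poly_def)
qed

lemma poincare_poly_one: "poincare_poly ori {#(1, [one_point])#} = 1"
  by (rule poincare_poly_eqI[OF signed_one])
    (simp add: signed_poly_simps betti_poly_one_point coeff_pCons split: nat.splits)

end

theorem theorem4:
  fixes ori :: "'a set set \<Rightarrow> 'a set \<Rightarrow> 'a list"
  assumes "is_orientation ori"
  shows "(\<forall>A. is_signed_complex A \<longrightarrow>
            poincare_map ori (strong_class A) = poincare_poly ori A) \<and>
         ring_hom_cring strong_ring (ring_of_type_algebra :: int poly ring) (poincare_map ori)"
proof -
  interpret orientation ori using assms by unfold_locales
  have "poincare_map ori \<in> ring_hom strong_ring (ring_of_type_algebra :: int poly ring)"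
    by (rule ring_hom_memI)
      (auto simp: strong_ring_simps ring_of_type_algebra_def poincare_map_strong_class signed_plus
        signed_times_signed poincare_poly_plus poincare_poly_times poincare_poly_one signed_one)
  then have "ring_hom_cring strong_ring (ring_of_type_algebra :: int poly ring) (poincare_map ori)"
    by (intro ring_hom_cring.intro ring_hom_cring_axioms.intro cring_strong_ring cring_from_type_algebra)
  then show ?thesis using poincare_map_strong_class by blast
qed

end
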